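(* Let $M$ be a finite-dimensional Riemannian manifold and let $S\subseteq M$ be a closed prox-regular set whose boundary $\partial S$ is a $C^2$ Riemannian submanifold of $M$. Let $\gamma:[a,b]\to M$ be a unit speed admissible curve in $S$. If $\gamma$ is minimizing in $S$, then $$D_t\dot\gamma(t)\in N^P_S(\gamma(t))$$ for every $t\in[a,b]$ except for finitely many points.
   Context: $M$ carries a Riemannian metric $\langle\cdot,\cdot\rangle$ with Riemannian distance $d$; $B(x,r)$ is the open metric ball. A convex set (or neighborhood, or ball) in $M$ means a strongly convex one: any two of its points are joined by a unique minimizing geodesic of $M$, and this geodesic lies in the set; for $x,y$ in a convex neighborhood, $\exp_x^{-1}y$ is the initial velocity of the minimizing geodesic $[0,1]\to M$ from $x$ to $y$. $D_t$ denotes the covariant derivative along a curve for the Levi-Civita connection of $M$. Proximal normal cone: for a nonempty closed $S\subseteq M$ and $x\in S$, $\xi\in T_xM$ belongs to $N^P_S(x)$ iff there is $\sigma>0$ such that $\langle\xi,\exp_x^{-1}y\rangle\le\sigma\, d^2(x,y)$ for every $y\in U\cap S$, where $U$ is a convex neighborhood of $x$. Prox-regular: a closed set $S\subseteq M$ is prox-regular at $\bar x\in S$ if there exist $\varepsilon>0$ and $\sigma>0$ such that $B(\bar x,\varepsilon)$ is convex and for every $x\in S\cap B(\bar x,\varepsilon)$ and $v\in N^P_S(x)$ with $\|v\|<\varepsilon$ one has $\langle v,\exp_x^{-1}y\rangle\le\sigma\,d^2(x,y)$ for every $y\in S\cap B(\bar x,\varepsilon)$. $S$ is prox-regular if it is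 so at each of its points. A piecewise regular curve is a continuous map $\gamma:[a,b]\to M$ that is piecewise $C^2$ (i.e. $C^2$ on each closed subinterval of some finite partition of $[a,b]$) with nonzero derivatives. An admissible curve in $S$ is a piecewise regular curve whose image lies entirely in $S$. An admissible curve $\gamma$ in $S$ is minimizing if $\mathcal{L}(\gamma)\le\mathcal{L}(\tilde\gamma)$ for all admissible curves $\tilde\gamma$ in $S$ with the same endpoints, where $\mathcal{L}$ denotes the length in $M$. *)

theory Defs
  imports "HOL-Analysis.Analysis" "HOL-Library.Extended_Real"
begin

section \<open>Maps of class \<open>C\<^sup>k\<close> between Euclidean spaces\<close>

text \<open>Meant for open sets \<open>U\<close>: continuity at level 0, and at level \<open>Suc k\<close> differentiability
  with all directional derivatives of class \<open>C\<^sup>k\<close>.\<close>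

primrec Ck_on :: "nat \<Rightarrow> ('a::euclidean_space \<Rightarrow> 'b::euclidean_space) \<Rightarrow> 'a set \<Rightarrow> bool" where
  "Ck_on 0 f U \<longleftrightarrow> continuous_on U f"
| "Ck_on (Suc k) f U \<longleftrightarrow>
     (\<forall>x\<in>U. f differentiable (at x)) \<and> (\<forall>v. Ck_on k (\<lambda>x. frechet_derivative f (at x) v) U)"

definition smooth_on :: "('a::euclidean_space \<Rightarrow> 'b::euclidean_space) \<Rightarrow> 'a set \<Rightarrow> bool" where
  "smooth_on f U \<longleftrightarrow> (\<forall>k. Ck_on k f U)"


section \<open>Smooth manifolds\<close>

text \<open>A chart is a pair of its domain and its coordinate map; the map is only relevant on the
  domain. The manifold itself is the whole type \<open>'m\<close>, and its dimension is \<open>CARD('n)\<close>.\<close>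

type_synonym ('m, 'n) chart = "'m set \<times> ('m \<Rightarrow> real^'n)"

definition chart_inv :: "('m, 'n) chart \<Rightarrow> real^'n \<Rightarrow> 'm" where
  "chart_inv c = inv_into (fst c) (snd c)"

text \<open>The coordinate change from \<open>c\<close> to \<open>c'\<close>, to be used on \<open>snd c ` (fst c \<inter> fst c')\<close>.\<close>

definition transition :: "('m, 'n) chart \<Rightarrow> ('m, 'n) chart \<Rightarrow> real^'n \<Rightarrow> real^'n" where
  "transition c c' = snd c' \<circ> chart_inv c"

text \<open>A tangent vector is given by its components in all charts. Components in charts
  that are not in the atlas, or not defined at the base point, are set to 0, so that equality
  of tangent vectors is equality of functions and the zero vector is \<open>\<lambda>_. 0\<close>.\<close>

type_synonym ('m, 'n) tvec = "('m, 'n) chart \<Rightarrow> real^'n"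

locale smooth_manifold =
  fixes A :: "('m::{t2_space,second_countable_topology}, 'n::finite) chart set"
  assumes dom_open: "c \<in> A \<Longrightarrow> open (fst c)"
    and image_open: "c \<in> A \<Longrightarrow> open (snd c ` fst c)"
    and homeo: "c \<in> A \<Longrightarrow> homeomorphism (fst c) (snd c ` fst c) (snd c) (chart_inv c)"
    and cover: "(\<Union>c\<in>A. fst c) = UNIV"
    and compatible: "c \<in> A \<Longrightarrow> c' \<in> A \<Longrightarrow>
      smooth_on (transition c c') (snd c ` (fst c \<inter> fst c'))"
begin

definition tangent_space :: "'m \<Rightarrow> ('m, 'n) tvec set" where
  "tangent_space x = {\<xi>.
     (\<forall>c. c \<notin> A \<or> x \<notin> fst c \<longrightarrow> \<xi> c = 0) \<and>
     (\<forall>c\<in>A. \<forall>c'\<in>A. x \<in> fst c \<inter> fst c' \<longrightarrow>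
        \<xi> c' = frechet_derivative (transition c c') (at (snd c x)) (\<xi> c))}"

text \<open>The tangent vector at \<open>x\<close> with components \<open>v\<close> in the chart \<open>c\<close>.\<close>

definition coord_vec :: "('m, 'n) chart \<Rightarrow> 'm \<Rightarrow> real^'n \<Rightarrow> ('m, 'n) tvec" where
  "coord_vec c x v = (\<lambda>c'. if c' \<in> A \<and> x \<in> fst c'
     then frechet_derivative (transition c c') (at (snd c x)) v else 0)"

text \<open>\<open>C\<^sup>2\<close> curves on a nondegenerate closed interval \<open>I\<close>, with one-sided derivatives at the
  end points. Only the parameters \<open>t \<in> I\<close> with \<open>\<gamma> t\<close> in the domain of the chart matter.\<close>

definition C2_curve_on :: "(real \<Rightarrow> 'm) \<Rightarrow> real set \<Rightarrow> bool" where
  "C2_curve_on \<gamma> I \<longleftrightarrow> continuous_on I \<gamma> \<and>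
     (\<forall>c\<in>A. \<exists>v w.
        (\<forall>t\<in>I. \<gamma> t \<in> fst c \<longrightarrow>
           ((snd c \<circ> \<gamma>) has_vector_derivative v t) (at t within I) \<and>
           (v has_vector_derivative w t) (at t within I)) \<and>
        continuous_on {t\<in>I. \<gamma> t \<in> fst c} w)"

definition velocity :: "(real \<Rightarrow> 'm) \<Rightarrow> real set \<Rightarrow> real \<Rightarrow> ('m, 'n) tvec" where
  "velocity \<gamma> I t = (\<lambda>c. if c \<in> A \<and> \<gamma> t \<in> fst c
     then vector_derivative (snd c \<circ> \<gamma>) (at t within I) else 0)"

definition piecewise_regular :: "(real \<Rightarrow> 'm) \<Rightarrow> real \<Rightarrow> real \<Rightarrow> bool" where
  "piecewise_regular \<gamma> a b \<longleftrightarrow> a < b \<and> continuous_on {a..b} \<gamma> \<and>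
     (\<exists>(p::nat \<Rightarrow> real) n. p 0 = a \<and> p n = b \<and>
        (\<forall>i<n. p i < p (Suc i) \<and>
           C2_curve_on \<gamma> {p i..p (Suc i)} \<and>
           (\<forall>t\<in>{p i..p (Suc i)}. velocity \<gamma> {p i..p (Suc i)} t \<noteq> (\<lambda>_. 0))))"

definition admissible :: "'m set \<Rightarrow> (real \<Rightarrow> 'm) \<Rightarrow> real \<Rightarrow> real \<Rightarrow> bool" where
  "admissible S \<gamma> a b \<longleftrightarrow> piecewise_regular \<gamma> a b \<and> \<gamma> ` {a..b} \<subseteq> S"

text \<open>Embedded \<open>C\<^sup>2\<close> submanifolds of dimension \<open>k\<close>: around each point some \<open>C\<^sup>2\<close> change \<open>\<psi>\<close> of the
  coordinates flattens \<open>N\<close> to a \<open>k\<close>-dimensional linear slice.\<close>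

definition C2_submanifold :: "nat \<Rightarrow> 'm set \<Rightarrow> bool" where
  "C2_submanifold k N \<longleftrightarrow>
     (\<forall>x\<in>N. \<exists>c\<in>A. \<exists>V \<psi> L.
        open V \<and> x \<in> V \<and> V \<subseteq> fst c \<and>
        inj_on \<psi> (snd c ` V) \<and> open (\<psi> ` snd c ` V) \<and>
        Ck_on 2 \<psi> (snd c ` V) \<and> Ck_on 2 (inv_into (snd c ` V) \<psi>) (\<psi> ` snd c ` V) \<and>
        subspace (L :: (real^'n) set) \<and> dim L = k \<and>
        \<psi> ` snd c ` (V \<inter> N) = \<psi> ` snd c ` V \<inter> L)"

lemma coord_vec_tangent:
  assumes c: "c \<in> A" and x: "x \<in> fst c"
  shows "coord_vec c x v \<in> tangent_space x"
proof -
  have D: "frechet_derivative (transition c2 c3) (at (snd c2 x))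
        (frechet_derivative (transition c c2) (at (snd c x)) v)
      = frechet_derivative (transition c c3) (at (snd c x)) v"
    if c2: "c2 \<in> A" "x \<in> fst c2" and c3: "c3 \<in> A" "x \<in> fst c3" for c2 c3
  proof -
    have diff: "transition d d' differentiable (at (snd d x))"
      if "d \<in> A" "d' \<in> A" "x \<in> fst d" "x \<in> fst d'" for d d'
    proof -
      have "Ck_on (Suc 0) (transition d d') (snd d ` (fst d \<inter> fst d'))"
        using compatible that unfolding smooth_on_def by blast
      then show ?thesis using that by auto
    qed
    let ?U = "snd c ` (fst c \<inter> fst c2 \<inter> fst c3)"
    have hom: "homeomorphism (fst c) (snd c ` fst c) (snd c) (chart_inv c)"
      using homeo c by blast
    have "openin (top_of_set (snd c ` fst c)) ?U"
    proof (rule homeomorphism_imp_open_map[OF hom])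
      show "openin (top_of_set (fst c)) (fst c \<inter> fst c2 \<inter> fst c3)"
        using open_Int[OF dom_open[OF c2(1)] dom_open[OF c3(1)]]
        by (auto simp: openin_open Int_assoc)
    qed
    then have op: "open ?U" using image_open[OF c] openin_open_trans by blast
    have xU: "snd c x \<in> ?U" using x c2 c3 by auto
    have inv: "chart_inv c (snd c y) = y" if "y \<in> fst c" for y
      using hom that by (simp add: homeomorphism_def)
    have inv2: "chart_inv c2 (snd c2 y) = y" if "y \<in> fst c2" for y
      using homeo[OF c2(1)] that by (simp add: homeomorphism_def)
    have pt: "transition c c2 (snd c x) = snd c2 x"
      using inv x by (simp add: transition_def)
    have d1: "(transition c c2 has_derivative frechet_derivative (transition c c2) (at (snd c x))) (at (snd c x))"
      using diff[OF c c2(1) x c2(2)] frechet_derivative_works by blast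
    have d2: "(transition c2 c3 has_derivative frechet_derivative (transition c2 c3) (at (snd c2 x)))
        (at (transition c c2 (snd c x)))"
      using diff[OF c2(1) c3(1) c2(2) c3(2)] frechet_derivative_works pt by metis
    have d3: "(transition c2 c3 \<circ> transition c c2 has_derivative
        frechet_derivative (transition c2 c3) (at (snd c2 x)) \<circ>
        frechet_derivative (transition c c2) (at (snd c x))) (at (snd c x))"
      using diff_chain_at[OF d1 d2] .
    have "(transition c c3 has_derivative
        frechet_derivative (transition c2 c3) (at (snd c2 x)) \<circ>
        frechet_derivative (transition c c2) (at (snd c x))) (at (snd c x))"
    proof (rule has_derivative_transform_within_open[OF d3 op xU])
      fix y assume "y \<in> ?U"
      then show "(transition c2 c3 \<circ> transition c c2) y = transition c c3 y"
        using inv inv2 by (auto simp: transition_def)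
    qed
    then show ?thesis by (metis comp_apply frechet_derivative_at)
  qed
  show ?thesis
    unfolding tangent_space_def coord_vec_def using D by auto
qed

lemma coord_vec_self:
  assumes c: "c \<in> A" and x: "x \<in> fst c"
  shows "coord_vec c x v c = v"
proof -
  have hom: "homeomorphism (fst c) (snd c ` fst c) (snd c) (chart_inv c)"
    using homeo c by blast
  have "((\<lambda>y. y) has_derivative (\<lambda>v. v)) (at (snd c x))" by simp
  then have "(transition c c has_derivative (\<lambda>v. v)) (at (snd c x))"
  proof (rule has_derivative_transform_within_open[OF _ image_open[OF c]])
    show "snd c x \<in> snd c ` fst c" using x by auto
    show "y = transition c c y" if "y \<in> snd c ` fst c" for y
      using hom that by (auto simp: transition_def homeomorphism_def)
  qed
  then show ?thesis
    using c x by (metis coord_vec_def frechet_derivative_at)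
qed

end


section \<open>Riemannian manifolds\<close>

locale riemannian_manifold = smooth_manifold A
  for A :: "('m::{t2_space,second_countable_topology}, 'n::finite) chart set" +
  fixes g :: "'m \<Rightarrow> ('m, 'n) tvec \<Rightarrow> ('m, 'n) tvec \<Rightarrow> real"
  assumes metric_sym: "\<xi> \<in> tangent_space x \<Longrightarrow> \<eta> \<in> tangent_space x \<Longrightarrow> g x \<xi> \<eta> = g x \<eta> \<xi>"
    and metric_add: "\<xi> \<in> tangent_space x \<Longrightarrow> \<xi>' \<in> tangent_space x \<Longrightarrow> \<eta> \<in> tangent_space x \<Longrightarrow>
      g x (\<lambda>c. \<xi> c + \<xi>' c) \<eta> = g x \<xi> \<eta> + g x \<xi>' \<eta>"
    and metric_scale: "\<xi> \<in> tangent_space x \<Longrightarrow> \<eta> \<in> tangent_space x \<Longrightarrow>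
      g x (\<lambda>c. r *\<^sub>R \<xi> c) \<eta> = r * g x \<xi> \<eta>"
    and metric_pos: "\<xi> \<in> tangent_space x \<Longrightarrow> \<xi> \<noteq> (\<lambda>_. 0) \<Longrightarrow> 0 < g x \<xi> \<xi>"
    and metric_smooth: "c \<in> A \<Longrightarrow>
      smooth_on (\<lambda>p. g (chart_inv c p)
          (coord_vec c (chart_inv c p) (axis i 1)) (coord_vec c (chart_inv c p) (axis j 1)))
        (snd c ` fst c)"
begin

definition tnorm :: "'m \<Rightarrow> ('m, 'n) tvec \<Rightarrow> real" where
  "tnorm x \<xi> = sqrt (g x \<xi> \<xi>)"

subsection \<open>Length and Riemannian distance\<close>

text \<open>The integrand is meaningful except at the finitely many break points, which do not affect
  the integral.\<close>

definition curve_length :: "(real \<Rightarrow> 'm) \<Rightarrow> real \<Rightarrow> real \<Rightarrow> real" where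
  "curve_length \<gamma> a b = integral {a..b} (\<lambda>t. tnorm (\<gamma> t) (velocity \<gamma> {a..b} t))"

definition unit_speed :: "(real \<Rightarrow> 'm) \<Rightarrow> real \<Rightarrow> real \<Rightarrow> bool" where
  "unit_speed \<gamma> a b \<longleftrightarrow>
     (\<exists>F. finite F \<and> (\<forall>t\<in>{a..b} - F. tnorm (\<gamma> t) (velocity \<gamma> {a..b} t) = 1))"

text \<open>The distance is extended real valued (\<open>\<infinity>\<close> between different components), so that \<open>'m\<close> need
  not be connected.\<close>

definition rdist :: "'m \<Rightarrow> 'm \<Rightarrow> ereal" where
  "rdist x y = Inf {ereal (curve_length \<gamma> a b) | \<gamma> a b.
     piecewise_regular \<gamma> a b \<and> \<gamma> a = x \<and> \<gamma> b = y}"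

definition rball :: "'m \<Rightarrow> real \<Rightarrow> 'm set" where
  "rball x r = {y. rdist x y < ereal r}"

definition minimizing_in :: "'m set \<Rightarrow> (real \<Rightarrow> 'm) \<Rightarrow> real \<Rightarrow> real \<Rightarrow> bool" where
  "minimizing_in S \<gamma> a b \<longleftrightarrow> admissible S \<gamma> a b \<and>
     (\<forall>\<gamma>' a' b'. admissible S \<gamma>' a' b' \<and> \<gamma>' a' = \<gamma> a \<and> \<gamma>' b' = \<gamma> b \<longrightarrow>
        curve_length \<gamma> a b \<le> curve_length \<gamma>' a' b')"

subsection \<open>Levi-Civita connection\<close>

definition gram :: "('m, 'n) chart \<Rightarrow> real^'n \<Rightarrow> real^'n^'n" where
  "gram c p = (\<chi> i j. g (chart_inv c p)
     (coord_vec c (chart_inv c p) (axis i 1)) (coord_vec c (chart_inv c p) (axis j 1)))"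

text \<open>\<open>dgram c p k i j\<close> is the partial derivative of \<open>g\<^sub>i\<^sub>j\<close> in the \<open>k\<close>-th coordinate direction.\<close>

definition dgram :: "('m, 'n) chart \<Rightarrow> real^'n \<Rightarrow> 'n \<Rightarrow> 'n \<Rightarrow> 'n \<Rightarrow> real" where
  "dgram c p k i j = frechet_derivative (\<lambda>q. gram c q $ i $ j) (at p) (axis k 1)"

text \<open>\<open>christoffel c p k i j\<close> is the symbol with upper index \<open>k\<close> and lower indices \<open>i\<close>, \<open>j\<close>.\<close>

definition christoffel :: "('m, 'n) chart \<Rightarrow> real^'n \<Rightarrow> 'n \<Rightarrow> 'n \<Rightarrow> 'n \<Rightarrow> real" where
  "christoffel c p k i j = (1 / 2) *
     (\<Sum>l\<in>UNIV. matrix_inv (gram c p) $ k $ l * (dgram c p i j l + dgram c p j i l - dgram c p l i j))"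

text \<open>The covariant derivative at \<open>t\<close> of a vector field \<open>V\<close> along \<open>\<gamma>\<close>.\<close>

definition covariant_derivative ::
    "(real \<Rightarrow> 'm) \<Rightarrow> real set \<Rightarrow> (real \<Rightarrow> ('m, 'n) tvec) \<Rightarrow> real \<Rightarrow> ('m, 'n) tvec" where
  "covariant_derivative \<gamma> I V t = (\<lambda>c. if c \<in> A \<and> \<gamma> t \<in> fst c
     then (\<chi> k. vector_derivative (\<lambda>s. V s c) (at t within I) $ k +
        (\<Sum>i\<in>UNIV. \<Sum>j\<in>UNIV. christoffel c (snd c (\<gamma> t)) k i j * velocity \<gamma> I t c $ i * V t c $ j))
     else 0)"

text \<open>The next lemmas identify the connection as the Levi-Civita one: in every chart it is
  symmetric and compatible with the metric.\<close>

lemma gram_sym: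
  assumes c: "c \<in> A" and p: "p \<in> snd c ` fst c"
  shows "gram c p $ i $ j = gram c p $ j $ i"
proof -
  have "chart_inv c p \<in> fst c"
    using homeo[OF c] p by (auto simp: homeomorphism_def)
  then show ?thesis
    unfolding gram_def vec_lambda_beta
    by (intro metric_sym coord_vec_tangent[OF c])
qed

lemma dgram_sym:
  assumes c: "c \<in> A" and p: "p \<in> snd c ` fst c"
  shows "dgram c p k i j = dgram c p k j i"
proof -
  have imp: "((\<lambda>q. gram c q $ j $ i) has_derivative D) (at p)"
    if "((\<lambda>q. gram c q $ i $ j) has_derivative D) (at p)" for D i j
    by (rule has_derivative_transform_within_open[OF that image_open[OF c] p]) (rule gram_sym[OF c])
  have D: "((\<lambda>q. gram c q $ i $ j) has_derivative D) (at p) \<longleftrightarrow>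
        ((\<lambda>q. gram c q $ j $ i) has_derivative D) (at p)" for D
    using imp by blast
  then show ?thesis
    unfolding dgram_def frechet_derivative_def by simp
qed

lemma christoffel_sym:
  assumes "c \<in> A" "p \<in> snd c ` fst c"
  shows "christoffel c p k i j = christoffel c p k j i"
  unfolding christoffel_def using dgram_sym[OF assms] by (simp add: algebra_simps)

lemma gram_quadratic:
  assumes c: "c \<in> A" and p: "p \<in> snd c ` fst c"
  shows "g (chart_inv c p) (coord_vec c (chart_inv c p) v) (coord_vec c (chart_inv c p) w)
    = v \<bullet> (gram c p *v w)"
proof -
  let ?x = "chart_inv c p"
  let ?e = "coord_vec c ?x"
  have x: "?x \<in> fst c"
    using homeo[OF c] p by (auto simp: homeomorphism_def)
  have T: "?e v \<in> tangent_space ?x" for v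
    using coord_vec_tangent[OF c x] .
  have lin: "linear (frechet_derivative (transition c c') (at (snd c ?x)))"
    if "c' \<in> A" "?x \<in> fst c'" for c'
  proof -
    have "Ck_on (Suc 0) (transition c c') (snd c ` (fst c \<inter> fst c'))"
      using compatible[OF c that(1)] unfolding smooth_on_def by blast
    then have "transition c c' differentiable (at (snd c ?x))" using that x by auto
    then show ?thesis by (rule linear_frechet_derivative)
  qed
  have add: "?e (v + w) = (\<lambda>c'. ?e v c' + ?e w c')" for v w
    using lin by (auto simp: coord_vec_def linear_add)
  have scale: "?e (r *\<^sub>R v) = (\<lambda>c'. r *\<^sub>R ?e v c')" for r v
    using lin by (auto simp: coord_vec_def linear_cmul)
  have linL: "linear (\<lambda>v. g ?x (?e v) (?e w))" for w
    by (rule linearI) (simp_all add: add scale metric_add[OF T T T] metric_scale[OF T T])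
  have linR: "linear (\<lambda>w. g ?x (?e v) (?e w))" for v
    using linL[of v] metric_sym[OF T T] by simp
  have exp: "(\<Sum>i\<in>UNIV. u $ i *\<^sub>R axis i 1) = u" for u :: "real^'n"
    using basis_expansion[of u] by (simp add: scalar_mult_eq_scaleR)
  have "g ?x (?e v) (?e w)
      = g ?x (?e (\<Sum>i\<in>UNIV. v $ i *\<^sub>R axis i 1)) (?e w)"
    by (simp only: exp)
  also have "\<dots> = (\<Sum>i\<in>UNIV. v $ i * g ?x (?e (axis i 1)) (?e w))"
    by (simp add: linear_sum[OF linL] linear_cmul[OF linL])
  also have "\<dots> = (\<Sum>i\<in>UNIV. v $ i * g ?x (?e (axis i 1)) (?e (\<Sum>j\<in>UNIV. w $ j *\<^sub>R axis j 1)))"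
    by (simp only: exp)
  also have "\<dots> = (\<Sum>i\<in>UNIV. v $ i * (\<Sum>j\<in>UNIV. w $ j * g ?x (?e (axis i 1)) (?e (axis j 1))))"
    by (simp add: linear_sum[OF linR] linear_cmul[OF linR])
  also have "\<dots> = v \<bullet> (gram c p *v w)"
    by (simp add: inner_vec_def matrix_vector_mult_def gram_def mult.commute)
  finally show ?thesis .
qed

lemma gram_invertible:
  assumes c: "c \<in> A" and p: "p \<in> snd c ` fst c"
  shows "invertible (gram c p)"
proof -
  let ?x = "chart_inv c p"
  have x: "?x \<in> fst c"
    using homeo[OF c] p by (auto simp: homeomorphism_def)
  have "v = 0" if "gram c p *v v = 0" for v
  proof (rule ccontr)
    assume "v \<noteq> 0"
    then have "coord_vec c ?x v \<noteq> (\<lambda>_. 0)"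
      using coord_vec_self[OF c x] by metis
    then have "0 < v \<bullet> (gram c p *v v)"
      using metric_pos[OF coord_vec_tangent[OF c x]] gram_quadratic[OF assms] by metis
    then show False using that by simp
  qed
  then show ?thesis
    by (metis invertible_left_inverse matrix_left_invertible_ker)
qed

lemma christoffel_first_kind:
  assumes c: "c \<in> A" and p: "p \<in> snd c ` fst c"
  shows "(\<Sum>k\<in>UNIV. gram c p $ m $ k * christoffel c p k i j)
    = (dgram c p i j m + dgram c p j i m - dgram c p m i j) / 2"
proof -
  define b :: "real^'n" where "b = (\<chi> l. dgram c p i j l + dgram c p j i l - dgram c p l i j)"
  have "gram c p ** matrix_inv (gram c p) = mat 1"
    using someI_ex[OF gram_invertible[OF assms, unfolded invertible_def]]
    unfolding matrix_inv_def by blast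
  then have "gram c p *v (matrix_inv (gram c p) *v b) = b"
    by (simp add: matrix_vector_mul_assoc)
  then have 1: "(gram c p *v (matrix_inv (gram c p) *v b)) $ m = b $ m" by simp
  have 2: "christoffel c p k i j = (matrix_inv (gram c p) *v b) $ k / 2" for k
    by (simp add: christoffel_def matrix_vector_mult_def b_def)
  have "(\<Sum>k\<in>UNIV. gram c p $ m $ k * christoffel c p k i j)
      = (gram c p *v (matrix_inv (gram c p) *v b)) $ m / 2"
    unfolding 2 by (simp add: matrix_vector_mult_def[of "gram c p"] sum_divide_distrib)
  then show ?thesis unfolding 1 by (simp add: b_def)
qed

lemma christoffel_metric:
  assumes c: "c \<in> A" and p: "p \<in> snd c ` fst c"
  shows "dgram c p k i j = (\<Sum>l\<in>UNIV. christoffel c p l k i * gram c p $ l $ j)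
    + (\<Sum>l\<in>UNIV. christoffel c p l k j * gram c p $ i $ l)"
proof -
  have "(\<Sum>l\<in>UNIV. christoffel c p l k i * gram c p $ l $ j)
      = (dgram c p k i j + dgram c p i k j - dgram c p j k i) / 2"
    using christoffel_first_kind[OF assms, of j k i] gram_sym[OF assms, of _ j]
    by (simp add: mult.commute)
  moreover have "(\<Sum>l\<in>UNIV. christoffel c p l k j * gram c p $ i $ l)
      = (dgram c p k j i + dgram c p j k i - dgram c p i k j) / 2"
    using christoffel_first_kind[OF assms, of i k j] by (simp add: mult.commute)
  ultimately show ?thesis using dgram_sym[OF assms, of k j i] by simp
qed

subsection \<open>Geodesics and convexity\<close>

text \<open>Geodesics are parametrized on \<open>[0,1]\<close>; constant ones are allowed.\<close>

definition minimizing_geodesic :: "(real \<Rightarrow> 'm) \<Rightarrow> 'm \<Rightarrow> 'm \<Rightarrow> bool" where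
  "minimizing_geodesic \<gamma> x y \<longleftrightarrow> \<gamma> 0 = x \<and> \<gamma> 1 = y \<and> C2_curve_on \<gamma> {0..1} \<and>
     (\<forall>t\<in>{0..1}. covariant_derivative \<gamma> {0..1} (velocity \<gamma> {0..1}) t = (\<lambda>_. 0)) \<and>
     ereal (curve_length \<gamma> 0 1) = rdist x y"

text \<open>Uniqueness refers to the values on \<open>[0,1]\<close> only.\<close>

definition strongly_convex :: "'m set \<Rightarrow> bool" where
  "strongly_convex C \<longleftrightarrow> (\<forall>x\<in>C. \<forall>y\<in>C. \<exists>\<gamma>. minimizing_geodesic \<gamma> x y \<and> \<gamma> ` {0..1} \<subseteq> C \<and>
     (\<forall>\<gamma>'. minimizing_geodesic \<gamma>' x y \<longrightarrow> (\<forall>t\<in>{0..1}. \<gamma>' t = \<gamma> t)))"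

definition convex_nhd :: "'m \<Rightarrow> 'm set \<Rightarrow> bool" where
  "convex_nhd x U \<longleftrightarrow> strongly_convex U \<and> x \<in> interior U"

text \<open>Initial velocity of the minimizing geodesic; only meaningful when that geodesic is unique.\<close>

definition exp_inv :: "'m \<Rightarrow> 'm \<Rightarrow> ('m, 'n) tvec" where
  "exp_inv x y = (THE \<xi>. \<exists>\<gamma>. minimizing_geodesic \<gamma> x y \<and> \<xi> = velocity \<gamma> {0..1} 0)"

subsection \<open>Proximal normals and prox-regularity\<close>

definition proximal_normal_cone :: "'m set \<Rightarrow> 'm \<Rightarrow> ('m, 'n) tvec set" where
  "proximal_normal_cone S x = {\<xi> \<in> tangent_space x.
     \<exists>\<sigma>>0. \<exists>U. convex_nhd x U \<and>
       (\<forall>y\<in>U \<inter> S. ereal (g x \<xi> (exp_inv x y)) \<le> ereal \<sigma> * (rdist x y)\<^sup>2)}"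

definition prox_regular_at :: "'m set \<Rightarrow> 'm \<Rightarrow> bool" where
  "prox_regular_at S z \<longleftrightarrow>
     (\<exists>\<epsilon>>0. \<exists>\<sigma>>0. strongly_convex (rball z \<epsilon>) \<and>
        (\<forall>x\<in>S \<inter> rball z \<epsilon>. \<forall>v\<in>proximal_normal_cone S x. tnorm x v < \<epsilon> \<longrightarrow>
           (\<forall>y\<in>S \<inter> rball z \<epsilon>. ereal (g x v (exp_inv x y)) \<le> ereal \<sigma> * (rdist x y)\<^sup>2)))"

definition prox_regular :: "'m set \<Rightarrow> bool" where
  "prox_regular S \<longleftrightarrow> closed S \<and> (\<forall>z\<in>S. prox_regular_at S z)"

end

end

theory Submission
  imports Defs
begin

text \<open>Let \<open>x\<close> be a point of \<open>S\<close>. In suitable \<open>C\<^sup>2\<close> coordinates around \<open>x\<close> the set \<open>S\<close> is a convex cone \<open>K\<close>: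
  everything if \<open>x\<close> is interior, and otherwise the linear slice of the boundary or a half-space bounded by
  it. If \<open>u\<close> is the coordinate expression of \<open>\<gamma>\<close>, then the curves \<open>u + s \<phi> e\<close> with \<open>e \<in> K\<close>, \<open>s \<ge> 0\<close> and a
  bump function \<open>\<phi> \<ge> 0\<close> stay in \<open>S\<close>. The length of such a curve on an interval of length \<open>l\<close> is at most
  \<open>(E + l) / 2\<close>, where \<open>E\<close> is the integral of the squared speed, with equality for the unit speed curve \<open>\<gamma>\<close>.
  So \<open>E\<close> cannot decrease to first order, and the first variation formula gives \<open>\<langle>D\<^sub>t \<gamma>', e\<rangle> \<le> 0\<close> for all
  \<open>e \<in> K\<close>. By Taylor expansion of the coordinate change and of geodesics, a vector in this polar cone is a
  proximal normal; prox-regularity of \<open>S\<close> is only used to provide a convex ball around \<open>x\<close>.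

  The Euler--Lagrange expression of the energy is defined for a metric that is merely \<open>C\<^sup>1\<close>, and it is
  natural under \<open>C\<^sup>2\<close> maps because second derivatives are symmetric. This handles the boundary-flattening
  coordinates and also shows that the coordinate expressions of \<open>D\<^sub>t \<gamma>'\<close> define a tangent vector.\<close>

section \<open>Calculus of \<open>C\<^sup>2\<close> maps\<close>

text \<open>Flattening the boundary costs one derivative: a metric pulled back along a C^2 map is
  only C^1 and falls outside the smooth metrics of the locale. The Euler-Lagrange form, paired with
  a test vector, involves one derivative of the metric and no inverse matrix, so it serves in both
  kinds of coordinates. The varied curves lose nothing: \<open>u + s \<phi> e\<close> with a
  polynomial \<open>\<phi>\<close> is C^2, and so is its image under the C^2 inverse of the
  flattening, hence they are admissible. Energy replaces length because its integrand has no square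
  root: \<open>|v| \<le> (|v|^2 + 1) / 2\<close>, with equality at unit speed, turns a decrease of
  energy into a decrease of length. Variations are one-sided because \<open>K\<close> need not
  contain \<open>- e\<close>, so the outcome is a polar cone condition instead of an equation. This
  condition speaks about points of \<open>S\<close> because \<open>K\<close> contains the negative
  of the image of \<open>x\<close>: differences of images of nearby points of \<open>S\<close> and
  of \<open>x\<close> are directions in \<open>K\<close>. The remaining error is quadratic, as the
  proximal inequality permits; distant points of the convex ball are absorbed by enlarging the
  constant.\<close>

lemma Ck_on_subset: "Ck_on k f U \<Longrightarrow> V \<subseteq> U \<Longrightarrow> Ck_on k f V"
  by (induction k arbitrary: f) (auto intro: continuous_on_subset)

lemma Ck_on_1I:
  assumes "\<And>x. x \<in> U \<Longrightarrow> (f has_derivative f' x) (at x)" "\<And>v. continuous_on U (\<lambda>x. f' x v)"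
  shows "Ck_on 1 f U"
proof -
  have "frechet_derivative f (at x) = f' x" if "x \<in> U" for x
    using assms(1)[OF that] frechet_derivative_at by metis
  then have "continuous_on U (\<lambda>x. frechet_derivative f (at x) v)" for v
    using assms(2)[of v] by (simp cong: continuous_on_cong)
  then show ?thesis using assms(1) by (auto simp: differentiable_def)
qed

lemma Ck_on_1_has_derivative:
  "Ck_on 1 f U \<Longrightarrow> x \<in> U \<Longrightarrow> (f has_derivative frechet_derivative f (at x)) (at x)"
  by (auto simp: frechet_derivative_works)

lemma Ck_on_1_continuous_on: "Ck_on 1 f U \<Longrightarrow> continuous_on U f"
  by (auto intro!: continuous_at_imp_continuous_on differentiable_imp_continuous_within)

lemma Ck_on_2_imp_1:
  assumes "Ck_on 2 f U"
  shows "Ck_on 1 f U"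
  using assms
  by (auto simp: numeral_2_eq_2 intro!: continuous_at_imp_continuous_on differentiable_imp_continuous_within)

lemma Ck_on_2_has_derivative:
  "Ck_on 2 f U \<Longrightarrow> x \<in> U \<Longrightarrow> (f has_derivative frechet_derivative f (at x)) (at x)"
  by (auto simp: frechet_derivative_works numeral_2_eq_2)

lemma linear_expand:
  fixes f :: "'a::euclidean_space \<Rightarrow> 'b::real_vector"
  assumes "linear f"
  shows "f v = (\<Sum>b\<in>Basis. (v \<bullet> b) *\<^sub>R f b)"
proof -
  have "f v = f (\<Sum>b\<in>Basis. (v \<bullet> b) *\<^sub>R b)" by (simp add: euclidean_representation)
  then show ?thesis by (simp add: linear_sum[OF assms] linear_cmul[OF assms])
qed

text \<open>A C^1 field of linear maps, tested on one fixed argument at a time. Linearity and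
  \<open>linear_expand\<close> reduce everything to finitely many such tests, so the space of linear
  maps never has to be normed.\<close>

definition C1_field :: "'a::euclidean_space set \<Rightarrow> ('a \<Rightarrow> 'b::euclidean_space \<Rightarrow> 'c::euclidean_space) \<Rightarrow> bool" where
  "C1_field U F \<longleftrightarrow> open U \<and> (\<forall>y\<in>U. linear (F y)) \<and> (\<forall>v. Ck_on 1 (\<lambda>y. F y v) U)"

text \<open>The derivative acts on the base point only. For the derivative of a C^2 map this is the
  second derivative; for a metric it is the derivative of the coefficients in direction
  \<open>z\<close>.\<close>

definition dfield :: "('a::euclidean_space \<Rightarrow> 'b::euclidean_space \<Rightarrow> 'c::euclidean_space) \<Rightarrow> 'a \<Rightarrow> 'a \<Rightarrow> 'b \<Rightarrow> 'c" where
  "dfield F y z v = frechet_derivative (\<lambda>y. F y v) (at y) z"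

lemma C1_field_frechet:
  assumes "open U" "Ck_on 2 f U"
  shows "C1_field U (\<lambda>y. frechet_derivative f (at y))"
  using assms by (auto simp: C1_field_def numeral_2_eq_2 intro: linear_frechet_derivative)

lemma dfield_has_derivative:
  assumes "C1_field U F" "y \<in> U"
  shows "((\<lambda>y. F y v) has_derivative (\<lambda>z. dfield F y z v)) (at y)"
  unfolding dfield_def using assms Ck_on_1_has_derivative unfolding C1_field_def by blast

lemma linear_dfield_direction: "C1_field U F \<Longrightarrow> y \<in> U \<Longrightarrow> linear (\<lambda>z. dfield F y z v)"
  using dfield_has_derivative has_derivative_linear by blast

text \<open>Linearity holds at all nearby base points, so it survives differentiation, by uniqueness
  of derivatives.\<close>

lemma linear_dfield_arg:
  assumes F: "C1_field U F" and y: "y \<in> U"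
  shows "linear (dfield F y z)"
proof -
  have lin: "linear (F y)" if "y \<in> U" for y using F that by (auto simp: C1_field_def)
  have op: "open U" using F by (simp add: C1_field_def)
  note D = dfield_has_derivative[OF F y]
  show ?thesis
  proof (rule linearI)
    fix v w
    have "((\<lambda>y. F y (v + w)) has_derivative (\<lambda>z. dfield F y z v + dfield F y z w)) (at y)"
      by (rule has_derivative_transform_within_open[OF has_derivative_add[OF D D] op y])
        (simp add: lin linear_add)
    then show "dfield F y z (v + w) = dfield F y z v + dfield F y z w"
      using has_derivative_unique[OF D] by metis
  next
    fix r v
    have "((\<lambda>y. F y (r *\<^sub>R v)) has_derivative (\<lambda>z. r *\<^sub>R dfield F y z v)) (at y)"
      by (rule has_derivative_transform_within_open[OF has_derivative_scaleR_right[OF D] op y])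
        (simp add: lin linear_cmul)
    then show "dfield F y z (r *\<^sub>R v) = r *\<^sub>R dfield F y z v"
      using has_derivative_unique[OF D] by metis
  qed
qed

text \<open>The product rule for a field evaluated along a curve, from the basis expansion of the
  argument. The expansion is valid while \<open>u\<close> stays in \<open>U\<close>, hence near
  \<open>t\<close>.\<close>

lemma C1_field_chain:
  assumes F: "C1_field U F" and u: "(u has_derivative u') (at t within J)" "u t \<in> U" "t \<in> J"
    and v: "(v has_derivative v') (at t within J)"
  shows "((\<lambda>s. F (u s) (v s)) has_derivative (\<lambda>h. dfield F (u t) (u' h) (v t) + F (u t) (v' h)))
    (at t within J)"
proof -
  have lin: "linear (F y)" if "y \<in> U" for y using F that by (auto simp: C1_field_def)
  have op: "open U" using F by (simp add: C1_field_def)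
  have "((\<lambda>s. \<Sum>b\<in>Basis. (v s \<bullet> b) *\<^sub>R F (u s) b) has_derivative
      (\<lambda>h. \<Sum>b\<in>Basis. (v t \<bullet> b) *\<^sub>R dfield F (u t) (u' h) b + (v' h \<bullet> b) *\<^sub>R F (u t) b)) (at t within J)"
    by (intro has_derivative_sum has_derivative_scaleR has_derivative_inner_left v
        has_derivative_compose[OF u(1) dfield_has_derivative[OF F u(2)]])
  moreover have "\<forall>\<^sub>F s in at t within J. (\<Sum>b\<in>Basis. (v s \<bullet> b) *\<^sub>R F (u s) b) = F (u s) (v s)"
  proof -
    have "(u \<longlongrightarrow> u t) (at t within J)"
      using has_derivative_continuous[OF u(1)] by (simp add: continuous_within)
    then have "\<forall>\<^sub>F s in at t within J. u s \<in> U" using op u(2) by (rule topological_tendstoD)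
    then show ?thesis
      by eventually_elim (rule linear_expand[OF lin, symmetric])
  qed
  ultimately have "((\<lambda>s. F (u s) (v s)) has_derivative
      (\<lambda>h. \<Sum>b\<in>Basis. (v t \<bullet> b) *\<^sub>R dfield F (u t) (u' h) b + (v' h \<bullet> b) *\<^sub>R F (u t) b)) (at t within J)"
    by (rule has_derivative_transform_eventually) (use u lin linear_expand in \<open>metis+\<close>)
  moreover have "(\<Sum>b\<in>Basis. (v t \<bullet> b) *\<^sub>R dfield F (u t) (u' h) b + (v' h \<bullet> b) *\<^sub>R F (u t) b)
      = dfield F (u t) (u' h) (v t) + F (u t) (v' h)" for h
    using linear_expand[OF lin[OF u(2)], of "v' h"]
      linear_expand[OF linear_dfield_arg[OF F u(2)], of "u' h" "v t"]
    by (simp add: sum.distrib)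
  ultimately show ?thesis by simp
qed

lemma C1_field_chain_vector:
  assumes F: "C1_field U F" and u: "(u has_vector_derivative u') (at t within J)" "u t \<in> U" "t \<in> J"
    and v: "(v has_vector_derivative v') (at t within J)"
  shows "((\<lambda>s. F (u s) (v s)) has_vector_derivative (dfield F (u t) u' (v t) + F (u t) v'))
    (at t within J)"
proof -
  have lin: "linear (F (u t))" using F u by (auto simp: C1_field_def)
  show ?thesis
    using C1_field_chain[OF F u(1)[unfolded has_vector_derivative_def] u(2,3) v[unfolded has_vector_derivative_def]]
    unfolding has_vector_derivative_def
    by (simp add: linear_cmul[OF lin] linear_cmul[OF linear_dfield_direction[OF F u(2)]] scaleR_add_right)
qed

lemma C1_field_continuous_on:
  assumes F: "C1_field U F" and u: "continuous_on X u" "\<And>t. t \<in> X \<Longrightarrow> u t \<in> U" and v: "continuous_on X v"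
  shows "continuous_on X (\<lambda>t. F (u t) (v t))"
proof -
  have lin: "linear (F y)" if "y \<in> U" for y using F that by (auto simp: C1_field_def)
  have "continuous_on U (\<lambda>y. F y b)" for b
    using F Ck_on_1_continuous_on unfolding C1_field_def by blast
  then have "continuous_on X (\<lambda>t. F (u t) b)" for b
    using continuous_on_compose2[OF _ u(1)] u(2) by blast
  then have "continuous_on X (\<lambda>t. \<Sum>b\<in>Basis. (v t \<bullet> b) *\<^sub>R F (u t) b)"
    by (intro continuous_intros v)
  moreover have "F (u t) (v t) = (\<Sum>b\<in>Basis. (v t \<bullet> b) *\<^sub>R F (u t) b)" if "t \<in> X" for t
    using linear_expand[OF lin[OF u(2)[OF that]]] .
  ultimately show ?thesis by (simp cong: continuous_on_cong)
qed

lemma dfield_continuous_on: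
  assumes F: "C1_field U F" and u: "continuous_on X u" "\<And>t. t \<in> X \<Longrightarrow> u t \<in> U"
    and z: "continuous_on X z" and v: "continuous_on X v"
  shows "continuous_on X (\<lambda>t. dfield F (u t) (z t) (v t))"
proof -
  have "continuous_on U (\<lambda>y. dfield F y a b)" for a b
    using F unfolding C1_field_def dfield_def by simp
  then have "continuous_on X (\<lambda>t. dfield F (u t) a b)" for a b
    using continuous_on_compose2[OF _ u(1)] u(2) by blast
  then have "continuous_on X (\<lambda>t. \<Sum>b\<in>Basis. (v t \<bullet> b) *\<^sub>R (\<Sum>a\<in>Basis. (z t \<bullet> a) *\<^sub>R dfield F (u t) a b))"
    by (intro continuous_intros v z)
  moreover have "dfield F (u t) (z t) (v t) =
      (\<Sum>b\<in>Basis. (v t \<bullet> b) *\<^sub>R (\<Sum>a\<in>Basis. (z t \<bullet> a) *\<^sub>R dfield F (u t) a b))" if "t \<in> X" for t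
    by (subst linear_expand[OF linear_dfield_arg[OF F u(2)[OF that]]],
        subst linear_expand[OF linear_dfield_direction[OF F u(2)[OF that]]], rule refl)
  ultimately show ?thesis by (simp cong: continuous_on_cong)
qed

lemma frechet_derivative_has_vector_derivative:
  assumes f: "Ck_on 1 f U" and u: "(u has_vector_derivative u') (at t within J)" "u t \<in> U"
  shows "((\<lambda>s. f (u s)) has_vector_derivative frechet_derivative f (at (u t)) u') (at t within J)"
proof -
  note D = Ck_on_1_has_derivative[OF f u(2)]
  have "((\<lambda>s. f (u s)) has_derivative (\<lambda>h. frechet_derivative f (at (u t)) (h *\<^sub>R u'))) (at t within J)"
    using has_derivative_compose[OF u(1)[unfolded has_vector_derivative_def] D] .
  then show ?thesis
    unfolding has_vector_derivative_def
    by (simp add: linear_cmul[OF has_derivative_linear[OF D]])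
qed

text \<open>Differentiating \<open>f (x + s v + t w) - f (x + s v) = \<integral>\<^sub>0\<^sup>t D\<^sub>w f (x + s v + \<tau> w) d\<tau>\<close> in \<open>s\<close> under the
  integral sign and comparing with \<open>D\<^sub>v f (x + t w) - D\<^sub>v f x = \<integral>\<^sub>0\<^sup>t D\<^sub>w D\<^sub>v f (x + \<tau> w) d\<tau>\<close>.\<close>

lemma second_derivative_symmetric:
  fixes f :: "'a::euclidean_space \<Rightarrow> 'b::euclidean_space"
  assumes U: "open U" and f: "Ck_on 2 f U" and x: "x \<in> U"
  shows "dfield (\<lambda>y. frechet_derivative f (at y)) x v w = dfield (\<lambda>y. frechet_derivative f (at y)) x w v"
proof -
  let ?D = "\<lambda>y. frechet_derivative f (at y)"
  have F: "C1_field U ?D" using C1_field_frechet[OF U f] .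
  have f1: "Ck_on 1 f U" using Ck_on_2_imp_1[OF f] .
  obtain e where e: "e > 0" "ball x e \<subseteq> U" using U x openE by blast
  \<comment> \<open>Scaled so that all points \<open>x + s v + t w\<close> used below lie in the
    ball of radius \<open>e\<close>; the \<open>+ 1\<close> keeps the denominator positive.\<close>
  define d where "d = e / (norm v + norm w + 1)"
  have pos: "norm v + norm w + 1 > 0" using norm_ge_zero[of v] norm_ge_zero[of w] by linarith
  have d: "d > 0" using e pos by (simp add: d_def)
  have inU: "x + s *\<^sub>R v + t *\<^sub>R w \<in> U" if "s \<in> {-d..d}" "t \<in> {0..d}" for s t
  proof -
    have "norm (s *\<^sub>R v + t *\<^sub>R w) \<le> \<bar>s\<bar> * norm v + \<bar>t\<bar> * norm w"
      by (metis norm_scaleR norm_triangle_ineq)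
    also have "\<dots> \<le> d * norm v + d * norm w"
      using that by (intro add_mono mult_right_mono) auto
    also have "\<dots> < d * (norm v + norm w + 1)" using d by (simp add: algebra_simps)
    also have "\<dots> = e" using pos by (simp add: d_def)
    finally have "x + (s *\<^sub>R v + t *\<^sub>R w) \<in> ball x e"
      by (simp add: dist_norm del: minus_add_distrib)
    then show ?thesis using e by (auto simp: add.assoc)
  qed
  have path: "((\<lambda>t. y + t *\<^sub>R z) has_vector_derivative z) (at t within X)" for y z :: 'a and t X
    by (auto intro!: derivative_eq_intros simp: has_vector_derivative_def)
  have cont2: "continuous_on {0..d} (\<lambda>\<tau>. dfield ?D (x + \<tau> *\<^sub>R w) a b)" for a b
    using inU[of 0] d by (intro dfield_continuous_on[OF F] continuous_intros) auto
  define I where "I t a b = integral {0..t} (\<lambda>\<tau>. dfield ?D (x + \<tau> *\<^sub>R w) a b)" for t a b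
  have 1: "?D (x + t *\<^sub>R w) v - ?D x v = I t w v" if t: "t \<in> {0..d}" for t
  proof -
    have "((\<lambda>\<tau>. dfield ?D (x + \<tau> *\<^sub>R w) w v) has_integral (?D (x + t *\<^sub>R w) v - ?D (x + 0 *\<^sub>R w) v)) {0..t}"
    proof (rule fundamental_theorem_of_calculus)
      fix \<tau> assume "\<tau> \<in> {0..t}"
      then have "x + \<tau> *\<^sub>R w \<in> U" using inU[of 0 \<tau>] t d by auto
      then show "((\<lambda>t. ?D (x + t *\<^sub>R w) v) has_vector_derivative dfield ?D (x + \<tau> *\<^sub>R w) w v) (at \<tau> within {0..t})"
        unfolding dfield_def
        using F unfolding C1_field_def
        by (intro frechet_derivative_has_vector_derivative[of "\<lambda>y. ?D y v" U] path) auto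
    qed (use t in auto)
    then show ?thesis by (simp add: I_def integral_unique)
  qed
  have 2: "?D (x + t *\<^sub>R w) v - ?D x v = I t v w" if t: "t \<in> {0..d}" for t
  proof -
    have "((\<lambda>s. integral (cbox 0 t) (\<lambda>\<tau>. ?D (x + s *\<^sub>R v + \<tau> *\<^sub>R w) w)) has_vector_derivative
        integral (cbox 0 t) (\<lambda>\<tau>. dfield ?D (x + 0 *\<^sub>R v + \<tau> *\<^sub>R w) v w)) (at 0 within {-d..d})"
    proof (rule leibniz_rule_vector_derivative)
      fix s \<tau> assume s: "s \<in> {-d..d}" "\<tau> \<in> cbox 0 t"
      then have *: "x + s *\<^sub>R v + \<tau> *\<^sub>R w \<in> U" using t by (intro inU) auto
      have "((\<lambda>s. (x + \<tau> *\<^sub>R w) + s *\<^sub>R v) has_vector_derivative v) (at s within {-d..d})"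
        by (rule path)
      then have "((\<lambda>s. x + s *\<^sub>R v + \<tau> *\<^sub>R w) has_vector_derivative v) (at s within {-d..d})"
        by (simp add: algebra_simps)
      then show "((\<lambda>s. ?D (x + s *\<^sub>R v + \<tau> *\<^sub>R w) w) has_vector_derivative
          dfield ?D (x + s *\<^sub>R v + \<tau> *\<^sub>R w) v w) (at s within {-d..d})"
        unfolding dfield_def using F * unfolding C1_field_def
        by (intro frechet_derivative_has_vector_derivative[of "\<lambda>y. ?D y w" U]) auto
    next
      fix s assume "s \<in> {-d..d}"
      then show "(\<lambda>\<tau>. ?D (x + s *\<^sub>R v + \<tau> *\<^sub>R w) w) integrable_on cbox 0 t"
        using t by (intro integrable_continuous C1_field_continuous_on[OF F] continuous_intros inU) auto
    next
      show "continuous_on ({-d..d} \<times> cbox 0 t) (\<lambda>(s, \<tau>). dfield ?D (x + s *\<^sub>R v + \<tau> *\<^sub>R w) v w)"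
        using t unfolding split_beta
        by (intro dfield_continuous_on[OF F] continuous_intros inU) auto
    qed (use d in auto)
    moreover have "((\<lambda>s. integral (cbox 0 t) (\<lambda>\<tau>. ?D (x + s *\<^sub>R v + \<tau> *\<^sub>R w) w)) has_vector_derivative
        ?D (x + t *\<^sub>R w) v - ?D x v) (at 0 within {-d..d})"
    proof (rule has_vector_derivative_transform)
      show "0 \<in> {-d..d}" using d by auto
      fix s assume s: "s \<in> {-d..d}"
      have "((\<lambda>\<tau>. ?D (x + s *\<^sub>R v + \<tau> *\<^sub>R w) w) has_integral
          (f (x + s *\<^sub>R v + t *\<^sub>R w) - f (x + s *\<^sub>R v + 0 *\<^sub>R w))) {0..t}"
        using s t
        by (intro fundamental_theorem_of_calculus frechet_derivative_has_vector_derivative[OF f1] path inU) auto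
      then show "integral (cbox 0 t) (\<lambda>\<tau>. ?D (x + s *\<^sub>R v + \<tau> *\<^sub>R w) w) = f (x + t *\<^sub>R w + s *\<^sub>R v) - f (x + s *\<^sub>R v)"
        by (simp add: integral_unique add.commute add.left_commute)
    next
      have "x + t *\<^sub>R w \<in> U" using inU[of 0 t] t d by auto
      then have "((\<lambda>s. f (x + t *\<^sub>R w + s *\<^sub>R v)) has_vector_derivative ?D (x + t *\<^sub>R w + 0 *\<^sub>R v) v) (at 0 within {-d..d})"
        by (intro frechet_derivative_has_vector_derivative[OF f1] path) auto
      moreover have "((\<lambda>s. f (x + s *\<^sub>R v)) has_vector_derivative ?D (x + 0 *\<^sub>R v) v) (at 0 within {-d..d})"
        using x by (intro frechet_derivative_has_vector_derivative[OF f1] path) auto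
      ultimately show "((\<lambda>s. f (x + t *\<^sub>R w + s *\<^sub>R v) - f (x + s *\<^sub>R v)) has_vector_derivative
          ?D (x + t *\<^sub>R w) v - ?D x v) (at 0 within {-d..d})"
        using has_vector_derivative_diff by fastforce
    qed
    moreover have "at 0 within {-d..d} \<noteq> bot"
      using d by (simp add: trivial_limit_within islimpt_Icc)
    ultimately have "integral (cbox 0 t) (\<lambda>\<tau>. dfield ?D (x + 0 *\<^sub>R v + \<tau> *\<^sub>R w) v w) = ?D (x + t *\<^sub>R w) v - ?D x v"
      using vector_derivative_unique_within by blast
    then show ?thesis by (simp add: I_def)
  qed
  \<comment> \<open>Both integrals represent the same increment for every \<open>t\<close>; their
    derivatives at \<open>t = 0\<close> recover the integrands at \<open>x\<close>, that is, the two
    mixed derivatives.\<close>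
  have "((\<lambda>t. I t w v) has_vector_derivative dfield ?D (x + 0 *\<^sub>R w) w v) (at 0 within {0..d})"
    unfolding I_def using d by (intro integral_has_vector_derivative[OF cont2]) auto
  moreover have "((\<lambda>t. I t w v) has_vector_derivative dfield ?D (x + 0 *\<^sub>R w) v w) (at 0 within {0..d})"
  proof (rule has_vector_derivative_transform)
    show "I t w v = I t v w" if "t \<in> {0..d}" for t using 1[OF that] 2[OF that] by simp
    show "((\<lambda>t. I t v w) has_vector_derivative dfield ?D (x + 0 *\<^sub>R w) v w) (at 0 within {0..d})"
      unfolding I_def using d by (intro integral_has_vector_derivative[OF cont2]) auto
  qed (use d in auto)
  moreover have "at 0 within {0..d} \<noteq> bot"
    using d by (simp add: trivial_limit_within islimpt_Icc)
  ultimately show ?thesis using vector_derivative_unique_within by fastforce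
qed

section \<open>Energy and the Euler--Lagrange expression\<close>

text \<open>A Riemannian metric on \<open>U\<close>, encoded by its musical isomorphism: \<open>\<langle>v, w\<rangle>\<^sub>p = F p v \<bullet> w\<close>.\<close>

definition metric_field :: "'a::euclidean_space set \<Rightarrow> ('a \<Rightarrow> 'a \<Rightarrow> 'a) \<Rightarrow> bool" where
  "metric_field U F \<longleftrightarrow> C1_field U F \<and> (\<forall>y\<in>U. \<forall>v w. F y v \<bullet> w = F y w \<bullet> v) \<and>
     (\<forall>y\<in>U. \<forall>v. v \<noteq> 0 \<longrightarrow> 0 < F y v \<bullet> v)"

text \<open>For a curve \<open>x\<close> with \<open>p = x t\<close>, \<open>v = x' t\<close> and \<open>w = x'' t\<close>, this is minus the Euler--Lagrange
  expression of the energy \<open>\<integral> F x x' \<bullet> x' / 2\<close>, paired with \<open>z\<close>.\<close>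

definition EL :: "('a::euclidean_space \<Rightarrow> 'a \<Rightarrow> 'a) \<Rightarrow> 'a \<Rightarrow> 'a \<Rightarrow> 'a \<Rightarrow> 'a \<Rightarrow> real" where
  "EL F p v w z = F p w \<bullet> z + dfield F p v v \<bullet> z - dfield F p z v \<bullet> v / 2"

text \<open>In matrix form this is \<open>Dq^T F(q p) Dq\<close>, the musical isomorphism of the
  pulled-back metric; the transpose is spelled out in the basis.\<close>

definition pullback :: "('a::euclidean_space \<Rightarrow> 'b::euclidean_space) \<Rightarrow> ('b \<Rightarrow> 'b \<Rightarrow> 'b) \<Rightarrow> 'a \<Rightarrow> 'a \<Rightarrow> 'a" where
  "pullback q F p v = (\<Sum>b\<in>Basis. (F (q p) (frechet_derivative q (at p) v) \<bullet> frechet_derivative q (at p) b) *\<^sub>R b)"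

lemma EL_cong:
  assumes U: "open U" "p \<in> U" and eq: "\<And>y v. y \<in> U \<Longrightarrow> F y v = G y v"
  shows "EL F p v w z = EL G p v w z"
proof -
  \<comment> \<open>\<open>frechet_derivative\<close> is a choice among all derivatives, so it is
    determined by which maps are derivatives; differentiability need not be known.\<close>
  have D: "((\<lambda>y. F y v) has_derivative D) (at p) \<longleftrightarrow> ((\<lambda>y. G y v) has_derivative D) (at p)" for v D
    using has_derivative_transform_within_open[OF _ U, of "\<lambda>y. F y v" D UNIV "\<lambda>y. G y v"]
      has_derivative_transform_within_open[OF _ U, of "\<lambda>y. G y v" D UNIV "\<lambda>y. F y v"] eq
    by auto
  then show ?thesis using eq U by (simp add: EL_def dfield_def frechet_derivative_def)
qed

section \<open>Pullback of a metric along a C^2 map\<close>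

context
  fixes Q :: "'a::euclidean_space set" and q :: "'a \<Rightarrow> 'b::euclidean_space"
    and U :: "'b set" and F :: "'b \<Rightarrow> 'b \<Rightarrow> 'b"
  assumes Q: "open Q" and q: "Ck_on 2 q Q" and qU: "q ` Q \<subseteq> U" and F: "C1_field U F"
begin

private abbreviation "D \<equiv> \<lambda>y. frechet_derivative q (at y)"

lemma linear_pullback_map: "p \<in> Q \<Longrightarrow> linear (D p)"
  using Ck_on_2_has_derivative[OF q] has_derivative_linear by blast

lemma pullback_inner:
  assumes p: "p \<in> Q"
  shows "pullback q F p v \<bullet> w = F (q p) (D p v) \<bullet> D p w"
proof -
  have "pullback q F p v \<bullet> w = (\<Sum>b\<in>Basis. (F (q p) (D p v) \<bullet> D p b) * (b \<bullet> w))"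
    by (simp add: pullback_def inner_sum_left)
  also have "\<dots> = F (q p) (D p v) \<bullet> (\<Sum>b\<in>Basis. (w \<bullet> b) *\<^sub>R D p b)"
    by (simp add: inner_sum_right mult.commute inner_commute)
  also have "\<dots> = F (q p) (D p v) \<bullet> D p w"
    by (simp add: linear_expand[OF linear_pullback_map[OF p], of w])
  finally show ?thesis .
qed

lemma pullback_inner_has_derivative:
  assumes p: "p \<in> Q"
  shows "((\<lambda>p. F (q p) (D p v) \<bullet> D p w) has_derivative (\<lambda>z.
      dfield F (q p) (D p z) (D p v) \<bullet> D p w + F (q p) (dfield D p z v) \<bullet> D p w
      + F (q p) (D p v) \<bullet> dfield D p z w)) (at p)"
proof -
  note CD = C1_field_frechet[OF Q q]
  have "((\<lambda>p. F (q p) (D p v)) has_derivative (\<lambda>z. dfield F (q p) (D p z) (D p v) + F (q p) (dfield D p z v))) (at p)"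
    by (rule C1_field_chain[OF F Ck_on_2_has_derivative[OF q p] _ _ dfield_has_derivative[OF CD p]])
      (use qU p in auto)
  from has_derivative_inner[OF this dfield_has_derivative[OF CD p]]
  show ?thesis by (simp add: inner_add_left algebra_simps)
qed

lemma pullback_has_derivative:
  assumes p: "p \<in> Q"
  shows "((\<lambda>p. pullback q F p v) has_derivative (\<lambda>z. \<Sum>b\<in>Basis. (
      dfield F (q p) (D p z) (D p v) \<bullet> D p b + F (q p) (dfield D p z v) \<bullet> D p b
      + F (q p) (D p v) \<bullet> dfield D p z b) *\<^sub>R b)) (at p)"
  unfolding pullback_def
  by (intro has_derivative_sum has_derivative_scaleR_left pullback_inner_has_derivative p)

text \<open>Differentiating \<open>pullback\<close> consumes the second derivatives of
  \<open>q\<close>; C^2 supplies exactly their existence and continuity.\<close>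

lemma C1_field_pullback: "C1_field Q (pullback q F)"
  unfolding C1_field_def
proof (intro conjI ballI allI Q)
  fix p assume p: "p \<in> Q"
  have lin: "linear (F (q p))" using F p qU by (auto simp: C1_field_def)
  have l: "linear (\<lambda>v. F (q p) (D p v))"
    using linear_compose[OF linear_pullback_map[OF p] lin] by (simp add: o_def)
  show "linear (pullback q F p)"
    unfolding pullback_def
    by (intro linearI) (simp_all add: linear_add[OF l] linear_cmul[OF l] inner_add_left sum.distrib
        scaleR_add_left scaleR_sum_right)
next
  fix v
  note CD = C1_field_frechet[OF Q q]
  have cq: "continuous_on Q q" using Ck_on_1_continuous_on[OF Ck_on_2_imp_1[OF q]] .
  have cD: "continuous_on Q (\<lambda>p. D p a)" for a
    by (intro C1_field_continuous_on[OF CD] continuous_intros) auto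
  have cD2: "continuous_on Q (\<lambda>p. dfield D p a b)" for a b
    by (intro dfield_continuous_on[OF CD] continuous_intros) auto
  show "Ck_on 1 (\<lambda>p. pullback q F p v) Q"
    using qU by (intro Ck_on_1I[OF pullback_has_derivative] continuous_intros
        dfield_continuous_on[OF F cq] C1_field_continuous_on[OF F cq] cD cD2) auto
qed

lemma dfield_pullback_inner:
  assumes p: "p \<in> Q"
  shows "dfield (pullback q F) p z v \<bullet> w = dfield F (q p) (D p z) (D p v) \<bullet> D p w
    + F (q p) (dfield D p z v) \<bullet> D p w + F (q p) (D p v) \<bullet> dfield D p z w"
proof -
  have "((\<lambda>p. pullback q F p v \<bullet> w) has_derivative (\<lambda>z.
      dfield F (q p) (D p z) (D p v) \<bullet> D p w + F (q p) (dfield D p z v) \<bullet> D p w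
      + F (q p) (D p v) \<bullet> dfield D p z w)) (at p)"
    by (rule has_derivative_transform_within_open[OF pullback_inner_has_derivative[OF p] Q p])
      (simp add: pullback_inner)
  from fun_cong[OF has_derivative_unique[OF has_derivative_inner_left[OF dfield_has_derivative[OF C1_field_pullback p]] this]]
  show ?thesis .
qed

text \<open>The derivative of the pulled-back metric produces three terms with a second derivative
  of \<open>q\<close>. By symmetry of \<open>F\<close> and of second derivatives,
  \<open>F (D v)\<close> paired with the mixed derivative in \<open>v\<close> and \<open>z\<close>
  occurs once with factor 1 and twice with factor -1/2, so it cancels. What is left is the second
  derivative in \<open>v\<close> and \<open>v\<close>, which is the contribution of \<open>q\<close>
  to the acceleration of the image curve.\<close>

lemma EL_pullback:
  assumes p: "p \<in> Q" and sym: "\<And>v w. F (q p) v \<bullet> w = F (q p) w \<bullet> v"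
  shows "EL (pullback q F) p v w z = EL F (q p) (D p v) (dfield D p v v + D p w) (D p z)"
proof -
  have lin: "linear (F (q p))" using F p qU by (auto simp: C1_field_def)
  have "F (q p) (dfield D p z v) \<bullet> D p v = F (q p) (D p v) \<bullet> dfield D p v z"
    using sym second_derivative_symmetric[OF Q q p] by simp
  moreover have "F (q p) (D p v) \<bullet> dfield D p z v = F (q p) (D p v) \<bullet> dfield D p v z"
    using second_derivative_symmetric[OF Q q p] by simp
  ultimately show ?thesis
    unfolding EL_def dfield_pullback_inner[OF p] pullback_inner[OF p] linear_add[OF lin] inner_add_left
    by (simp add: field_simps)
qed

end

lemma metric_field_pullback:
  assumes Q: "open Q" "Ck_on 2 q Q" "q ` Q \<subseteq> U" and F: "metric_field U F"
    and inj: "\<And>p v. p \<in> Q \<Longrightarrow> v \<noteq> 0 \<Longrightarrow> frechet_derivative q (at p) v \<noteq> 0"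
  shows "metric_field Q (pullback q F)"
proof -
  have C: "C1_field U F" using F by (simp add: metric_field_def)
  have *: "q p \<in> U" if "p \<in> Q" for p using Q that by blast
  show ?thesis
    unfolding metric_field_def
    using C1_field_pullback[OF Q C] pullback_inner[OF Q C] F * inj
    by (simp add: metric_field_def)
qed

section \<open>First variation of the energy\<close>

lemma small_perturbation_in_open:
  fixes u :: "real \<Rightarrow> 'a::euclidean_space"
  assumes u: "continuous_on {\<alpha>..\<beta>} u" "\<And>t. t \<in> {\<alpha>..\<beta>} \<Longrightarrow> u t \<in> U" "open U"
    and k: "continuous_on {\<alpha>..\<beta>} (k :: real \<Rightarrow> real)"
  obtains d where "d > 0" "\<And>s t. \<bar>s\<bar> \<le> d \<Longrightarrow> t \<in> {\<alpha>..\<beta>} \<Longrightarrow> u t + (s * k t) *\<^sub>R e \<in> U"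
proof -
  have "compact (u ` {\<alpha>..\<beta>})" using u(1) compact_continuous_image by blast
  then obtain r where r: "r > 0" "(\<Union>x\<in>u ` {\<alpha>..\<beta>}. ball x r) \<subseteq> U"
    using compact_subset_open_imp_ball_epsilon_subset[of "u ` {\<alpha>..\<beta>}" U] u(2,3) by blast
  have "bounded (k ` {\<alpha>..\<beta>})" using k compact_continuous_image compact_imp_bounded by blast
  then obtain M where M: "M > 0" "\<And>t. t \<in> {\<alpha>..\<beta>} \<Longrightarrow> \<bar>k t\<bar> \<le> M"
    unfolding bounded_pos by auto
  obtain N where N: "N > 0" "norm e \<le> N" by (metis less_add_one norm_ge_zero order_le_less_trans less_imp_le)
  \<comment> \<open>The displacement is then at most \<open>r / 2\<close>, strictly inside a ball
    contained in \<open>U\<close>. \<open>N\<close> is a positive bound for the norm of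
    \<open>e\<close>, which may itself be zero.\<close>
  define d where "d = r / (2 * M * N)"
  show thesis
  proof (rule that[of d])
    show "d > 0" using r M N by (simp add: d_def)
    fix s t assume st: "\<bar>s\<bar> \<le> d" "t \<in> {\<alpha>..\<beta>}"
    have "norm ((s * k t) *\<^sub>R e) \<le> d * M * N"
      using st M(2)[OF st(2)] N \<open>d > 0\<close> by (auto simp: abs_mult intro!: mult_mono)
    also have "\<dots> = r / 2" using M N by (simp add: d_def)
    also have "\<dots> < r" using r by simp
    finally have "u t + (s * k t) *\<^sub>R e \<in> ball (u t) r" by (simp add: dist_norm)
    then show "u t + (s * k t) *\<^sub>R e \<in> U" using r st by blast
  qed
qed

text \<open>The first variation formula with the bump \<open>k\<close>, which vanishes at both ends:
  the boundary terms disappear and the right derivative of the energy at \<open>s = 0\<close> is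
  \<open>- \<integral> 2 k EL\<close>. This is negative because \<open>k\<close> is positive in
  between.\<close>

lemma energy_decreases:
  fixes u v w :: "real \<Rightarrow> 'a::euclidean_space"
  assumes F: "metric_field U F" and ab: "\<alpha> < \<beta>"
    and u: "\<And>t. t \<in> {\<alpha>..\<beta>} \<Longrightarrow> (u has_vector_derivative v t) (at t within {\<alpha>..\<beta>})"
    and v: "\<And>t. t \<in> {\<alpha>..\<beta>} \<Longrightarrow> (v has_vector_derivative w t) (at t within {\<alpha>..\<beta>})"
    and w: "continuous_on {\<alpha>..\<beta>} w" and uU: "\<And>t. t \<in> {\<alpha>..\<beta>} \<Longrightarrow> u t \<in> U"
    and EL: "\<And>t. t \<in> {\<alpha>..\<beta>} \<Longrightarrow> 0 < EL F (u t) (v t) (w t) e"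
  obtains d where "d > 0" "\<And>s. 0 < s \<Longrightarrow> s < d \<Longrightarrow>
    integral {\<alpha>..\<beta>} (\<lambda>t. F (u t + (s * ((t - \<alpha>) * (\<beta> - t))) *\<^sub>R e) (v t + (s * (\<alpha> + \<beta> - 2 * t)) *\<^sub>R e)
      \<bullet> (v t + (s * (\<alpha> + \<beta> - 2 * t)) *\<^sub>R e))
    < integral {\<alpha>..\<beta>} (\<lambda>t. F (u t) (v t) \<bullet> v t)"
proof -
  have C: "C1_field U F" and op: "open U" and sym: "\<And>y a b. y \<in> U \<Longrightarrow> F y a \<bullet> b = F y b \<bullet> a"
    using F by (auto simp: metric_field_def C1_field_def)
  define k where "k t = (t - \<alpha>) * (\<beta> - t)" for t
  define l where "l t = \<alpha> + \<beta> - 2 * t" for t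
  have kl: "(k has_vector_derivative l t) (at t within X)" for t X
    unfolding k_def l_def has_real_derivative_iff_has_vector_derivative[symmetric]
    by (auto intro!: derivative_eq_intros)
  have ck: "continuous_on X k" and cl: "continuous_on X l" for X
    unfolding k_def l_def by (intro continuous_intros)+
  have cu: "continuous_on {\<alpha>..\<beta>} u" using u continuous_on_vector_derivative by blast
  have cv: "continuous_on {\<alpha>..\<beta>} v" using v continuous_on_vector_derivative by blast
  define us where "us s t = u t + (s * k t) *\<^sub>R e" for s t
  define vs where "vs s t = v t + (s * l t) *\<^sub>R e" for s t
  obtain d0 where d0: "d0 > 0" "\<And>s t. \<bar>s\<bar> \<le> d0 \<Longrightarrow> t \<in> {\<alpha>..\<beta>} \<Longrightarrow> us s t \<in> U"
    using small_perturbation_in_open[OF cu uU op ck[of "{\<alpha>..\<beta>}"]] unfolding us_def by metis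
  define f where "f s t = F (us s t) (vs s t) \<bullet> vs s t" for s t
  define f' where "f' s t = dfield F (us s t) (k t *\<^sub>R e) (vs s t) \<bullet> vs s t
      + 2 * (F (us s t) (vs s t) \<bullet> (l t *\<^sub>R e))" for s t
  have cus: "continuous_on ({0..d0} \<times> {\<alpha>..\<beta>}) (\<lambda>x. us (fst x) (snd x))"
    and cvs: "continuous_on ({0..d0} \<times> {\<alpha>..\<beta>}) (\<lambda>x. vs (fst x) (snd x))"
    unfolding us_def vs_def
    by (intro continuous_intros continuous_on_compose2[OF cu] continuous_on_compose2[OF cv]
        continuous_on_compose2[OF ck] continuous_on_compose2[OF cl]; auto)+
  have inU: "us s t \<in> U" if "s \<in> {0..d0}" "t \<in> {\<alpha>..\<beta>}" for s t using that d0 by auto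
  have "((\<lambda>s. integral (cbox \<alpha> \<beta>) (f s)) has_vector_derivative integral (cbox \<alpha> \<beta>) (f' 0)) (at 0 within {0..d0})"
  proof (rule leibniz_rule_vector_derivative)
    fix s t assume st: "s \<in> {0..d0}" "t \<in> cbox \<alpha> \<beta>"
    have du: "((\<lambda>s. us s t) has_vector_derivative k t *\<^sub>R e) (at s within {0..d0})"
      unfolding us_def by (auto intro!: derivative_eq_intros simp: has_vector_derivative_def)
    have dv: "((\<lambda>s. vs s t) has_vector_derivative l t *\<^sub>R e) (at s within {0..d0})"
      unfolding vs_def by (auto intro!: derivative_eq_intros simp: has_vector_derivative_def)
    have U: "us s t \<in> U" using inU st by auto
    have "((\<lambda>s. F (us s t) (vs s t) \<bullet> vs s t) has_vector_derivative
        (F (us s t) (vs s t) \<bullet> l t *\<^sub>R e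
        + (dfield F (us s t) (k t *\<^sub>R e) (vs s t) + F (us s t) (l t *\<^sub>R e)) \<bullet> vs s t)) (at s within {0..d0})"
      by (rule bounded_bilinear.has_vector_derivative[OF bounded_bilinear_inner])
        (intro dv C1_field_chain_vector[OF C du U st(1) dv])+
    then show "((\<lambda>s. f s t) has_vector_derivative f' s t) (at s within {0..d0})"
      unfolding f_def f'_def using sym[OF U] by (simp add: inner_add_left algebra_simps)
  next
    fix s assume s: "s \<in> {0..d0}"
    have "continuous_on {\<alpha>..\<beta>} (us s)" "continuous_on {\<alpha>..\<beta>} (vs s)"
      unfolding us_def vs_def by (intro continuous_intros cu cv ck cl)+
    then show "f s integrable_on cbox \<alpha> \<beta>"
      unfolding f_def using inU[OF s]
      by (intro integrable_continuous continuous_intros C1_field_continuous_on[OF C]) auto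
  next
    show "continuous_on ({0..d0} \<times> cbox \<alpha> \<beta>) (\<lambda>(s, t). f' s t)"
      unfolding f'_def split_beta box_real using inU
      by (intro continuous_intros C1_field_continuous_on[OF C] dfield_continuous_on[OF C] cus cvs
          continuous_on_compose2[OF ck] continuous_on_compose2[OF cl]) auto
  qed (use d0 in auto)
  then have deriv: "((\<lambda>s. integral {\<alpha>..\<beta>} (f s)) has_real_derivative integral {\<alpha>..\<beta>} (f' 0)) (at 0 within {0..d0})"
    by (simp add: has_real_derivative_iff_has_vector_derivative)
  \<comment> \<open>Integration by parts: \<open>f' 0 + h\<close> is the derivative of
    \<open>2 k (F u v \<bullet> e)\<close>, whose values at both ends are zero, so
    \<open>f' 0\<close> and \<open>- h\<close> have the same integral.\<close>
  define h where "h t = 2 * k t * EL F (u t) (v t) (w t) e" for t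
  have ch: "continuous_on {\<alpha>..\<beta>} h"
    unfolding h_def EL_def
    by (intro continuous_intros ck C1_field_continuous_on[OF C] dfield_continuous_on[OF C] cu cv w uU) auto
  have "((\<lambda>t. f' 0 t + h t) has_integral 2 * k \<beta> * (F (u \<beta>) (v \<beta>) \<bullet> e) - 2 * k \<alpha> * (F (u \<alpha>) (v \<alpha>) \<bullet> e)) {\<alpha>..\<beta>}"
  proof (rule fundamental_theorem_of_calculus)
    fix t assume t: "t \<in> {\<alpha>..\<beta>}"
    note D = C1_field_chain_vector[OF C u[OF t] uU[OF t] t v[OF t]]
    have k': "((\<lambda>t. 2 * k t) has_real_derivative 2 * l t) (at t within {\<alpha>..\<beta>})"
      using kl[of t "{\<alpha>..\<beta>}"] unfolding has_real_derivative_iff_has_vector_derivative[symmetric]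
      by (rule DERIV_cmult)
    have "((\<lambda>t. (2 * k t) * (F (u t) (v t) \<bullet> e)) has_vector_derivative
        (2 * k t) * ((dfield F (u t) (v t) (v t) + F (u t) (w t)) \<bullet> e) + (2 * l t) * (F (u t) (v t) \<bullet> e)) (at t within {\<alpha>..\<beta>})"
      by (rule has_vector_derivative_mult[OF k'[unfolded has_real_derivative_iff_has_vector_derivative]
          bounded_linear.has_vector_derivative[OF bounded_linear_inner_left D]])
    moreover have "dfield F (u t) (k t *\<^sub>R e) (v t) = k t *\<^sub>R dfield F (u t) e (v t)"
      using linear_cmul[OF linear_dfield_direction[OF C uU[OF t]]] .
    ultimately show "((\<lambda>t. 2 * k t * (F (u t) (v t) \<bullet> e)) has_vector_derivative f' 0 t + h t) (at t within {\<alpha>..\<beta>})"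
      unfolding f'_def h_def EL_def us_def vs_def
      by (simp add: inner_add_left algebra_simps)
  qed (use ab in auto)
  then have "((\<lambda>t. f' 0 t + h t) has_integral 0) {\<alpha>..\<beta>}" by (simp add: k_def)
  moreover have "(h has_integral integral {\<alpha>..\<beta>} h) {\<alpha>..\<beta>}"
    using ch integrable_continuous_interval by blast
  ultimately have "((\<lambda>t. (f' 0 t + h t) - h t) has_integral (0 - integral {\<alpha>..\<beta>} h)) {\<alpha>..\<beta>}"
    by (rule has_integral_diff)
  then have "integral {\<alpha>..\<beta>} (f' 0) = - integral {\<alpha>..\<beta>} h"
    by (simp add: integral_unique)
  moreover have "integral {\<alpha>..\<beta>} h > 0"
  proof -
    have nn: "h t \<ge> 0" if "t \<in> {\<alpha>..\<beta>}" for t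
      using EL[OF that] that by (auto simp: h_def k_def)
    \<comment> \<open>A continuous nonnegative function with zero integral vanishes;
      \<open>h\<close> does not at the midpoint, where \<open>k\<close> is positive.\<close>
    have "integral {\<alpha>..\<beta>} h \<noteq> 0"
    proof
      assume "integral {\<alpha>..\<beta>} h = 0"
      then have "h ((\<alpha> + \<beta>) / 2) = 0"
        using integral_eq_0_iff[OF ch ab nn] ab by auto
      moreover have "k ((\<alpha> + \<beta>) / 2) > 0" using ab unfolding k_def by (intro mult_pos_pos) (auto simp: field_simps)
      moreover have "(\<alpha> + \<beta>) / 2 \<in> {\<alpha>..\<beta>}" using ab by auto
      ultimately show False using EL[of "(\<alpha> + \<beta>) / 2"] by (simp add: h_def)
    qed
    moreover have "integral {\<alpha>..\<beta>} h \<ge> 0"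
      by (rule integral_nonneg[OF integrable_continuous_interval[OF ch] nn])
    ultimately show ?thesis by simp
  qed
  ultimately have "integral {\<alpha>..\<beta>} (f' 0) < 0" by simp
  from has_real_derivative_neg_dec_right[OF deriv this]
  obtain d where d: "d > 0" "\<And>s. 0 < s \<Longrightarrow> 0 + s \<in> {0..d0} \<Longrightarrow> s < d \<Longrightarrow>
      integral {\<alpha>..\<beta>} (f (0 + s)) < integral {\<alpha>..\<beta>} (f 0)"
    by blast
  show thesis
  proof (rule that[of "min d d0"])
    fix s :: real assume "0 < s" "s < min d d0"
    then have "integral {\<alpha>..\<beta>} (f s) < integral {\<alpha>..\<beta>} (f 0)" using d(2)[of s] by auto
    then show "integral {\<alpha>..\<beta>} (\<lambda>t. F (u t + (s * ((t - \<alpha>) * (\<beta> - t))) *\<^sub>R e) (v t + (s * (\<alpha> + \<beta> - 2 * t)) *\<^sub>R e)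
        \<bullet> (v t + (s * (\<alpha> + \<beta> - 2 * t)) *\<^sub>R e)) < integral {\<alpha>..\<beta>} (\<lambda>t. F (u t) (v t) \<bullet> v t)"
      unfolding f_def us_def vs_def k_def l_def by simp
  qed (use d d0 in auto)
qed

section \<open>Mean value and Taylor estimates\<close>

lemma vector_differentiable_bound:
  fixes f :: "real \<Rightarrow> 'a::real_normed_vector"
  assumes "convex S" "\<And>t. t \<in> S \<Longrightarrow> (f has_vector_derivative f' t) (at t within S)"
    "\<And>t. t \<in> S \<Longrightarrow> norm (f' t) \<le> B" "x \<in> S" "y \<in> S"
  shows "norm (f x - f y) \<le> B * norm (x - y)"
proof (rule differentiable_bound[OF assms(1) assms(2)[unfolded has_vector_derivative_def] _ assms(4,5)])
  fix t assume t: "t \<in> S"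
  have "norm (h *\<^sub>R f' t) \<le> B * norm h" for h
    using mult_right_mono[OF assms(3)[OF t], of "norm h"] by (simp add: mult.commute)
  then show "onorm (\<lambda>h. h *\<^sub>R f' t) \<le> B" by (rule onorm_le)
qed

text \<open>Differentiability of the derivative at the single point \<open>x\<close> makes it
  Lipschitz there; the mean value inequality along the segment from \<open>x\<close> to
  \<open>x + h\<close> then yields the quadratic remainder.\<close>

lemma Ck_on_2_Taylor:
  fixes f :: "'a::euclidean_space \<Rightarrow> 'b::euclidean_space"
  assumes U: "open U" and f: "Ck_on 2 f U" and x: "x \<in> U"
  obtains C d where "C > 0" "d > 0" "\<And>h. norm h < d \<Longrightarrow> x + h \<in> U \<and>
    norm (f (x + h) - f x - frechet_derivative f (at x) h) \<le> C * (norm h)\<^sup>2"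
proof -
  let ?D = "\<lambda>y. frechet_derivative f (at y)"
  note CD = C1_field_frechet[OF U f]
  have "\<exists>C d. C > 0 \<and> d > 0 \<and> (\<forall>h. norm h < d \<longrightarrow> norm (?D (x + h) b - ?D x b) \<le> C * norm h)" for b
  proof -
    note H = dfield_has_derivative[OF CD x, of b]
    obtain K where K: "K > 0" "\<And>z. norm (dfield ?D x z b) \<le> norm z * K"
      using bounded_linear.pos_bounded[OF has_derivative_bounded_linear[OF H]] by blast
    \<comment> \<open>Any fixed tolerance would do; tolerance 1 adds 1 to the Lipschitz
      constant.\<close>
    obtain d where d: "d > 0" "\<And>y. norm (y - x) < d \<Longrightarrow>
        norm (?D y b - ?D x b - dfield ?D x (y - x) b) \<le> 1 * norm (y - x)"
      using H unfolding has_derivative_at_alt by (meson zero_less_one)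
    have "norm (?D (x + h) b - ?D x b) \<le> (K + 1) * norm h" if "norm h < d" for h
      using d(2)[of "x + h"] K(2)[of h] that
        norm_triangle_sub[of "?D (x + h) b - ?D x b" "dfield ?D x h b"] by (simp add: algebra_simps)
    then show ?thesis using K d by (intro exI[of _ "K + 1"] exI[of _ d]) auto
  qed
  then obtain C d where Cd: "\<And>b. C b > 0" "\<And>b. d b > 0"
      "\<And>b h. norm h < d b \<Longrightarrow> norm (?D (x + h) b - ?D x b) \<le> C b * norm h" by metis
  obtain e where e: "e > 0" "ball x e \<subseteq> U" using U x openE by blast
  \<comment> \<open>Small enough for every basis direction at once; the sum of the constants then
    serves arbitrary directions.\<close>
  define d0 where "d0 = Min (insert e (d ` Basis))"
  define C0 where "C0 = (\<Sum>b\<in>(Basis::'a set). C b)"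
  have d0: "d0 > 0" using e Cd by (auto simp: d0_def)
  have C0: "C0 > 0" using Cd by (auto simp: C0_def intro!: sum_pos)
  have inU: "x + h \<in> U" if "norm h < d0" for h
  proof -
    have "norm h < e" using that by (auto simp: d0_def)
    then have "x + h \<in> ball x e" by (simp add: dist_norm)
    then show ?thesis using e by blast
  qed
  have lip: "norm (?D (x + h) z - ?D x z) \<le> C0 * norm h * norm z" if h: "norm h < d0" for h z
  proof -
    have l: "linear (?D (x + h))" "linear (?D x)"
      using inU[OF h] x CD by (auto simp: C1_field_def)
    have "?D (x + h) z - ?D x z = (\<Sum>b\<in>Basis. (z \<bullet> b) *\<^sub>R (?D (x + h) b - ?D x b))"
      by (simp add: linear_expand[OF l(1), of z] linear_expand[OF l(2), of z] sum_subtractf scaleR_diff_right)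
    also have "norm \<dots> \<le> (\<Sum>b\<in>Basis. norm z * (C b * norm h))"
    proof (rule sum_norm_le)
      fix b :: 'a assume b: "b \<in> Basis"
      have "norm h < d b" using h b by (auto simp: d0_def)
      then show "norm ((z \<bullet> b) *\<^sub>R (?D (x + h) b - ?D x b)) \<le> norm z * (C b * norm h)"
        using Cd(3)[of h b] Basis_le_norm[OF b, of z] by (auto intro!: mult_mono)
    qed
    also have "\<dots> = C0 * norm h * norm z"
      by (simp add: C0_def sum_distrib_left sum_distrib_right mult_ac)
    finally show ?thesis .
  qed
  show thesis
  proof (rule that[OF C0 d0])
    fix h :: 'a assume h: "norm h < d0"
    have seg: "norm (\<tau> *\<^sub>R h) < d0" if "\<tau> \<in> {0..1}" for \<tau>
    proof -
      have "norm (\<tau> *\<^sub>R h) \<le> 1 * norm h" using that unfolding norm_scaleR by (intro mult_right_mono) auto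
      then show ?thesis using h by simp
    qed
    have "norm ((f (x + 1 *\<^sub>R h) - 1 *\<^sub>R ?D x h) - (f (x + 0 *\<^sub>R h) - 0 *\<^sub>R ?D x h)) \<le> (C0 * norm h * norm h) * norm (1 - 0 :: real)"
    proof (rule vector_differentiable_bound[where S = "{0..1}" and f = "\<lambda>\<tau>. f (x + \<tau> *\<^sub>R h) - \<tau> *\<^sub>R ?D x h"
          and f' = "\<lambda>\<tau>. ?D (x + \<tau> *\<^sub>R h) h - ?D x h"])
      fix \<tau> :: real assume t: "\<tau> \<in> {0..1}"
      have "((\<lambda>\<tau>. f (x + \<tau> *\<^sub>R h)) has_vector_derivative ?D (x + \<tau> *\<^sub>R h) h) (at \<tau> within {0..1})"
        using inU[OF seg[OF t]]
        by (intro frechet_derivative_has_vector_derivative[OF Ck_on_2_imp_1[OF f]])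
          (auto intro!: derivative_eq_intros simp: has_vector_derivative_def)
      moreover have "((\<lambda>\<tau>. \<tau> *\<^sub>R ?D x h) has_vector_derivative ?D x h) (at \<tau> within {0..1})"
        by (auto intro!: derivative_eq_intros simp: has_vector_derivative_def)
      ultimately show "((\<lambda>\<tau>. f (x + \<tau> *\<^sub>R h) - \<tau> *\<^sub>R ?D x h) has_vector_derivative ?D (x + \<tau> *\<^sub>R h) h - ?D x h) (at \<tau> within {0..1})"
        by (rule has_vector_derivative_diff)
      have "norm (?D (x + \<tau> *\<^sub>R h) h - ?D x h) \<le> C0 * norm (\<tau> *\<^sub>R h) * norm h"
        using lip[OF seg[OF t]] .
      also have "\<dots> \<le> C0 * norm h * norm h"
        using t C0 mult_right_mono[of \<tau> 1 "norm h"] by (intro mult_right_mono mult_left_mono) auto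
      finally show "norm (?D (x + \<tau> *\<^sub>R h) h - ?D x h) \<le> C0 * norm h * norm h" .
    qed auto
    then show "x + h \<in> U \<and> norm (f (x + h) - f x - ?D x h) \<le> C0 * (norm h)\<^sup>2"
      using inU[OF h] by (simp add: power2_eq_square algebra_simps)
  qed
qed

lemma Ck_on_2_locally_lipschitz:
  fixes f :: "'a::euclidean_space \<Rightarrow> 'b::euclidean_space"
  assumes U: "open U" and f: "Ck_on 2 f U" and x: "x \<in> U"
  obtains C d where "C > 0" "d > 0" "\<And>y. norm (y - x) < d \<Longrightarrow> norm (f y - f x) \<le> C * norm (y - x)"
proof -
  let ?D = "frechet_derivative f (at x)"
  obtain C d where C: "C > 0" "d > 0" "\<And>h. norm h < d \<Longrightarrow> x + h \<in> U \<and>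
      norm (f (x + h) - f x - ?D h) \<le> C * (norm h)\<^sup>2"
    by (rule Ck_on_2_Taylor[OF U f x]) blast
  obtain B where B: "B > 0" "\<And>h. norm (?D h) \<le> norm h * B"
    using bounded_linear.pos_bounded[OF has_derivative_bounded_linear[OF Ck_on_2_has_derivative[OF f x]]] by blast
  show ?thesis
  proof (rule that[of "C * d + B" d])
    show "C * d + B > 0" using C B by (simp add: add_pos_pos)
    fix y assume y: "norm (y - x) < d"
    have "norm (f y - f x) \<le> norm (f y - f x - ?D (y - x)) + norm (?D (y - x))"
      by (metis add.commute norm_triangle_sub)
    also have "\<dots> \<le> C * (norm (y - x))\<^sup>2 + norm (y - x) * B"
      using C(3)[of "y - x"] B(2)[of "y - x"] y by (intro add_mono) auto
    also have "C * (norm (y - x))\<^sup>2 \<le> C * (d * norm (y - x))"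
      unfolding power2_eq_square using y C(1) by (intro mult_left_mono mult_right_mono) auto
    finally show "norm (f y - f x) \<le> (C * d + B) * norm (y - x)" by (simp add: algebra_simps)
  qed (rule C)
qed

section \<open>Sets with flat boundary\<close>

text \<open>A segment from a point of \<open>T\<close> to a point outside must cross \<open>L\<close>. Hence, if both exist off \<open>L\<close>, then
  modulo \<open>L\<close> all points off \<open>L\<close> lie on one line through 0, those of \<open>T\<close> on one side and the others on the
  other, so that \<open>T\<close> is a half-space; no dimension count is needed.\<close>

lemma flat_boundary_cone:
  fixes L T :: "'a::euclidean_space set"
  assumes L: "subspace L" and u0: "u0 \<in> L" and LT: "ball u0 r \<inter> L \<subseteq> T"
    and seg: "\<And>p p'. p \<in> ball u0 r \<Longrightarrow> p' \<in> ball u0 r \<Longrightarrow> closed_segment p p' \<inter> L = {} \<Longrightarrow> p \<in> T \<Longrightarrow> p' \<in> T"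
  obtains K where "\<And>e f. e \<in> K \<Longrightarrow> f \<in> K \<Longrightarrow> e + f \<in> K" "\<And>e s. e \<in> K \<Longrightarrow> s \<ge> 0 \<Longrightarrow> s *\<^sub>R e \<in> K" "L \<subseteq> K"
    "ball u0 r \<inter> T = ball u0 r \<inter> K"
proof (cases "\<exists>p\<in>ball u0 r - L. p \<in> T")
  case False
  show thesis
  proof (rule that[of L])
    show "ball u0 r \<inter> T = ball u0 r \<inter> L" using False LT by blast
  qed (use subspace_add[OF L] subspace_scale[OF L] in auto)
next
  case True
  show thesis
  proof (cases "ball u0 r \<subseteq> T")
    case True
    then show ?thesis by (intro that[of UNIV]) auto
  next
    case False
    then obtain p0 where p0: "p0 \<in> ball u0 r" "p0 \<notin> T" by blast
    have decomp: "\<exists>a b. p = a + b \<and> a \<in> L \<and> (\<forall>l\<in>L. b \<bullet> l = 0)" for p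
    proof -
      obtain y z where "y \<in> span L" "\<And>w. w \<in> span L \<Longrightarrow> orthogonal z w" "p = y + z"
        using orthogonal_subspace_decomp_exists[of L p] by blast
      then show ?thesis using span_eq_iff[of L] L unfolding orthogonal_def by metis
    qed
    obtain a0 b0 where ab0: "p0 = a0 + b0" "a0 \<in> L" "\<And>l. l \<in> L \<Longrightarrow> b0 \<bullet> l = 0" using decomp by metis
    have orth: "b = 0" if "b \<in> L" "\<And>l. l \<in> L \<Longrightarrow> b \<bullet> l = 0" for b using that by force
    \<comment> \<open>\<open>b\<close> and \<open>b'\<close> are the components of \<open>p\<close>
      and \<open>p'\<close> orthogonal to \<open>L\<close>. At a crossing point a convex combination
      of them lies in \<open>L\<close> and is orthogonal to it, hence is zero; both weights are
      positive because neither end point is in \<open>L\<close>.\<close>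
    have cross: "\<exists>s>0. b' = - s *\<^sub>R b" if p: "p \<in> ball u0 r" "p \<in> T" "p \<notin> L" and p': "p' \<in> ball u0 r" "p' \<notin> T"
        and d: "p = a + b" "a \<in> L" "\<And>l. l \<in> L \<Longrightarrow> b \<bullet> l = 0"
        and d': "p' = a' + b'" "a' \<in> L" "\<And>l. l \<in> L \<Longrightarrow> b' \<bullet> l = 0" for p p' a a' b b'
    proof -
      obtain x where x: "x \<in> closed_segment p p'" "x \<in> L" using seg[OF p(1) p'(1)] p p' by blast
      then obtain \<theta> where th: "0 \<le> \<theta>" "\<theta> \<le> 1" "x = (1 - \<theta>) *\<^sub>R p + \<theta> *\<^sub>R p'"
        unfolding closed_segment_def by blast
      have p'L: "p' \<notin> L" using p' LT by blast
      have "(1 - \<theta>) *\<^sub>R b + \<theta> *\<^sub>R b' = x - (1 - \<theta>) *\<^sub>R a - \<theta> *\<^sub>R a'"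
        using th d d' by (simp add: algebra_simps)
      also have "\<dots> \<in> L" using x d d' by (intro subspace_diff[OF L] subspace_scale[OF L])
      finally have z: "(1 - \<theta>) *\<^sub>R b + \<theta> *\<^sub>R b' = 0"
        by (rule orth) (simp add: inner_add_left d(3) d'(3))
      have "\<theta> \<noteq> 0" using th x p by auto
      have "\<theta> \<noteq> 1" using th x p'L by auto
      have "b' = (- ((1 - \<theta>) / \<theta>)) *\<^sub>R b"
      proof -
        have "\<theta> *\<^sub>R b' = - ((1 - \<theta>) *\<^sub>R b)" using z by (simp add: eq_neg_iff_add_eq_0 add.commute)
        then have "(1 / \<theta>) *\<^sub>R (\<theta> *\<^sub>R b') = (1 / \<theta>) *\<^sub>R (- ((1 - \<theta>) *\<^sub>R b))" by simp
        then show ?thesis using \<open>\<theta> \<noteq> 0\<close> by simp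
      qed
      then show ?thesis using th \<open>\<theta> \<noteq> 0\<close> \<open>\<theta> \<noteq> 1\<close> by (intro exI[of _ "(1 - \<theta>) / \<theta>"]) auto
    qed
    obtain p1 a1 b1 where p1: "p1 \<in> ball u0 r" "p1 \<in> T" "p1 \<notin> L" and
      ab1: "p1 = a1 + b1" "a1 \<in> L" "\<And>l. l \<in> L \<Longrightarrow> b1 \<bullet> l = 0"
      using \<open>\<exists>p\<in>ball u0 r - L. p \<in> T\<close> decomp by (metis DiffE)
    have b1: "b1 \<noteq> 0" using p1 ab1 by auto
    \<comment> \<open>\<open>p0\<close> is outside \<open>T\<close>, so its component
      \<open>b0\<close> orthogonal to \<open>L\<close> is an outer normal of the half-space.\<close>
    have side: "(p \<in> T) = (p \<bullet> b0 \<le> 0)" if p: "p \<in> ball u0 r" for p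
    proof (cases "p \<in> L")
      case True
      then show ?thesis using ab0(3)[of p] LT p by (auto simp: inner_commute)
    next
      case False
      obtain a b where ab: "p = a + b" "a \<in> L" "\<And>l. l \<in> L \<Longrightarrow> b \<bullet> l = 0" using decomp by metis
      have pb: "p \<bullet> b0 = b \<bullet> b0" using ab ab0 by (simp add: inner_add_left inner_commute inner_add_right)
      obtain s where s: "s > 0" "b0 = - s *\<^sub>R b1"
        using cross[OF p1 p0 ab1 ab0] by auto
      show ?thesis
      proof (cases "p \<in> T")
        case True
        obtain s' where s': "s' > 0" "b0 = - s' *\<^sub>R b" using cross[OF p True False p0 ab ab0] by auto
        have "p \<bullet> b0 = b \<bullet> (- s' *\<^sub>R b)" using pb s'(2) by metis
        also have "\<dots> = - s' * (b \<bullet> b)" by simp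
        also have "\<dots> \<le> 0" using s' by simp
        finally show ?thesis using True by simp
      next
        case pT: False
        obtain s' where s': "s' > 0" "b = - s' *\<^sub>R b1" using cross[OF p1 p pT ab1 ab] by auto
        have "p \<bullet> b0 = (- s' *\<^sub>R b1) \<bullet> (- s *\<^sub>R b1)" using pb s(2) s'(2) by metis
        also have "\<dots> = s' * s * (b1 \<bullet> b1)" by simp
        also have "\<dots> > 0" using s s' b1 by simp
        finally show ?thesis using pT by simp
      qed
    qed
    show thesis
    proof (rule that[of "{p. p \<bullet> b0 \<le> 0}"])
      show "L \<subseteq> {p. p \<bullet> b0 \<le> 0}" using ab0(3) by (auto simp: inner_commute)
    qed (use side in \<open>auto simp: inner_add_left mult_nonneg_nonpos\<close>)
  qed
qed

section \<open>Curves and covariant derivatives in charts\<close>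

lemma at_within_Icc_neq_bot: "a < b \<Longrightarrow> t \<in> {a..b} \<Longrightarrow> at t within {a..b} \<noteq> bot" for a b t :: real
  by (simp add: trivial_limit_within islimpt_Icc)

lemma has_vector_derivative_transform_eventually:
  assumes "(f has_vector_derivative f') (at t within I)" "\<forall>\<^sub>F s in at t within I. f s = h s" "f t = h t" "t \<in> I"
  shows "(h has_vector_derivative f') (at t within I)"
  using has_derivative_transform_eventually[OF assms(1)[unfolded has_vector_derivative_def] assms(2-4)]
  unfolding has_vector_derivative_def .

context smooth_manifold
begin

lemma chart_inv_left: "c \<in> A \<Longrightarrow> x \<in> fst c \<Longrightarrow> chart_inv c (snd c x) = x"
  using homeo[of c] by (simp add: homeomorphism_def)

lemma chart_inv_mem: "c \<in> A \<Longrightarrow> p \<in> snd c ` fst c \<Longrightarrow> chart_inv c p \<in> fst c"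
  by (metis chart_inv_left imageE)

lemma chart_inv_right: "c \<in> A \<Longrightarrow> p \<in> snd c ` fst c \<Longrightarrow> snd c (chart_inv c p) = p"
  by (metis chart_inv_left imageE)

lemma continuous_on_chart: "c \<in> A \<Longrightarrow> continuous_on (fst c) (snd c)"
  using homeo[of c] by (simp add: homeomorphism_def)

lemma continuous_on_chart_inv: "c \<in> A \<Longrightarrow> continuous_on (snd c ` fst c) (chart_inv c)"
  using homeo[of c] by (simp add: homeomorphism_def)

lemma open_chart_image:
  assumes c: "c \<in> A" and V: "open V" "V \<subseteq> fst c"
  shows "open (snd c ` V)"
proof -
  have "openin (top_of_set (fst c)) V" using V by (simp add: open_subset)
  from homeomorphism_imp_open_map[OF homeo[OF c] this]
  show ?thesis using image_open[OF c] openin_open_trans by blast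
qed

lemma transition_eq: "c \<in> A \<Longrightarrow> x \<in> fst c \<Longrightarrow> transition c c' (snd c x) = snd c' x"
  by (simp add: transition_def chart_inv_left)

lemma transition_Ck_on: "c \<in> A \<Longrightarrow> c' \<in> A \<Longrightarrow> Ck_on k (transition c c') (snd c ` (fst c \<inter> fst c'))"
  using compatible by (simp add: smooth_on_def)

lemma open_chart_overlap: "c \<in> A \<Longrightarrow> c' \<in> A \<Longrightarrow> open (snd c ` (fst c \<inter> fst c'))"
  using open_chart_image dom_open by blast

lemma tangent_space_transition:
  assumes "\<xi> \<in> tangent_space x" "c \<in> A" "c' \<in> A" "x \<in> fst c" "x \<in> fst c'"
  shows "\<xi> c' = frechet_derivative (transition c c') (at (snd c x)) (\<xi> c)"
  using assms unfolding tangent_space_def by blast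

lemma tangent_space_coord_vec:
  assumes "\<xi> \<in> tangent_space x" "c \<in> A" "x \<in> fst c"
  shows "\<xi> = coord_vec c x (\<xi> c)"
proof
  fix c'
  show "\<xi> c' = coord_vec c x (\<xi> c) c'"
  proof (cases "c' \<in> A \<and> x \<in> fst c'")
    case True
    then show ?thesis
      using tangent_space_transition[OF assms(1,2) _ assms(3), of c'] by (simp add: coord_vec_def)
  next
    case False
    then have "\<xi> c' = 0" using assms(1) unfolding tangent_space_def by blast
    then show ?thesis by (simp only: coord_vec_def if_not_P[OF False])
  qed
qed

lemma eventually_in_chart:
  assumes "c \<in> A" "continuous_on I \<gamma>" "t \<in> I" "\<gamma> t \<in> fst c"
  shows "\<forall>\<^sub>F s in at t within I. \<gamma> s \<in> fst c"
proof -
  have "(\<gamma> \<longlongrightarrow> \<gamma> t) (at t within I)" using assms by (simp add: continuous_on_def)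
  then show ?thesis using topological_tendstoD dom_open assms by blast
qed

lemma chart_change_has_vector_derivative:
  assumes c: "c \<in> A" "c' \<in> A" and \<gamma>: "continuous_on I \<gamma>" "t \<in> I" "\<gamma> t \<in> fst c" "\<gamma> t \<in> fst c'"
    and d: "((snd c \<circ> \<gamma>) has_vector_derivative v) (at t within I)"
  shows "((snd c' \<circ> \<gamma>) has_vector_derivative
    frechet_derivative (transition c c') (at (snd c (\<gamma> t))) v) (at t within I)"
proof (rule has_vector_derivative_transform_eventually)
  show "((\<lambda>s. transition c c' ((snd c \<circ> \<gamma>) s)) has_vector_derivative
    frechet_derivative (transition c c') (at (snd c (\<gamma> t))) v) (at t within I)"
    using frechet_derivative_has_vector_derivative[OF transition_Ck_on[OF c] d] \<gamma> by auto
  show "\<forall>\<^sub>F s in at t within I. transition c c' ((snd c \<circ> \<gamma>) s) = (snd c' \<circ> \<gamma>) s"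
    using eventually_in_chart[OF c(1) \<gamma>(1-3)] by eventually_elim (simp add: transition_eq[OF c(1)])
qed (use \<gamma> c in \<open>auto simp: transition_eq\<close>)

lemma velocity_eq_coord_vec:
  assumes c: "c \<in> A" and \<gamma>: "continuous_on I \<gamma>" "t \<in> I" "\<gamma> t \<in> fst c" and bot: "at t within I \<noteq> bot"
    and d: "((snd c \<circ> \<gamma>) has_vector_derivative v) (at t within I)"
  shows "velocity \<gamma> I t = coord_vec c (\<gamma> t) v"
proof
  fix c'
  show "velocity \<gamma> I t c' = coord_vec c (\<gamma> t) v c'"
    using vector_derivative_within[OF bot chart_change_has_vector_derivative[OF c _ \<gamma> _ d]]
    by (simp add: velocity_def coord_vec_def)
qed

text \<open>One chart around the whole image is enough: in any other chart the first two derivatives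
  come from the chain rule for the transition map, and the second stays continuous.\<close>

lemma C2_curve_on_chartI:
  assumes c: "c \<in> A" and \<gamma>: "continuous_on I \<gamma>" "\<gamma> ` I \<subseteq> fst c"
    and v: "\<And>t. t \<in> I \<Longrightarrow> ((snd c \<circ> \<gamma>) has_vector_derivative v t) (at t within I)"
    and w: "\<And>t. t \<in> I \<Longrightarrow> (v has_vector_derivative w t) (at t within I)"
    and cw: "continuous_on I w"
  shows "C2_curve_on \<gamma> I"
  unfolding C2_curve_on_def
proof (intro conjI ballI \<gamma>(1))
  fix c' assume c': "c' \<in> A"
  let ?D = "\<lambda>y. frechet_derivative (transition c c') (at y)"
  let ?x = "\<lambda>t. snd c (\<gamma> t)"
  note CD = C1_field_frechet[OF open_chart_overlap[OF c c'] transition_Ck_on[OF c c']]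
  define v' where "v' t = ?D (?x t) (v t)" for t
  define w' where "w' t = dfield ?D (?x t) (v t) (v t) + ?D (?x t) (w t)" for t
  have v'w': "((snd c' \<circ> \<gamma>) has_vector_derivative v' t) (at t within I) \<and>
      (v' has_vector_derivative w' t) (at t within I)" if t: "t \<in> I" "\<gamma> t \<in> fst c'" for t
  proof
    have tc: "\<gamma> t \<in> fst c" using \<gamma> t by auto
    show "((snd c' \<circ> \<gamma>) has_vector_derivative v' t) (at t within I)"
      unfolding v'_def by (rule chart_change_has_vector_derivative[OF c c' \<gamma>(1) t(1) tc t(2) v[OF t(1)]])
    show "(v' has_vector_derivative w' t) (at t within I)"
      unfolding v'_def w'_def
      by (rule C1_field_chain_vector[OF CD, of ?x])
        (use v[OF t(1)] w[OF t(1)] t tc in \<open>auto simp: o_def\<close>)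
  qed
  have "continuous_on {t \<in> I. \<gamma> t \<in> fst c'} w'"
  proof -
    have cv: "continuous_on {t \<in> I. \<gamma> t \<in> fst c'} v"
      using continuous_on_subset[OF continuous_on_vector_derivative[OF w]] by auto
    have cx: "continuous_on {t \<in> I. \<gamma> t \<in> fst c'} ?x"
      using continuous_on_subset[OF continuous_on_vector_derivative[OF v]] by (auto simp: o_def)
    have cw': "continuous_on {t \<in> I. \<gamma> t \<in> fst c'} w"
      using continuous_on_subset[OF cw] by auto
    show ?thesis
      unfolding w'_def using \<gamma>(2)
      by (intro continuous_intros C1_field_continuous_on[OF CD] dfield_continuous_on[OF CD] cv cx cw') auto
  qed
  then show "\<exists>v w. (\<forall>t\<in>I. \<gamma> t \<in> fst c' \<longrightarrow> ((snd c' \<circ> \<gamma>) has_vector_derivative v t) (at t within I) \<and>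
           (v has_vector_derivative w t) (at t within I)) \<and> continuous_on {t \<in> I. \<gamma> t \<in> fst c'} w"
    using v'w' by blast
qed

text \<open>The body of the existential in \<open>C2_curve_on\<close>, named so that the two
  derivatives \<open>v\<close> and \<open>w\<close> in a chart can be obtained and reused
  together.\<close>

definition chart_derivs ::
    "('m, 'n) chart \<Rightarrow> (real \<Rightarrow> 'm) \<Rightarrow> real set \<Rightarrow> (real \<Rightarrow> real^'n) \<Rightarrow> (real \<Rightarrow> real^'n) \<Rightarrow> bool" where
  "chart_derivs c \<gamma> I v w \<longleftrightarrow>
     (\<forall>t\<in>I. \<gamma> t \<in> fst c \<longrightarrow> ((snd c \<circ> \<gamma>) has_vector_derivative v t) (at t within I) \<and>
        (v has_vector_derivative w t) (at t within I)) \<and>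
     continuous_on {t\<in>I. \<gamma> t \<in> fst c} w"

lemma C2_curve_onE:
  assumes "C2_curve_on \<gamma> I" "c \<in> A"
  obtains v w where "chart_derivs c \<gamma> I v w"
  using assms unfolding C2_curve_on_def chart_derivs_def by blast

lemma chart_derivsD:
  assumes "chart_derivs c \<gamma> I v w"
  shows "\<And>t. t \<in> I \<Longrightarrow> \<gamma> t \<in> fst c \<Longrightarrow> ((snd c \<circ> \<gamma>) has_vector_derivative v t) (at t within I)"
    "\<And>t. t \<in> I \<Longrightarrow> \<gamma> t \<in> fst c \<Longrightarrow> (v has_vector_derivative w t) (at t within I)"
    "continuous_on {t \<in> I. \<gamma> t \<in> fst c} w"
  using assms by (auto simp: chart_derivs_def)

lemma C2_curve_on_continuous: "C2_curve_on \<gamma> I \<Longrightarrow> continuous_on I \<gamma>"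
  by (simp add: C2_curve_on_def)

lemma C2_curve_on_subset:
  assumes C: "C2_curve_on \<gamma> I" and J: "J \<subseteq> I"
  shows "C2_curve_on \<gamma> J"
  unfolding C2_curve_on_def
proof (intro conjI ballI)
  show "continuous_on J \<gamma>" using C J continuous_on_subset C2_curve_on_continuous by blast
  fix c assume "c \<in> A"
  then obtain v w where "chart_derivs c \<gamma> I v w"
    by (rule C2_curve_onE[OF C])
  note vw = chart_derivsD[OF this]
  have "continuous_on {t \<in> J. \<gamma> t \<in> fst c} w" using vw(3) by (rule continuous_on_subset) (use J in auto)
  then show "\<exists>v w. (\<forall>t\<in>J. \<gamma> t \<in> fst c \<longrightarrow> ((snd c \<circ> \<gamma>) has_vector_derivative v t) (at t within J) \<and>
           (v has_vector_derivative w t) (at t within J)) \<and> continuous_on {t \<in> J. \<gamma> t \<in> fst c} w"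
    using has_vector_derivative_within_subset[OF vw(1) J] has_vector_derivative_within_subset[OF vw(2) J] J
    by (intro exI[of _ v] exI[of _ w] conjI ballI impI) (simp_all add: subset_iff)
qed

lemma velocity_subset:
  assumes C: "C2_curve_on \<gamma> I" and J: "J \<subseteq> I" "t \<in> J" "at t within J \<noteq> bot"
  shows "velocity \<gamma> J t = velocity \<gamma> I t"
proof -
  obtain c where c: "c \<in> A" "\<gamma> t \<in> fst c" using cover by blast
  obtain v w where "chart_derivs c \<gamma> I v w"
    by (rule C2_curve_onE[OF C c(1)])
  note v = chart_derivsD[OF this]
  have bot: "at t within I \<noteq> bot" using J at_le[of J I t] by (metis bot.extremum_uniqueI)
  have t: "t \<in> I" using J by auto
  note d = v(1)[OF t c(2)]
  have cI: "continuous_on I \<gamma>" using C2_curve_on_continuous[OF C] .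
  show ?thesis
    using velocity_eq_coord_vec[OF c(1) cI t c(2) bot d]
      velocity_eq_coord_vec[OF c(1) continuous_on_subset[OF cI J(1)] J(2) c(2) J(3)
        has_vector_derivative_within_subset[OF d J(1)]] by simp
qed

lemma velocity_cong:
  assumes "\<And>s. s \<in> I \<Longrightarrow> \<gamma> s = \<gamma>' s" "t \<in> I"
  shows "velocity \<gamma> I t = velocity \<gamma>' I t"
proof -
  have "vector_derivative (snd c \<circ> \<gamma>) (at t within I) = vector_derivative (snd c \<circ> \<gamma>') (at t within I)"
    for c :: "('m, 'n) chart"
    by (rule vector_derivative_cong_eq) (use assms in \<open>auto simp: eventually_at_filter\<close>)
  then show ?thesis unfolding velocity_def by (simp add: assms(1)[OF assms(2)] cong: if_cong)
qed

end

section \<open>The metric and the acceleration in charts\<close>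

context riemannian_manifold
begin

abbreviation gfield :: "('m, 'n) chart \<Rightarrow> real^'n \<Rightarrow> real^'n \<Rightarrow> real^'n" where
  "gfield c \<equiv> \<lambda>p v. gram c p *v v"

lemma metric_coord:
  assumes c: "c \<in> A" "x \<in> fst c"
  shows "g x (coord_vec c x v) (coord_vec c x w) = gfield c (snd c x) v \<bullet> w"
proof -
  have "g x (coord_vec c x v) (coord_vec c x w) = v \<bullet> (gram c (snd c x) *v w)"
    using gram_quadratic[OF c(1), of "snd c x" v w] c chart_inv_left by simp
  moreover have "g x (coord_vec c x v) (coord_vec c x w) = g x (coord_vec c x w) (coord_vec c x v)"
    by (intro metric_sym coord_vec_tangent c)
  moreover have "g x (coord_vec c x w) (coord_vec c x v) = w \<bullet> (gram c (snd c x) *v v)"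
    using gram_quadratic[OF c(1), of "snd c x" w v] c chart_inv_left by simp
  ultimately show ?thesis by (simp add: inner_commute)
qed

lemma gram_has_derivative:
  assumes c: "c \<in> A" and p: "p \<in> snd c ` fst c"
  shows "((\<lambda>p. gram c p $ i $ j) has_derivative (\<lambda>z. \<Sum>k\<in>UNIV. z $ k * dgram c p k i j)) (at p)"
proof -
  have "Ck_on 1 (\<lambda>p. gram c p $ i $ j) (snd c ` fst c)"
    using metric_smooth[OF c, of i j] unfolding smooth_on_def gram_def by simp
  from Ck_on_1_has_derivative[OF this p]
  have D: "((\<lambda>p. gram c p $ i $ j) has_derivative frechet_derivative (\<lambda>p. gram c p $ i $ j) (at p)) (at p)" .
  have "frechet_derivative (\<lambda>p. gram c p $ i $ j) (at p) z = (\<Sum>k\<in>UNIV. z $ k * dgram c p k i j)" for z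
  proof -
    have "frechet_derivative (\<lambda>p. gram c p $ i $ j) (at p) z
        = frechet_derivative (\<lambda>p. gram c p $ i $ j) (at p) (\<Sum>k\<in>UNIV. z $ k *\<^sub>R axis k 1)"
      using basis_expansion[of z] by (simp add: scalar_mult_eq_scaleR)
    also have "\<dots> = (\<Sum>k\<in>UNIV. z $ k * dgram c p k i j)"
      by (simp add: linear_sum[OF has_derivative_linear[OF D]] linear_cmul[OF has_derivative_linear[OF D]] dgram_def)
    finally show ?thesis .
  qed
  then have "frechet_derivative (\<lambda>p. gram c p $ i $ j) (at p) = (\<lambda>z. \<Sum>k\<in>UNIV. z $ k * dgram c p k i j)"
    by (rule ext)
  then show ?thesis using D by simp
qed

lemma gfield_has_derivative:
  assumes c: "c \<in> A" and p: "p \<in> snd c ` fst c"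
  shows "((\<lambda>p. gfield c p v) has_derivative
    (\<lambda>z. \<chi> i. \<Sum>j\<in>UNIV. (\<Sum>k\<in>UNIV. z $ k * dgram c p k i j) * v $ j)) (at p)"
proof -
  have e: "(\<chi> i. h i) = (\<Sum>i\<in>UNIV. h i *\<^sub>R axis i 1)" for h :: "'n \<Rightarrow> real"
    using basis_expansion[of "\<chi> i. h i"] by (simp add: scalar_mult_eq_scaleR)
  show ?thesis
    unfolding matrix_vector_mult_def e
    by (intro has_derivative_sum has_derivative_scaleR_left has_derivative_mult_left gram_has_derivative[OF c p])
qed

lemma metric_field_gfield:
  assumes c: "c \<in> A"
  shows "metric_field (snd c ` fst c) (gfield c)"
  unfolding metric_field_def C1_field_def
proof (intro conjI ballI allI impI image_open[OF c])
  fix v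
  have "continuous_on (snd c ` fst c) (\<lambda>p. dgram c p k i j)" for k i j
  proof -
    have "Ck_on 1 (\<lambda>p. gram c p $ i $ j) (snd c ` fst c)"
      using metric_smooth[OF c, of i j] unfolding smooth_on_def gram_def by simp
    then show ?thesis unfolding dgram_def by simp
  qed
  then show "Ck_on 1 (\<lambda>p. gfield c p v) (snd c ` fst c)"
    by (intro Ck_on_1I[OF gfield_has_derivative[OF c]] continuous_intros) auto
next
  fix p assume p: "p \<in> snd c ` fst c"
  show "linear (gfield c p)" by simp
  have *: "chart_inv c p \<in> fst c" "snd c (chart_inv c p) = p" using p c chart_inv_mem chart_inv_right by auto
  note M = metric_coord[OF c *(1), unfolded *(2)]
  show "gfield c p v \<bullet> w = gfield c p w \<bullet> v" for v w
    using metric_sym[OF coord_vec_tangent[OF c *(1)] coord_vec_tangent[OF c *(1)]] M by metis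
  fix v :: "real^'n" assume "v \<noteq> 0"
  then have "coord_vec c (chart_inv c p) v \<noteq> (\<lambda>_. 0)"
    using coord_vec_self[OF c *(1)] by metis
  then show "0 < gfield c p v \<bullet> v"
    using metric_pos[OF coord_vec_tangent[OF c *(1)]] M by metis
qed

lemma C1_field_gfield: "c \<in> A \<Longrightarrow> C1_field (snd c ` fst c) (gfield c)"
  using metric_field_gfield by (simp add: metric_field_def)

lemma dfield_gfield:
  assumes c: "c \<in> A" and p: "p \<in> snd c ` fst c"
  shows "dfield (gfield c) p z v = (\<chi> i. \<Sum>j\<in>UNIV. (\<Sum>k\<in>UNIV. z $ k * dgram c p k i j) * v $ j)"
  by (rule fun_cong[OF has_derivative_unique[OF dfield_has_derivative[OF C1_field_gfield[OF c] p]
        gfield_has_derivative[OF c p]]])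

lemma tnorm_coord: "c \<in> A \<Longrightarrow> x \<in> fst c \<Longrightarrow> tnorm x (coord_vec c x v) = sqrt (gfield c (snd c x) v \<bullet> v)"
  by (simp add: tnorm_def metric_coord)

text \<open>Both charts compute \<open>g\<close> at the same point, so a transition map is an
  isometry between the coordinate metrics. This makes \<open>EL_pullback\<close> applicable to chart
  changes.\<close>

lemma gfield_transition:
  assumes c: "c \<in> A" "c' \<in> A" and p: "p \<in> snd c ` (fst c \<inter> fst c')"
  shows "gfield c p v = pullback (transition c c') (gfield c') p v"
proof -
  obtain x where x: "x \<in> fst c" "x \<in> fst c'" "p = snd c x" using p by auto
  have sub: "transition c c' ` (snd c ` (fst c \<inter> fst c')) \<subseteq> snd c' ` fst c'"
    using c by (auto simp: transition_eq)
  let ?D = "frechet_derivative (transition c c') (at p)"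
  have cv: "coord_vec c x v = coord_vec c' x (?D v)" for v
    using tangent_space_coord_vec[OF coord_vec_tangent[OF c(1) x(1)] c(2) x(2)] x c
    by (simp add: coord_vec_def)
  have "gfield c p v \<bullet> w = pullback (transition c c') (gfield c') p v \<bullet> w" for w
  proof -
    have "gfield c p v \<bullet> w = g x (coord_vec c' x (?D v)) (coord_vec c' x (?D w))"
      using metric_coord[OF c(1) x(1)] x cv by simp
    also have "\<dots> = gfield c' (transition c c' p) (?D v) \<bullet> ?D w"
      using metric_coord[OF c(2) x(2)] x c by (simp add: transition_eq)
    also have "\<dots> = pullback (transition c c') (gfield c') p v \<bullet> w"
      using pullback_inner[OF open_chart_overlap[OF c] transition_Ck_on[OF c] sub C1_field_gfield[OF c(2)] p] by simp
    finally show ?thesis .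
  qed
  then show ?thesis using vector_eq_rdot by blast
qed

lemma EL_transition:
  assumes c: "c \<in> A" "c' \<in> A" and p: "p \<in> snd c ` (fst c \<inter> fst c')"
  defines "D \<equiv> \<lambda>y. frechet_derivative (transition c c') (at y)"
  shows "EL (gfield c) p v w z =
    EL (gfield c') (transition c c' p) (D p v) (dfield D p v v + D p w) (D p z)"
proof -
  have sub: "transition c c' ` (snd c ` (fst c \<inter> fst c')) \<subseteq> snd c' ` fst c'"
    using c by (auto simp: transition_eq)
  have sym: "gfield c' (transition c c' p) v \<bullet> w = gfield c' (transition c c' p) w \<bullet> v" for v w
    using metric_field_gfield[OF c(2)] p sub unfolding metric_field_def by blast
  have "EL (gfield c) p v w z = EL (pullback (transition c c') (gfield c')) p v w z"
    by (rule EL_cong[OF open_chart_overlap[OF c] p]) (rule gfield_transition[OF c])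
  also have "\<dots> = EL (gfield c') (transition c c' p) (D p v) (dfield D p v v + D p w) (D p z)"
    unfolding D_def
    by (rule EL_pullback[OF open_chart_overlap[OF c] transition_Ck_on[OF c] sub C1_field_gfield[OF c(2)] p sym])
  finally show ?thesis .
qed

text \<open>The components of \<open>D\<^sub>t \<gamma>'\<close> as a function of position
  \<open>p\<close>, velocity \<open>v\<close> and coordinate second derivative
  \<open>w\<close>.\<close>

definition coord_accel :: "('m, 'n) chart \<Rightarrow> real^'n \<Rightarrow> real^'n \<Rightarrow> real^'n \<Rightarrow> real^'n" where
  "coord_accel c p v w = (\<chi> k. w $ k + (\<Sum>i\<in>UNIV. \<Sum>j\<in>UNIV. christoffel c p k i j * v $ i * v $ j))"

text \<open>Lowering the index removes the inverse matrix, by \<open>christoffel_first_kind\<close>.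
  After contraction with \<open>v\<close> twice, two of the three terms there coincide and add up to
  \<open>dfield\<close> in direction \<open>v\<close>; the third is half the derivative, in
  direction \<open>z\<close>, of the squared length of \<open>v\<close>.\<close>

lemma gfield_coord_accel:
  assumes c: "c \<in> A" and p: "p \<in> snd c ` fst c"
  shows "gfield c p (coord_accel c p v w) \<bullet> z = EL (gfield c) p v w z"
proof -
  define S where "S a b m = v $ a * v $ b * dgram c p a b m" for a b m
  define T where "T m = (\<Sum>i\<in>UNIV. \<Sum>j\<in>UNIV. v $ i * v $ j * dgram c p m i j)" for m
  have 1: "(\<Sum>k\<in>UNIV. gram c p $ m $ k * (\<Sum>i\<in>UNIV. \<Sum>j\<in>UNIV. christoffel c p k i j * v $ i * v $ j))
      = (\<Sum>i\<in>UNIV. \<Sum>j\<in>UNIV. S i j m) - T m / 2" for m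
  proof -
    have "(\<Sum>k\<in>UNIV. gram c p $ m $ k * (\<Sum>i\<in>UNIV. \<Sum>j\<in>UNIV. christoffel c p k i j * v $ i * v $ j))
        = (\<Sum>k\<in>UNIV. \<Sum>i\<in>UNIV. \<Sum>j\<in>UNIV. v $ i * v $ j * (gram c p $ m $ k * christoffel c p k i j))"
      by (simp add: sum_distrib_left mult_ac)
    also have "\<dots> = (\<Sum>i\<in>UNIV. \<Sum>k\<in>UNIV. \<Sum>j\<in>UNIV. v $ i * v $ j * (gram c p $ m $ k * christoffel c p k i j))"
      by (rule sum.swap)
    also have "\<dots> = (\<Sum>i\<in>UNIV. \<Sum>j\<in>UNIV. \<Sum>k\<in>UNIV. v $ i * v $ j * (gram c p $ m $ k * christoffel c p k i j))"
      by (intro sum.cong refl sum.swap)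
    also have "\<dots> = (\<Sum>i\<in>UNIV. \<Sum>j\<in>UNIV. v $ i * v $ j *
        ((dgram c p i j m + dgram c p j i m - dgram c p m i j) / 2))"
      by (simp only: sum_distrib_left[symmetric] christoffel_first_kind[OF c p])
    also have "\<dots> = (\<Sum>i\<in>UNIV. \<Sum>j\<in>UNIV. S i j m / 2 + S j i m / 2 - v $ i * v $ j * dgram c p m i j / 2)"
      by (intro sum.cong refl) (simp add: S_def field_simps)
    also have "\<dots> = (\<Sum>i\<in>UNIV. \<Sum>j\<in>UNIV. S i j m) / 2 + (\<Sum>i\<in>UNIV. \<Sum>j\<in>UNIV. S j i m) / 2 - T m / 2"
      by (simp add: sum.distrib sum_subtractf sum_divide_distrib T_def)
    also have "(\<Sum>i\<in>UNIV. \<Sum>j\<in>UNIV. S j i m) = (\<Sum>i\<in>UNIV. \<Sum>j\<in>UNIV. S i j m)" by (rule sum.swap)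
    finally show ?thesis by simp
  qed
  have 2: "gfield c p (coord_accel c p v w) $ m = gfield c p w $ m + ((\<Sum>i\<in>UNIV. \<Sum>j\<in>UNIV. S i j m) - T m / 2)" for m
    using 1[of m] by (simp add: coord_accel_def matrix_vector_mult_def ring_distribs sum.distrib)
  have 3: "dfield (gfield c) p v v $ m = (\<Sum>i\<in>UNIV. \<Sum>j\<in>UNIV. S i j m)" for m
  proof -
    have "dfield (gfield c) p v v $ m = (\<Sum>j\<in>UNIV. \<Sum>i\<in>UNIV. S i j m)"
      by (simp add: dfield_gfield[OF c p] S_def sum_distrib_left sum_distrib_right dgram_sym[OF c p, of _ m] mult_ac)
    also have "\<dots> = (\<Sum>i\<in>UNIV. \<Sum>j\<in>UNIV. S i j m)" by (rule sum.swap)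
    finally show ?thesis .
  qed
  have 4: "dfield (gfield c) p z v \<bullet> v = (\<Sum>m\<in>UNIV. z $ m * T m)"
  proof -
    have "dfield (gfield c) p z v \<bullet> v = (\<Sum>i\<in>UNIV. \<Sum>j\<in>UNIV. \<Sum>k\<in>UNIV. z $ k * (v $ i * v $ j * dgram c p k i j))"
      by (simp add: dfield_gfield[OF c p] inner_vec_def sum_distrib_left sum_distrib_right mult_ac)
    also have "\<dots> = (\<Sum>i\<in>UNIV. \<Sum>k\<in>UNIV. \<Sum>j\<in>UNIV. z $ k * (v $ i * v $ j * dgram c p k i j))"
      by (intro sum.cong refl sum.swap)
    also have "\<dots> = (\<Sum>k\<in>UNIV. \<Sum>i\<in>UNIV. \<Sum>j\<in>UNIV. z $ k * (v $ i * v $ j * dgram c p k i j))"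
      by (rule sum.swap)
    finally show ?thesis by (simp add: T_def sum_distrib_left)
  qed
  have "gfield c p (coord_accel c p v w) \<bullet> z =
      (\<Sum>m\<in>UNIV. (gfield c p w $ m + ((\<Sum>i\<in>UNIV. \<Sum>j\<in>UNIV. S i j m) - T m / 2)) * z $ m)"
    by (simp only: inner_vec_def inner_real_def 2)
  also have "\<dots> = (\<Sum>m\<in>UNIV. gfield c p w $ m * z $ m) + (\<Sum>m\<in>UNIV. dfield (gfield c) p v v $ m * z $ m)
      - (\<Sum>m\<in>UNIV. z $ m * T m) / 2"
    by (simp add: 3 ring_distribs sum.distrib sum_subtractf sum_divide_distrib mult.commute)
  also have "\<dots> = EL (gfield c) p v w z"
    by (simp add: EL_def 4 inner_vec_def[of "gfield c p w"] inner_vec_def[of "dfield (gfield c) p v v"])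
  finally show ?thesis .
qed

lemma covariant_derivative_coord:
  assumes c: "c \<in> A" and \<gamma>: "continuous_on I \<gamma>" "t \<in> I" "\<gamma> t \<in> fst c"
    and bot: "\<And>s. s \<in> I \<Longrightarrow> at s within I \<noteq> bot"
    and v: "\<And>s. s \<in> I \<Longrightarrow> \<gamma> s \<in> fst c \<Longrightarrow> ((snd c \<circ> \<gamma>) has_vector_derivative v s) (at s within I)"
    and w: "(v has_vector_derivative w) (at t within I)"
  shows "covariant_derivative \<gamma> I (velocity \<gamma> I) t c = coord_accel c (snd c (\<gamma> t)) (v t) w"
proof -
  have vel: "velocity \<gamma> I s c = v s" if "s \<in> I" "\<gamma> s \<in> fst c" for s
    using vector_derivative_within[OF bot v] that c by (simp add: velocity_def)
  have "((\<lambda>s. velocity \<gamma> I s c) has_vector_derivative w) (at t within I)"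
  proof (rule has_vector_derivative_transform_eventually[OF w])
    show "\<forall>\<^sub>F s in at t within I. v s = velocity \<gamma> I s c"
      using eventually_in_chart[OF c \<gamma>] eventually_at_topological[of "\<lambda>s. s \<in> I" t I] vel
      by (auto elim!: eventually_rev_mp simp: eventually_at_filter)
  qed (use vel \<gamma> in auto)
  then have "vector_derivative (\<lambda>s. velocity \<gamma> I s c) (at t within I) = w"
    using vector_derivative_within[OF bot[OF \<gamma>(2)]] by blast
  then show ?thesis
    using c \<gamma> vel by (simp add: covariant_derivative_def coord_accel_def)
qed

text \<open>By naturality of \<open>EL\<close> the lowered accelerations in two charts agree as
  functionals. The transition derivative is onto, so nondegeneracy of the metric turns this into the
  transformation rule for the components.\<close>

lemma covariant_derivative_tangent:
  assumes C: "C2_curve_on \<gamma> I" and t: "t \<in> I" and bot: "\<And>s. s \<in> I \<Longrightarrow> at s within I \<noteq> bot"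
  shows "covariant_derivative \<gamma> I (velocity \<gamma> I) t \<in> tangent_space (\<gamma> t)" (is "?a \<in> _")
  unfolding tangent_space_def mem_Collect_eq
proof (intro conjI allI impI ballI)
  fix c assume "c \<notin> A \<or> \<gamma> t \<notin> fst c"
  then show "?a c = 0" by (auto simp: covariant_derivative_def)
next
  fix c c' assume c: "c \<in> A" and c': "c' \<in> A" and "\<gamma> t \<in> fst c \<inter> fst c'"
  then have x: "\<gamma> t \<in> fst c" "\<gamma> t \<in> fst c'" by auto
  note ct = C2_curve_on_continuous[OF C]
  obtain v w where "chart_derivs c \<gamma> I v w"
    by (rule C2_curve_onE[OF C c])
  note vw = chart_derivsD[OF this]
  obtain v' w' where "chart_derivs c' \<gamma> I v' w'"
    by (rule C2_curve_onE[OF C c'])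
  note vw' = chart_derivsD[OF this]
  define D where "D = (\<lambda>y. frechet_derivative (transition c c') (at y))"
  define p where "p = snd c (\<gamma> t)"
  define p' where "p' = snd c' (\<gamma> t)"
  have p: "p \<in> snd c ` (fst c \<inter> fst c')" "p \<in> snd c ` fst c" "p' \<in> snd c' ` fst c'" "transition c c' p = p'"
    using x c by (auto simp: p_def p'_def transition_eq)
  have CD: "C1_field (snd c ` (fst c \<inter> fst c')) D"
    unfolding D_def using C1_field_frechet[OF open_chart_overlap[OF c c'] transition_Ck_on[OF c c']] .
  have v': "v' s = D (snd c (\<gamma> s)) (v s)" if "s \<in> I" "\<gamma> s \<in> fst c" "\<gamma> s \<in> fst c'" for s
    using chart_change_has_vector_derivative[OF c c' ct that vw(1)] vw'(1) that bot
      vector_derivative_unique_within unfolding D_def by blast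
  have w': "w' t = dfield D p (v t) (v t) + D p (w t)"
  proof -
    have "((\<lambda>s. D ((snd c \<circ> \<gamma>) s) (v s)) has_vector_derivative dfield D p (v t) (v t) + D p (w t)) (at t within I)"
      using C1_field_chain_vector[OF CD vw(1)[OF t x(1)] _ t vw(2)[OF t x(1)]] x by (simp add: p_def)
    moreover have eventually_in_I: "\<forall>\<^sub>F s in at t within I. s \<in> I" by (simp add: eventually_at_filter)
    have "\<forall>\<^sub>F s in at t within I. D ((snd c \<circ> \<gamma>) s) (v s) = v' s"
      using eventually_in_chart[OF c ct t x(1)] eventually_in_chart[OF c' ct t x(2)] eventually_in_I
      by eventually_elim (simp add: v')
    ultimately have "(v' has_vector_derivative dfield D p (v t) (v t) + D p (w t)) (at t within I)"
      by (rule has_vector_derivative_transform_eventually) (use v'[OF t x] t in auto)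
    then show ?thesis using vw'(2)[OF t x(2)] vector_derivative_unique_within[OF bot[OF t]] by blast
  qed
  define a where "a = coord_accel c p (v t) (w t)"
  define a' where "a' = coord_accel c' p' (v' t) (w' t)"
  have eq: "gfield c p a \<bullet> z = gfield c' p' a' \<bullet> D p z" for z
  proof -
    have "gfield c p a \<bullet> z = EL (gfield c) p (v t) (w t) z"
      unfolding a_def by (rule gfield_coord_accel[OF c p(2)])
    also have "\<dots> = EL (gfield c') p' (v' t) (w' t) (D p z)"
      using EL_transition[OF c c' p(1), of "v t" "w t" z] p(4) w' v'[OF t x] unfolding D_def p_def by simp
    also have "\<dots> = gfield c' p' a' \<bullet> D p z"
      unfolding a'_def by (rule gfield_coord_accel[OF c' p(3), symmetric])
    finally show ?thesis .
  qed
  have "gfield c p a \<bullet> z = gfield c' p' (D p a) \<bullet> D p z" for z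
  proof -
    have "transition c c' ` (snd c ` (fst c \<inter> fst c')) \<subseteq> snd c' ` fst c'"
      using c by (auto simp: transition_eq)
    from pullback_inner[OF open_chart_overlap[OF c c'] transition_Ck_on[OF c c'] this C1_field_gfield[OF c'] p(1)]
    show ?thesis using gfield_transition[OF c c' p(1)] p(4) unfolding D_def by simp
  qed
  then have *: "gfield c' p' (a' - D p a) \<bullet> D p z = 0" for z
    using eq by (simp add: matrix_vector_mult_diff_distrib inner_diff_left)
  \<comment> \<open>Surjectivity: \<open>z\<close> consists of the components in \<open>c\<close> of
    the tangent vector whose components in \<open>c'\<close> are \<open>a' - D p a\<close>.\<close>
  obtain z where z: "D p z = a' - D p a"
    using tangent_space_transition[OF coord_vec_tangent[OF c' x(2)] c c' x] coord_vec_self[OF c' x(2)]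
    unfolding D_def p_def by metis
  have "a' - D p a = 0"
  proof (rule ccontr)
    assume "a' - D p a \<noteq> 0"
    then have "0 < gfield c' p' (a' - D p a) \<bullet> (a' - D p a)"
      using metric_field_gfield[OF c'] p(3) unfolding metric_field_def by blast
    then show False using *[of z] z by simp
  qed
  moreover have "?a c = a" "?a c' = a'"
    unfolding a_def a'_def p_def p'_def
    using covariant_derivative_coord[OF c ct t x(1) bot vw(1) vw(2)[OF t x(1)]]
      covariant_derivative_coord[OF c' ct t x(2) bot vw'(1) vw'(2)[OF t x(2)]] by auto
  ultimately show "?a c' = frechet_derivative (transition c c') (at (snd c (\<gamma> t))) (?a c)"
    by (simp add: D_def p_def)
qed

end

section \<open>Piecewise regular curves and their length\<close>

context smooth_manifold
begin

definition regular_piece :: "(real \<Rightarrow> 'm) \<Rightarrow> real \<Rightarrow> real \<Rightarrow> bool" where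
  "regular_piece \<gamma> a b \<longleftrightarrow> a < b \<and> C2_curve_on \<gamma> {a..b} \<and> (\<forall>t\<in>{a..b}. velocity \<gamma> {a..b} t \<noteq> (\<lambda>_. 0))"

lemma regular_piece_subset:
  assumes "regular_piece \<gamma> a b" "a \<le> a'" "a' < b'" "b' \<le> b"
  shows "regular_piece \<gamma> a' b'"
proof -
  have sub: "{a'..b'} \<subseteq> {a..b}" using assms by auto
  have C: "C2_curve_on \<gamma> {a..b}" using assms by (simp add: regular_piece_def)
  have "velocity \<gamma> {a'..b'} t \<noteq> (\<lambda>_. 0)" if t: "t \<in> {a'..b'}" for t
    using velocity_subset[OF C sub t at_within_Icc_neq_bot[OF assms(3) t]] assms(1) t sub
    unfolding regular_piece_def by auto
  then show ?thesis using C2_curve_on_subset[OF C sub] assms(3) unfolding regular_piece_def by blast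
qed

lemma C2_curve_on_cong:
  assumes C: "C2_curve_on \<gamma> I" and eq: "\<And>t. t \<in> I \<Longrightarrow> \<gamma> t = \<gamma>' t"
  shows "C2_curve_on \<gamma>' I"
  unfolding C2_curve_on_def
proof (intro conjI ballI)
  show "continuous_on I \<gamma>'" using C2_curve_on_continuous[OF C] eq by (rule continuous_on_eq)
  fix c assume "c \<in> A"
  then obtain v w where "chart_derivs c \<gamma> I v w" by (rule C2_curve_onE[OF C])
  note vw = chart_derivsD[OF this]
  have "((snd c \<circ> \<gamma>') has_vector_derivative v t) (at t within I)" if t: "t \<in> I" "\<gamma>' t \<in> fst c" for t
    by (rule has_vector_derivative_transform[OF t(1) _ vw(1)]) (use t eq in auto)
  moreover have "{t \<in> I. \<gamma>' t \<in> fst c} = {t \<in> I. \<gamma> t \<in> fst c}" using eq by auto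
  ultimately show "\<exists>v w. (\<forall>t\<in>I. \<gamma>' t \<in> fst c \<longrightarrow> ((snd c \<circ> \<gamma>') has_vector_derivative v t) (at t within I) \<and>
           (v has_vector_derivative w t) (at t within I)) \<and> continuous_on {t \<in> I. \<gamma>' t \<in> fst c} w"
    using vw eq by (intro exI[of _ v] exI[of _ w] conjI ballI impI) auto
qed

lemma regular_piece_cong:
  assumes "regular_piece \<gamma> a b" "\<And>t. t \<in> {a..b} \<Longrightarrow> \<gamma> t = \<gamma>' t"
  shows "regular_piece \<gamma>' a b"
proof -
  have "velocity \<gamma>' {a..b} t = velocity \<gamma> {a..b} t" if "t \<in> {a..b}" for t
    using velocity_cong[of "{a..b}" \<gamma> \<gamma>' t] assms(2) that by auto
  then show ?thesis
    using assms C2_curve_on_cong[of \<gamma> "{a..b}" \<gamma>'] unfolding regular_piece_def by simp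
qed

lemma piecewise_regular_iff:
  "piecewise_regular \<gamma> a b \<longleftrightarrow> a < b \<and> continuous_on {a..b} \<gamma> \<and>
     (\<exists>(p::nat \<Rightarrow> real) n. p 0 = a \<and> p n = b \<and> (\<forall>i<n. regular_piece \<gamma> (p i) (p (Suc i))))"
  unfolding piecewise_regular_def regular_piece_def by blast

lemma piecewise_regular_piece:
  assumes "regular_piece \<gamma> a b"
  shows "piecewise_regular \<gamma> a b"
proof -
  have "continuous_on {a..b} \<gamma>" "a < b"
    using assms C2_curve_on_continuous unfolding regular_piece_def by auto
  then show ?thesis
    unfolding piecewise_regular_iff using assms
    by (intro conjI exI[of _ "\<lambda>i::nat. if i = 0 then a else b"] exI[of _ "1::nat"]) auto
qed

lemma piecewise_regular_join:
  assumes "piecewise_regular \<gamma> a m" "piecewise_regular \<gamma> m b"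
  shows "piecewise_regular \<gamma> a b"
proof -
  obtain p n where p: "a < m" "continuous_on {a..m} \<gamma>" "p 0 = a" "p n = m"
      "\<And>i. i < n \<Longrightarrow> regular_piece \<gamma> (p i) (p (Suc i))"
    using assms(1) unfolding piecewise_regular_iff by blast
  obtain q k where q: "m < b" "continuous_on {m..b} \<gamma>" "q 0 = m" "q k = b"
      "\<And>i. i < k \<Longrightarrow> regular_piece \<gamma> (q i) (q (Suc i))"
    using assms(2) unfolding piecewise_regular_iff by blast
  define r where "r i = (if i \<le> n then p i else q (i - n))" for i
  have "regular_piece \<gamma> (r i) (r (Suc i))" if i: "i < n + k" for i
  proof (cases "i < n")
    case True
    then show ?thesis using p(5) by (simp add: r_def)
  next
    case False
    then have "r i = q (i - n)" "r (Suc i) = q (Suc (i - n))"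
      using p(4) q(3) by (auto simp: r_def Suc_diff_le)
    then show ?thesis using q(5)[of "i - n"] i False by simp
  qed
  moreover have "r 0 = a" "r (n + k) = b" using p q by (cases "k = 0"; force simp: r_def)+
  moreover have "continuous_on {a..b} \<gamma>"
    using continuous_on_closed_Un[OF _ _ p(2) q(2)] p(1) q(1) by (simp add: ivl_disj_un_two_touch)
  ultimately show ?thesis
    unfolding piecewise_regular_iff using p(1) q(1)
    by (intro conjI exI[of _ r] exI[of _ "n + k"]) auto
qed

text \<open>Induction on the number of pieces, appending the last one; it spares later proofs the
  indices of a partition.\<close>

lemma piecewise_regular_induct [consumes 1, case_names piece join]:
  assumes pr: "piecewise_regular \<gamma> a b"
    and piece: "\<And>a b. regular_piece \<gamma> a b \<Longrightarrow> P a b"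
    and join: "\<And>a m b. piecewise_regular \<gamma> a m \<Longrightarrow> P a m \<Longrightarrow> regular_piece \<gamma> m b \<Longrightarrow> P m b \<Longrightarrow> P a b"
  shows "P a b"
proof -
  obtain p n where p: "a < b" "p 0 = a" "p n = b" "\<And>i. i < n \<Longrightarrow> regular_piece \<gamma> (p i) (p (Suc i))"
    using pr unfolding piecewise_regular_iff by blast
  have "piecewise_regular \<gamma> (p 0) (p (Suc i)) \<and> P (p 0) (p (Suc i))" if "i < n" for i
    using that
  proof (induction i)
    case 0
    then show ?case using p(4) piece piecewise_regular_piece by blast
  next
    case (Suc i)
    then have "piecewise_regular \<gamma> (p 0) (p (Suc i))" "P (p 0) (p (Suc i))" by auto
    moreover have "regular_piece \<gamma> (p (Suc i)) (p (Suc (Suc i)))" using p(4) Suc.prems by blast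
    ultimately show ?case using join piece piecewise_regular_piece piecewise_regular_join by blast
  qed
  \<comment> \<open>At least one piece exists because \<open>a < b\<close>, so the rule can start
    from a piece instead of an empty partition.\<close>
  moreover have "n \<noteq> 0" using p by (intro notI) simp
  ultimately show ?thesis using p by (metis Suc_pred lessI neq0_conv)
qed

lemma piecewise_regular_less: "piecewise_regular \<gamma> a b \<Longrightarrow> a < b"
  by (simp add: piecewise_regular_def)

lemma piecewise_regular_continuous: "piecewise_regular \<gamma> a b \<Longrightarrow> continuous_on {a..b} \<gamma>"
  by (simp add: piecewise_regular_def)

lemma piecewise_regular_split:
  assumes "piecewise_regular \<gamma> a b" "a < m" "m < b"
  shows "piecewise_regular \<gamma> a m \<and> piecewise_regular \<gamma> m b"
  using assms
proof (induction arbitrary: m rule: piecewise_regular_induct)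
  case (piece a b)
  then show ?case
    using regular_piece_subset[of \<gamma> a b] by (auto intro!: piecewise_regular_piece)
next
  case (join a k b)
  note k = piecewise_regular_piece[OF join.hyps(2)]
  consider "m < k" | "m = k" | "k < m" by linarith
  then show ?case
  proof cases
    case 1
    then show ?thesis using join.IH(1)[of m] join.prems piecewise_regular_join[OF _ k] by blast
  next
    case 2
    then show ?thesis using join.hyps k by blast
  next
    case 3
    then show ?thesis using join.IH(2)[of m] join.prems piecewise_regular_join[OF join.hyps(1)] by blast
  qed
qed

lemma piecewise_regular_cong:
  assumes "piecewise_regular \<gamma> a b" "\<And>t. t \<in> {a..b} \<Longrightarrow> \<gamma> t = \<gamma>' t"
  shows "piecewise_regular \<gamma>' a b"
  using assms
proof (induction rule: piecewise_regular_induct)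
  case (piece a b)
  then show ?case by (intro piecewise_regular_piece) (rule regular_piece_cong)
next
  case (join a m b)
  have "a < m" "m < b" using join.hyps piecewise_regular_less piecewise_regular_piece by blast+
  then show ?case using join.IH join.prems by (intro piecewise_regular_join[of _ a m b]) auto
qed

text \<open>The exceptional set collects the end points of all pieces; every other parameter is
  interior to a piece.\<close>

lemma piecewise_regular_regular_points:
  assumes "piecewise_regular \<gamma> a b"
  obtains F where "finite F" "\<And>t. t \<in> {a..b} - F \<Longrightarrow>
    \<exists>\<alpha> \<beta>. \<alpha> < t \<and> t < \<beta> \<and> a \<le> \<alpha> \<and> \<beta> \<le> b \<and> regular_piece \<gamma> \<alpha> \<beta>"
proof -
  have "\<exists>F. finite F \<and> (\<forall>t\<in>{a..b} - F. \<exists>\<alpha> \<beta>. \<alpha> < t \<and> t < \<beta> \<and> a \<le> \<alpha> \<and> \<beta> \<le> b \<and> regular_piece \<gamma> \<alpha> \<beta>)"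
    using assms
  proof (induction rule: piecewise_regular_induct)
    case (piece a b)
    then show ?case by (intro exI[of _ "{a, b}"]) force
  next
    case (join a m b)
    have ab: "a < m" "m < b" using join.hyps piecewise_regular_less piecewise_regular_piece by blast+
    obtain F F' where F: "finite F" "finite F'"
        "\<forall>t\<in>{a..m} - F. \<exists>\<alpha> \<beta>. \<alpha> < t \<and> t < \<beta> \<and> a \<le> \<alpha> \<and> \<beta> \<le> m \<and> regular_piece \<gamma> \<alpha> \<beta>"
        "\<forall>t\<in>{m..b} - F'. \<exists>\<alpha> \<beta>. \<alpha> < t \<and> t < \<beta> \<and> m \<le> \<alpha> \<and> \<beta> \<le> b \<and> regular_piece \<gamma> \<alpha> \<beta>"
      using join.IH by blast
    have "\<exists>\<alpha> \<beta>. \<alpha> < t \<and> t < \<beta> \<and> a \<le> \<alpha> \<and> \<beta> \<le> b \<and> regular_piece \<gamma> \<alpha> \<beta>"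
      if t: "t \<in> {a..b} - (F \<union> F')" for t
    proof (cases "t \<le> m")
      case True
      then show ?thesis using F(3) t ab by (force dest: bspec[of _ _ t])
    next
      case False
      then show ?thesis using F(4) t ab by (force dest: bspec[of _ _ t])
    qed
    then show ?case using F by (intro exI[of _ "F \<union> F'"]) auto
  qed
  then show ?thesis using that by blast
qed

text \<open>At an interior point the filter \<open>at t within\<close> an interval is
  \<open>at t\<close>, so this holds even where the curve has no derivative.\<close>

lemma velocity_interior:
  assumes "a \<le> a'" "b' \<le> b" "a' < t" "t < b'"
  shows "velocity \<gamma> {a..b} t = velocity \<gamma> {a'..b'} t"
proof -
  have "at t within {a..b} = at t" "at t within {a'..b'} = at t"
    using assms by (simp_all add: at_within_Icc_at)
  then show ?thesis by (simp add: velocity_def cong: if_cong)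
qed

end

section \<open>Speed and length of piecewise regular curves\<close>

context riemannian_manifold
begin

abbreviation speed :: "(real \<Rightarrow> 'm) \<Rightarrow> real set \<Rightarrow> real \<Rightarrow> real" where
  "speed \<gamma> I t \<equiv> tnorm (\<gamma> t) (velocity \<gamma> I t)"

lemma speed_coord:
  assumes "c \<in> A" "continuous_on I \<gamma>" "t \<in> I" "\<gamma> t \<in> fst c" "at t within I \<noteq> bot"
    "((snd c \<circ> \<gamma>) has_vector_derivative v) (at t within I)"
  shows "speed \<gamma> I t = sqrt (gfield c (snd c (\<gamma> t)) v \<bullet> v)"
  using velocity_eq_coord_vec[OF assms] tnorm_coord[OF assms(1,4)] by simp

lemma gfield_nonneg: "c \<in> A \<Longrightarrow> p \<in> snd c ` fst c \<Longrightarrow> 0 \<le> gfield c p v \<bullet> v"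
  using metric_field_gfield[of c] unfolding metric_field_def by (cases "v = 0") (auto intro: less_imp_le)

lemma regular_piece_chartI:
  assumes c: "c \<in> A" and ab: "a < b" and \<gamma>: "continuous_on {a..b} \<gamma>" "\<gamma> ` {a..b} \<subseteq> fst c"
    and v: "\<And>t. t \<in> {a..b} \<Longrightarrow> ((snd c \<circ> \<gamma>) has_vector_derivative v t) (at t within {a..b})"
    and w: "\<And>t. t \<in> {a..b} \<Longrightarrow> (v has_vector_derivative w t) (at t within {a..b})"
    and cw: "continuous_on {a..b} w" and nz: "\<And>t. t \<in> {a..b} \<Longrightarrow> v t \<noteq> 0"
  shows "regular_piece \<gamma> a b"
  unfolding regular_piece_def
proof (intro conjI ballI ab)
  show "C2_curve_on \<gamma> {a..b}" by (rule C2_curve_on_chartI[OF c \<gamma> v w cw])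
  fix t assume t: "t \<in> {a..b}"
  have tc: "\<gamma> t \<in> fst c" using \<gamma>(2) t by auto
  have "velocity \<gamma> {a..b} t c = v t"
    using velocity_eq_coord_vec[OF c \<gamma>(1) t tc at_within_Icc_neq_bot[OF ab t] v[OF t]] coord_vec_self[OF c tc]
    by simp
  then show "velocity \<gamma> {a..b} t \<noteq> (\<lambda>_. 0)" using nz[OF t] by auto
qed

lemma continuous_on_speed:
  assumes C: "C2_curve_on \<gamma> I" and bot: "\<And>s. s \<in> I \<Longrightarrow> at s within I \<noteq> bot"
  shows "continuous_on I (speed \<gamma> I)"
  unfolding continuous_on_eq_continuous_within
proof
  fix t assume t: "t \<in> I"
  obtain c where c: "c \<in> A" "\<gamma> t \<in> fst c" using cover by blast
  obtain v w where "chart_derivs c \<gamma> I v w" by (rule C2_curve_onE[OF C c(1)])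
  note vw = chart_derivsD[OF this]
  let ?J = "{s\<in>I. \<gamma> s \<in> fst c}"
  have J: "?J \<subseteq> I" by auto
  note ct = C2_curve_on_continuous[OF C]
  have "continuous_on ?J v"
    using has_vector_derivative_within_subset[OF vw(2) J] by (intro continuous_on_vector_derivative) auto
  moreover have "continuous_on ?J (snd c \<circ> \<gamma>)"
    using has_vector_derivative_within_subset[OF vw(1) J] by (intro continuous_on_vector_derivative) blast
  ultimately have "continuous_on ?J (\<lambda>s. sqrt (gfield c ((snd c \<circ> \<gamma>) s) (v s) \<bullet> v s))"
    by (intro continuous_on_real_sqrt continuous_on_inner C1_field_continuous_on[OF C1_field_gfield[OF c(1)]]) auto
  moreover have "sqrt (gfield c ((snd c \<circ> \<gamma>) s) (v s) \<bullet> v s) = speed \<gamma> I s" if "s \<in> ?J" for s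
    using speed_coord[OF c(1) ct _ _ bot vw(1)] that by simp
  ultimately have "continuous_on ?J (speed \<gamma> I)" by (rule continuous_on_eq)
  then have "continuous (at t within ?J) (speed \<gamma> I)"
    using t c continuous_on_eq_continuous_within by blast
  \<comment> \<open>The parameters mapped into the chart domain form a relatively open subset of
    \<open>I\<close>, so continuity within them is continuity within \<open>I\<close>.\<close>
  moreover have "at t within ?J = at t within I"
  proof -
    obtain O' where O: "open O'" "O' \<inter> I = \<gamma> -` fst c \<inter> I"
      using ct dom_open[OF c(1)] unfolding continuous_on_open_invariant by blast
    show ?thesis by (rule at_within_nhd[of t O']) (use O t c in auto)
  qed
  ultimately show "continuous (at t within I) (speed \<gamma> I)" by simp
qed

text \<open>At \<open>m\<close> the subintervals see one-sided derivatives and \<open>{a..b}\<close>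
  a two-sided one, which may fail to exist; changing finitely many values leaves the integrals
  alone.\<close>

lemma curve_length_join_has_integral:
  assumes ab: "a < m" "m < b" and 1: "(speed \<gamma> {a..m} has_integral i) {a..m}"
    and 2: "(speed \<gamma> {m..b} has_integral j) {m..b}"
  shows "(speed \<gamma> {a..b} has_integral (i + j)) {a..b}"
proof (rule has_integral_combine)
  show "(speed \<gamma> {a..b} has_integral i) {a..m}"
    by (rule has_integral_spike_finite[OF _ _ 1, of "{a, m}"])
      (use velocity_interior[of a a m b] ab in auto)
  show "(speed \<gamma> {a..b} has_integral j) {m..b}"
    by (rule has_integral_spike_finite[OF _ _ 2, of "{m, b}"])
      (use velocity_interior[of a m b b] ab in auto)
qed (use ab in auto)

lemma piece_has_length:
  assumes "regular_piece \<gamma> a b"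
  shows "(speed \<gamma> {a..b} has_integral curve_length \<gamma> a b) {a..b}"
proof -
  have "continuous_on {a..b} (speed \<gamma> {a..b})"
    using assms at_within_Icc_neq_bot unfolding regular_piece_def by (intro continuous_on_speed) auto
  then show ?thesis
    unfolding curve_length_def using integrable_continuous_interval integrable_integral by blast
qed

text \<open>Integrability has to be recorded: \<open>integral\<close> is 0 on nonintegrable
  functions, and the additivity of \<open>curve_length\<close> rests on this lemma.\<close>

lemma piecewise_regular_has_length:
  assumes "piecewise_regular \<gamma> a b"
  shows "(speed \<gamma> {a..b} has_integral curve_length \<gamma> a b) {a..b}"
  using assms
proof (induction rule: piecewise_regular_induct)
  case (piece a b)
  then show ?case by (rule piece_has_length)
next
  case (join a m b)
  have ab: "a < m" "m < b" using join.hyps piecewise_regular_less piecewise_regular_piece by blast+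
  show ?case
    using curve_length_join_has_integral[OF ab join.IH] integral_unique unfolding curve_length_def by fastforce
qed

lemma curve_length_join:
  assumes "piecewise_regular \<gamma> a m" "piecewise_regular \<gamma> m b"
  shows "curve_length \<gamma> a b = curve_length \<gamma> a m + curve_length \<gamma> m b"
  using curve_length_join_has_integral[OF _ _ piecewise_regular_has_length piecewise_regular_has_length]
    assms piecewise_regular_less integral_unique unfolding curve_length_def by blast

lemma curve_length_cong:
  assumes "\<And>t. t \<in> {a..b} \<Longrightarrow> \<gamma> t = \<gamma>' t"
  shows "curve_length \<gamma> a b = curve_length \<gamma>' a b"
  unfolding curve_length_def
proof (rule integral_cong)
  fix t assume t: "t \<in> {a..b}"
  show "speed \<gamma> {a..b} t = speed \<gamma>' {a..b} t"
    using velocity_cong[OF assms t] assms[OF t] by simp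
qed

lemma speed_nonneg:
  assumes C: "C2_curve_on \<gamma> I" and t: "t \<in> I" "at t within I \<noteq> bot"
  shows "speed \<gamma> I t \<ge> 0"
proof -
  obtain c where c: "c \<in> A" "\<gamma> t \<in> fst c" using cover by blast
  obtain v w where "chart_derivs c \<gamma> I v w" by (rule C2_curve_onE[OF C c(1)])
  note vw = chart_derivsD[OF this]
  show ?thesis
    using speed_coord[OF c(1) C2_curve_on_continuous[OF C] t(1) c(2) t(2) vw(1)[OF t(1) c(2)]]
      gfield_nonneg[OF c(1)] c(2) by simp
qed

lemma curve_length_nonneg:
  assumes "piecewise_regular \<gamma> a b"
  shows "curve_length \<gamma> a b \<ge> 0"
  using assms
proof (induction rule: piecewise_regular_induct)
  case (piece a b)
  show ?case
    by (rule has_integral_nonneg[OF piece_has_length[OF piece]])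
      (use piece at_within_Icc_neq_bot in \<open>auto simp: regular_piece_def intro!: speed_nonneg\<close>)
next
  case (join a m b)
  then show ?case using curve_length_join[OF join.hyps(1) piecewise_regular_piece[OF join.hyps(2)]] by simp
qed

section \<open>Riemannian length against Euclidean length in a chart\<close>

lemma gfield_bounds:
  assumes c: "c \<in> A" and K: "compact K" "K \<subseteq> snd c ` fst c"
  obtains m M where "m > 0" "M > 0" "\<And>p v. p \<in> K \<Longrightarrow> m * norm v \<le> sqrt (gfield c p v \<bullet> v)"
    "\<And>p v. p \<in> K \<Longrightarrow> sqrt (gfield c p v \<bullet> v) \<le> M * norm v"
proof (cases "K = {}")
  case True
  then show ?thesis using that[of 1 1] by auto
next
  case False
  \<comment> \<open>By homogeneity only unit vectors matter; on the compact product of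
    \<open>K\<close> with the unit sphere the norm attains a positive minimum and a maximum.\<close>
  define f where "f x = sqrt (gfield c (fst x) (snd x) \<bullet> snd x)" for x :: "(real^'n) \<times> (real^'n)"
  let ?X = "K \<times> sphere (0::real^'n) 1"
  have cf: "continuous_on ?X f"
    unfolding f_def using K(2)
    by (intro continuous_intros C1_field_continuous_on[OF C1_field_gfield[OF c]]) auto
  have X: "compact ?X" "?X \<noteq> {}"
  proof -
    obtain b :: "real^'n" where "b \<in> Basis" using nonempty_Basis by blast
    then have "b \<in> sphere 0 1" by simp
    then show "?X \<noteq> {}" using False by blast
    show "compact ?X" using K by (intro compact_Times) auto
  qed
  obtain x where x: "x \<in> ?X" "\<forall>y\<in>?X. f x \<le> f y" using continuous_attains_inf[OF X cf] by blast
  obtain y where y: "y \<in> ?X" "\<forall>z\<in>?X. f z \<le> f y" using continuous_attains_sup[OF X cf] by blast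
  have "f x > 0"
  proof -
    have "fst x \<in> snd c ` fst c" "snd x \<noteq> 0" using x(1) K(2) by auto
    then have "0 < gfield c (fst x) (snd x) \<bullet> snd x"
      using metric_field_gfield[OF c] unfolding metric_field_def by blast
    then show ?thesis by (simp add: f_def)
  qed
  moreover have "f y > 0" using bspec[OF x(2) y(1)] \<open>f x > 0\<close> by simp
  moreover have "f x * norm v \<le> sqrt (gfield c p v \<bullet> v) \<and> sqrt (gfield c p v \<bullet> v) \<le> f y * norm v" if p: "p \<in> K" for p v
  proof (cases "v = 0")
    case False
    have "gfield c p v \<bullet> v = (norm v)\<^sup>2 * (gfield c p (v /\<^sub>R norm v) \<bullet> (v /\<^sub>R norm v))"
      using False by (simp add: matrix_vector_mult_scaleR power2_eq_square field_simps)
    then have "sqrt (gfield c p v \<bullet> v) = norm v * f (p, v /\<^sub>R norm v)"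
      unfolding f_def by (simp add: real_sqrt_mult)
    moreover have "(p, v /\<^sub>R norm v) \<in> ?X" using p False by simp
    then have "f x \<le> f (p, v /\<^sub>R norm v)" "f (p, v /\<^sub>R norm v) \<le> f y" using x(2) y(2) by blast+
    ultimately show ?thesis by (simp add: mult.commute mult_left_mono)
  qed simp
  ultimately show ?thesis using that[of "f x" "f y"] by blast
qed

text \<open>The speed dominates \<open>m\<close> times the coordinate speed. On one piece this is
  integrated; across joins the triangle inequality is used.\<close>

lemma chart_displacement_le_length:
  assumes c: "c \<in> A" and m: "m > 0" "\<And>x v. x \<in> K \<Longrightarrow> m * norm v \<le> sqrt (gfield c (snd c x) v \<bullet> v)"
    and K: "K \<subseteq> fst c" and \<gamma>: "piecewise_regular \<gamma> a b" "\<gamma> ` {a..b} \<subseteq> K"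
  shows "m * norm (snd c (\<gamma> b) - snd c (\<gamma> a)) \<le> curve_length \<gamma> a b"
  using \<gamma>
proof (induction rule: piecewise_regular_induct)
  case (piece a b)
  then have ab: "a < b" and C: "C2_curve_on \<gamma> {a..b}" by (auto simp: regular_piece_def)
  obtain v w where "chart_derivs c \<gamma> {a..b} v w" by (rule C2_curve_onE[OF C c(1)])
  note vw = chart_derivsD[OF this]
  have in_c: "\<gamma> t \<in> fst c" "\<gamma> t \<in> K" if "t \<in> {a..b}" for t using piece.prems K that by blast+
  have 1: "(v has_integral (snd c \<circ> \<gamma>) b - (snd c \<circ> \<gamma>) a) {a..b}"
    using ab vw(1)[OF _ in_c(1)] by (intro fundamental_theorem_of_calculus[of a b "snd c \<circ> \<gamma>" v]) (simp, blast)
  have 2: "((\<lambda>t. speed \<gamma> {a..b} t / m) has_integral curve_length \<gamma> a b / m) {a..b}"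
    using has_integral_divide[OF piece_has_length[OF piece.hyps]] .
  have 3: "norm (v t) \<le> speed \<gamma> {a..b} t / m" if t: "t \<in> {a..b}" for t
    using m(2)[OF in_c(2)[OF t], of "v t"] m(1)
      speed_coord[OF c C2_curve_on_continuous[OF C] t in_c(1)[OF t] at_within_Icc_neq_bot[OF ab t] vw(1)[OF t in_c(1)[OF t]]]
    by (simp add: field_simps)
  have "norm ((snd c \<circ> \<gamma>) b - (snd c \<circ> \<gamma>) a) \<le> curve_length \<gamma> a b / m"
    using integral_norm_bound_integral[OF has_integral_integrable[OF 1] has_integral_integrable[OF 2] 3]
    unfolding integral_unique[OF 1] integral_unique[OF 2] by simp
  then show ?case using m(1) by (simp add: field_simps)
next
  case (join a k b)
  have ab: "a < k" "k < b" using join.hyps piecewise_regular_less piecewise_regular_piece by blast+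
  have "m * norm (snd c (\<gamma> b) - snd c (\<gamma> a)) \<le> m * (norm (snd c (\<gamma> b) - snd c (\<gamma> k)) + norm (snd c (\<gamma> k) - snd c (\<gamma> a)))"
    using m(1) norm_triangle_ineq[of "snd c (\<gamma> b) - snd c (\<gamma> k)" "snd c (\<gamma> k) - snd c (\<gamma> a)"] by simp
  also have "\<dots> \<le> curve_length \<gamma> k b + curve_length \<gamma> a k"
    using join.IH(1)[OF order_trans[OF image_mono join.prems]] join.IH(2)[OF order_trans[OF image_mono join.prems]] ab
    by (simp add: ring_distribs)
  finally show ?case
    using curve_length_join[OF join.hyps(1) piecewise_regular_piece[OF join.hyps(2)]] by simp
qed

text \<open>Consider the first exit from the open coordinate ball. Up to that time the curve has
  covered coordinate distance \<open>r\<close> inside the closed ball, which costs length at least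
  \<open>m * r\<close>.\<close>

lemma short_curve_in_chart_ball:
  assumes c: "c \<in> A" "x \<in> fst c" and r: "r > 0" "cball (snd c x) r \<subseteq> snd c ` fst c"
    and m: "m > 0" "\<And>p v. p \<in> cball (snd c x) r \<Longrightarrow> m * norm v \<le> sqrt (gfield c p v \<bullet> v)"
    and \<gamma>: "piecewise_regular \<gamma> a b" "\<gamma> a = x" and len: "curve_length \<gamma> a b < m * r" and t: "t \<in> {a..b}"
  shows "\<gamma> t \<in> fst c \<and> snd c (\<gamma> t) \<in> ball (snd c x) r"
proof (rule ccontr)
  assume neg: "\<not> ?thesis"
  define W where "W = {y\<in>fst c. snd c y \<in> ball (snd c x) r}"
  define K where "K = chart_inv c ` cball (snd c x) r"
  have K: "K = {y\<in>fst c. snd c y \<in> cball (snd c x) r}"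
    unfolding K_def using r(2) chart_inv_left[OF c(1)] chart_inv_mem[OF c(1)] chart_inv_right[OF c(1)]
    by (force simp: image_iff)
  have "W = fst c \<inter> snd c -` ball (snd c x) r" by (auto simp: W_def)
  then have W: "open W"
    using continuous_open_preimage[OF continuous_on_chart[OF c(1)] dom_open[OF c(1)]] by simp
  have "compact K"
    unfolding K_def using continuous_on_subset[OF continuous_on_chart_inv[OF c(1)] r(2)]
    by (rule compact_continuous_image) simp
  \<comment> \<open>The manifold is Hausdorff, so the compact \<open>K\<close> is closed. This keeps
    the point at the exit time inside the chart domain, where its coordinates can be
    compared.\<close>
  then have clK: "closed K" by (rule compact_imp_closed)
  note ct = piecewise_regular_continuous[OF \<gamma>(1)]
  have ab: "a < b" using piecewise_regular_less[OF \<gamma>(1)] .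
  define B where "B = {a..b} \<inter> \<gamma> -` (- W)"
  have "compact B"
  proof -
    have "closed B" unfolding B_def using W by (intro continuous_closed_preimage[OF ct]) auto
    moreover have "bounded B" unfolding B_def by (rule bounded_subset[of "{a..b}"]) auto
    ultimately show ?thesis by (simp add: compact_eq_bounded_closed)
  qed
  moreover have "B \<noteq> {}" using neg t by (auto simp: B_def W_def)
  ultimately obtain T where T: "T \<in> B" "\<And>s. s \<in> B \<Longrightarrow> T \<le> s" using compact_attains_inf by metis
  have "a \<notin> B" using c r \<gamma>(2) by (auto simp: B_def W_def)
  then have aT: "a < T" "T \<le> b" using T by (auto simp: B_def less_le)
  have inW: "\<gamma> s \<in> W" if "s \<in> {a..<T}" for s
    using T(2)[of s] that aT by (force simp: B_def)
  have "\<gamma> ` closure {a..<T} \<subseteq> K"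
  proof (rule image_closure_subset[OF _ clK])
    show "continuous_on (closure {a..<T}) \<gamma>" using ct aT by (auto intro: continuous_on_subset)
    show "\<gamma> ` {a..<T} \<subseteq> K" using inW by (force simp: K W_def)
  qed
  then have img: "\<gamma> ` {a..T} \<subseteq> K" using aT by simp
  then have "\<gamma> T \<in> K" using aT by auto
  then have "norm (snd c (\<gamma> T) - snd c (\<gamma> a)) = r"
    using T(1) \<gamma>(2) by (auto simp: B_def W_def K dist_norm norm_minus_commute)
  moreover have pr: "piecewise_regular \<gamma> a T \<and> curve_length \<gamma> a T \<le> curve_length \<gamma> a b"
  proof (cases "T = b")
    case False
    then have "piecewise_regular \<gamma> a T" "piecewise_regular \<gamma> T b"
      using piecewise_regular_split[OF \<gamma>(1), of T] aT by auto
    then show ?thesis using curve_length_join curve_length_nonneg by fastforce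
  qed (use \<gamma> in auto)
  moreover have "m * norm (snd c (\<gamma> T) - snd c (\<gamma> a)) \<le> curve_length \<gamma> a T"
    by (rule chart_displacement_le_length[OF c(1) m(1) _ _ conjunct1[OF pr] img]) (use m(2) K in auto)
  ultimately show False using len by auto
qed

text \<open>The parameter shift \<open>a\<close> lets two segments be concatenated;
  \<open>p \<noteq> q\<close> makes the velocity nonzero.\<close>

lemma chart_segment:
  fixes a :: real
  assumes c: "c \<in> A" and pq: "p \<noteq> q" "closed_segment p q \<subseteq> snd c ` fst c"
    and M: "\<And>y v. y \<in> closed_segment p q \<Longrightarrow> sqrt (gfield c y v \<bullet> v) \<le> M * norm v"
  defines "\<gamma> \<equiv> \<lambda>t. chart_inv c (p + (t - a) *\<^sub>R (q - p))"
  shows "regular_piece \<gamma> a (a + 1) \<and> curve_length \<gamma> a (a + 1) \<le> M * norm (q - p)"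
proof -
  have seg: "p + (t - a) *\<^sub>R (q - p) \<in> closed_segment p q" if "t \<in> {a..a+1}" for t
    using that unfolding closed_segment_def by (auto intro!: exI[of _ "t - a"] simp: algebra_simps)
  then have im: "p + (t - a) *\<^sub>R (q - p) \<in> snd c ` fst c" if "t \<in> {a..a+1}" for t using pq(2) that by blast
  have snd: "(snd c \<circ> \<gamma>) t = p + (t - a) *\<^sub>R (q - p)" if "t \<in> {a..a+1}" for t
    using chart_inv_right[OF c im[OF that]] by (simp add: \<gamma>_def)
  have mem: "\<gamma> t \<in> fst c" if "t \<in> {a..a+1}" for t
    using chart_inv_mem[OF c im[OF that]] by (simp add: \<gamma>_def)
  have ct: "continuous_on {a..a+1} \<gamma>"
    unfolding \<gamma>_def using im by (intro continuous_on_compose2[OF continuous_on_chart_inv[OF c]] continuous_intros) auto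
  have d: "((snd c \<circ> \<gamma>) has_vector_derivative (q - p)) (at t within {a..a+1})" if t: "t \<in> {a..a+1}" for t
  proof (rule has_vector_derivative_transform[OF t snd])
    show "((\<lambda>t. p + (t - a) *\<^sub>R (q - p)) has_vector_derivative q - p) (at t within {a..a + 1})"
      by (auto intro!: derivative_eq_intros simp: has_vector_derivative_def)
  qed
  have piece: "regular_piece \<gamma> a (a + 1)"
    by (rule regular_piece_chartI[OF c _ ct _ d, where w = "\<lambda>_. 0"]) (use mem pq in auto)
  have "curve_length \<gamma> a (a + 1) \<le> integral {a..a+1} (\<lambda>_. M * norm (q - p))"
  proof (rule has_integral_le[OF piece_has_length[OF piece] integrable_integral])
    fix t assume t: "t \<in> {a..a+1}"
    show "speed \<gamma> {a..a + 1} t \<le> M * norm (q - p)"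
      using speed_coord[OF c ct t mem[OF t] at_within_Icc_neq_bot[OF _ t] d[OF t]] M[OF seg[OF t], of "q - p"] snd[OF t]
      by simp
  qed auto
  then show ?thesis using piece by simp
qed

text \<open>\<open>convex_nhd\<close> asks for a neighbourhood in the manifold topology, so the
  metric ball must contain an open set: a small coordinate ball, each of whose points is reached by
  a short broken segment.\<close>

lemma rball_neighbourhood:
  assumes "\<epsilon> > 0"
  shows "x \<in> interior (rball x \<epsilon>)"
proof -
  obtain c where c: "c \<in> A" "x \<in> fst c" using cover by blast
  let ?p = "snd c x"
  obtain r where r: "r > 0" "cball ?p r \<subseteq> snd c ` fst c"
    using image_open[OF c(1)] c(2) open_contains_cball by blast
  obtain m M where M: "M > 0" "\<And>p v. p \<in> cball ?p r \<Longrightarrow> sqrt (gfield c p v \<bullet> v) \<le> M * norm v"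
    using gfield_bounds[OF c(1) compact_cball r(2)] by metis
  \<comment> \<open>The broken segment has coordinate length below \<open>3 * \<rho>\<close>: less
    than \<open>\<rho>\<close> to the detour point and less than \<open>2 * \<rho>\<close> from
    there to \<open>y\<close>.\<close>
  define \<rho> where "\<rho> = min r (\<epsilon> / (4 * M))"
  have \<rho>: "\<rho> > 0" "\<rho> \<le> r" "3 * M * \<rho> < \<epsilon>"
  proof -
    show "\<rho> > 0" using r M assms by (simp add: \<rho>_def)
    show "\<rho> \<le> r" by (simp add: \<rho>_def)
    have "3 * M * \<rho> \<le> 3 * M * (\<epsilon> / (4 * M))" using M by (intro mult_left_mono) (auto simp: \<rho>_def)
    also have "\<dots> < \<epsilon>" using M assms by simp
    finally show "3 * M * \<rho> < \<epsilon>" .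
  qed
  define W where "W = fst c \<inter> snd c -` ball ?p \<rho>"
  have "open W"
    unfolding W_def by (rule continuous_open_preimage[OF continuous_on_chart[OF c(1)] dom_open[OF c(1)]]) simp
  moreover have "x \<in> W" using c \<rho> by (simp add: W_def)
  moreover have "W \<subseteq> rball x \<epsilon>"
  proof
    fix y assume y: "y \<in> W"
    let ?q = "snd c y"
    have yc: "y \<in> fst c" and q: "?q \<in> ball ?p \<rho>" using y by (auto simp: W_def)
    \<comment> \<open>The curve makes a detour via \<open>?p + e\<close>, since a curve with nonzero velocity cannot be constant if \<open>y = x\<close>.\<close>
    obtain e :: "real^'n" where e: "norm e < \<rho>" "e \<noteq> 0" "?p + e \<noteq> ?q"
    proof -
      obtain b :: "real^'n" where b: "b \<in> Basis" using nonempty_Basis by blast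
      \<comment> \<open>The two multiples of \<open>b\<close> differ, so at most one of them leads
        to \<open>?q\<close>.\<close>
      have "(\<rho> / 2) *\<^sub>R b \<noteq> (\<rho> / 3) *\<^sub>R b" using b \<rho> nonzero_Basis by auto
      then have "?p + (\<rho> / 2) *\<^sub>R b \<noteq> ?q \<or> ?p + (\<rho> / 3) *\<^sub>R b \<noteq> ?q"
        by (metis add_left_cancel)
      moreover have "norm ((\<rho> / 2) *\<^sub>R b) < \<rho>" "norm ((\<rho> / 3) *\<^sub>R b) < \<rho>"
        "(\<rho> / 2) *\<^sub>R b \<noteq> 0" "(\<rho> / 3) *\<^sub>R b \<noteq> 0" using b \<rho> nonzero_Basis by auto
      ultimately show ?thesis using that by blast
    qed
    have pe: "?p + e \<in> ball ?p \<rho>" using e by (simp add: dist_norm)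
    have sub: "ball ?p \<rho> \<subseteq> cball ?p r" using \<rho> by (auto simp: dist_norm)
    have seg: "closed_segment u u' \<subseteq> cball ?p r" if "u \<in> ball ?p \<rho>" "u' \<in> ball ?p \<rho>" for u u'
      using closed_segment_subset[OF that convex_ball] sub by blast
    have pp: "?p \<in> ball ?p \<rho>" using \<rho> by simp
    define \<gamma>1 where "\<gamma>1 t = chart_inv c (?p + (t - 0) *\<^sub>R ((?p + e) - ?p))" for t
    define \<gamma>2 where "\<gamma>2 t = chart_inv c ((?p + e) + (t - 1) *\<^sub>R (?q - (?p + e)))" for t
    have 1: "regular_piece \<gamma>1 0 (0 + 1) \<and> curve_length \<gamma>1 0 (0 + 1) \<le> M * norm ((?p + e) - ?p)"
      unfolding \<gamma>1_def using e seg[OF pp pe] r(2) M(2) by (intro chart_segment[OF c(1)]) auto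
    have 2: "regular_piece \<gamma>2 1 (1 + 1) \<and> curve_length \<gamma>2 1 (1 + 1) \<le> M * norm (?q - (?p + e))"
      unfolding \<gamma>2_def using e(3) seg[OF pe q] r(2) M(2) by (intro chart_segment[OF c(1)]) auto
    define \<gamma> where "\<gamma> t = (if t \<le> 1 then \<gamma>1 t else \<gamma>2 t)" for t :: real
    have "\<gamma>1 1 = \<gamma>2 1" by (simp add: \<gamma>1_def \<gamma>2_def)
    then have \<gamma>12: "\<And>t. t \<in> {0..1} \<Longrightarrow> \<gamma>1 t = \<gamma> t" "\<And>t. t \<in> {1..2} \<Longrightarrow> \<gamma>2 t = \<gamma> t"
      by (auto simp: \<gamma>_def)
    have pr: "piecewise_regular \<gamma> 0 1" "piecewise_regular \<gamma> 1 2"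
      using regular_piece_cong[of \<gamma>1 0 1 \<gamma>] regular_piece_cong[of \<gamma>2 1 2 \<gamma>] 1 2 \<gamma>12
      by (auto intro!: piecewise_regular_piece)
    have "curve_length \<gamma> 0 2 = curve_length \<gamma>1 0 1 + curve_length \<gamma>2 1 2"
      using curve_length_join[OF pr] curve_length_cong[of 0 1 \<gamma>1 \<gamma>] curve_length_cong[of 1 2 \<gamma>2 \<gamma>] \<gamma>12 by simp
    also have "\<dots> \<le> M * norm e + M * norm (?q - (?p + e))" using 1 2 by simp
    also have "\<dots> \<le> M * \<rho> + M * (\<rho> + \<rho>)"
    proof (intro add_mono mult_left_mono)
      have "norm (?q - (?p + e)) \<le> norm (?q - ?p) + norm e"
        using norm_triangle_ineq4[of "?q - ?p" e] by (simp add: algebra_simps)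
      also have "norm (?q - ?p) < \<rho>" using q by (simp add: dist_norm norm_minus_commute)
      finally show "norm (?q - (?p + e)) \<le> \<rho> + \<rho>" using e by simp
    qed (use e M in auto)
    also have "\<dots> < \<epsilon>" using \<rho>(3) by (simp add: algebra_simps)
    finally have len: "curve_length \<gamma> 0 2 < \<epsilon>" .
    have "\<gamma> 0 = x" "\<gamma> 2 = y"
      using chart_inv_left[OF c] chart_inv_left[OF c(1) yc] by (auto simp: \<gamma>_def \<gamma>1_def \<gamma>2_def)
    then have "rdist x y \<le> ereal (curve_length \<gamma> 0 2)"
      unfolding rdist_def using piecewise_regular_join[OF pr] by (intro Inf_lower) blast
    then show "y \<in> rball x \<epsilon>" using len by (simp add: rball_def order_le_less_trans)
  qed
  ultimately show ?thesis unfolding interior_def by blast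
qed

end

section \<open>Geodesics and proximal normals\<close>

text \<open>Bilinearity reduces the bound to unit vectors, where compactness applies.\<close>

lemma dfield_bound:
  assumes F: "C1_field U F" and K: "compact K" "K \<subseteq> U"
  obtains B where "B > 0" "\<And>p z v. p \<in> K \<Longrightarrow> norm (dfield F p z v) \<le> B * norm z * norm v"
proof -
  let ?X = "K \<times> sphere 0 1 \<times> sphere 0 1"
  have "compact ((\<lambda>x. dfield F (fst x) (fst (snd x)) (snd (snd x))) ` ?X)"
    using K by (intro compact_continuous_image compact_Times dfield_continuous_on[OF F] continuous_intros) auto
  then have "bounded ((\<lambda>x. dfield F (fst x) (fst (snd x)) (snd (snd x))) ` ?X)" by (rule compact_imp_bounded)
  then obtain B where B: "B > 0" "\<And>x. x \<in> ?X \<Longrightarrow> norm (dfield F (fst x) (fst (snd x)) (snd (snd x))) \<le> B"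
    unfolding bounded_pos by blast
  have "norm (dfield F p z v) \<le> B * norm z * norm v" if p: "p \<in> K" for p z v
  proof -
    note lin = linear_dfield_direction[OF F subsetD[OF K(2) p]] linear_dfield_arg[OF F subsetD[OF K(2) p]]
    show ?thesis
    proof (cases "z = 0 \<or> v = 0")
      case True
      then have "dfield F p z v = 0" using linear_0[OF lin(1)] linear_0[OF lin(2)] by auto
      then show ?thesis using B by simp
    next
      case False
      have "dfield F p (norm z *\<^sub>R (z /\<^sub>R norm z)) (norm v *\<^sub>R (v /\<^sub>R norm v))
          = norm z *\<^sub>R norm v *\<^sub>R dfield F p (z /\<^sub>R norm z) (v /\<^sub>R norm v)"
        using linear_cmul[OF lin(1), of "norm z"] linear_cmul[OF lin(2), of _ "norm v"] by metis
      then have "norm (dfield F p z v) = norm z * norm v * norm (dfield F p (z /\<^sub>R norm z) (v /\<^sub>R norm v))"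
        using False by simp
      also have "\<dots> \<le> norm z * norm v * B"
        using B(2)[of "(p, z /\<^sub>R norm z, v /\<^sub>R norm v)"] p False by (intro mult_left_mono) auto
      finally show ?thesis by (simp add: mult_ac)
    qed
  qed
  then show ?thesis using that B(1) by blast
qed

section \<open>Geodesics in charts\<close>

context riemannian_manifold
begin

text \<open>The derivative of the squared speed is twice \<open>EL\<close> paired with the velocity
  itself, which the geodesic equation makes zero. Over an interval of length 1 the constant speed
  equals the length.\<close>

lemma geodesic_constant_speed:
  assumes "minimizing_geodesic \<sigma> x y"
  shows "0 \<le> curve_length \<sigma> 0 1" "\<And>t. t \<in> {0..1} \<Longrightarrow> speed \<sigma> {0..1} t = curve_length \<sigma> 0 1"
proof -
  let ?I = "{0..1::real}"
  have C: "C2_curve_on \<sigma> ?I" and acc: "\<And>t. t \<in> ?I \<Longrightarrow> covariant_derivative \<sigma> ?I (velocity \<sigma> ?I) t = (\<lambda>_. 0)"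
    using assms by (auto simp: minimizing_geodesic_def)
  note ct = C2_curve_on_continuous[OF C]
  have bot: "at t within ?I \<noteq> bot" if "t \<in> ?I" for t using at_within_Icc_neq_bot[OF zero_less_one that] .
  have "((\<lambda>t. (speed \<sigma> ?I t)\<^sup>2) has_derivative (\<lambda>h. 0)) (at t within ?I)" if t: "t \<in> ?I" for t
  proof -
    obtain c where c: "c \<in> A" "\<sigma> t \<in> fst c" using cover by blast
    obtain v w where "chart_derivs c \<sigma> ?I v w" by (rule C2_curve_onE[OF C c(1)])
    note vw = chart_derivsD[OF this]
    define p where "p = snd c (\<sigma> t)"
    have p: "p \<in> snd c ` fst c" using c by (simp add: p_def)
    have "coord_accel c p (v t) (w t) = 0"
      using covariant_derivative_coord[OF c(1) ct t c(2) bot vw(1) vw(2)[OF t c(2)]] acc[OF t] by (simp add: p_def)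
    then have 0: "EL (gfield c) p (v t) (w t) (v t) = 0"
      using gfield_coord_accel[OF c(1) p, of "v t" "w t" "v t"] by simp
    have "((\<lambda>s. gfield c ((snd c \<circ> \<sigma>) s) (v s)) has_vector_derivative
        (dfield (gfield c) p (v t) (v t) + gfield c p (w t))) (at t within ?I)"
      using C1_field_chain_vector[OF C1_field_gfield[OF c(1)] vw(1)[OF t c(2)] _ t vw(2)[OF t c(2)]] c(2)
      by (simp add: p_def)
    from bounded_bilinear.has_vector_derivative[OF bounded_bilinear_inner this vw(2)[OF t c(2)]]
    have "((\<lambda>s. gfield c ((snd c \<circ> \<sigma>) s) (v s) \<bullet> v s) has_vector_derivative
        2 * EL (gfield c) p (v t) (w t) (v t)) (at t within ?I)"
    proof (rule has_vector_derivative_eq_rhs)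
      have "gfield c p (v t) \<bullet> w t = gfield c p (w t) \<bullet> v t"
        using metric_field_gfield[OF c(1)] p unfolding metric_field_def by blast
      then show "gfield c ((snd c \<circ> \<sigma>) t) (v t) \<bullet> w t + (dfield (gfield c) p (v t) (v t) + gfield c p (w t)) \<bullet> v t
          = 2 * EL (gfield c) p (v t) (w t) (v t)"
        by (simp add: EL_def p_def inner_add_left)
    qed
    then have "((\<lambda>s. gfield c ((snd c \<circ> \<sigma>) s) (v s) \<bullet> v s) has_vector_derivative 0) (at t within ?I)"
      using 0 by simp
    moreover have sp: "gfield c ((snd c \<circ> \<sigma>) s) (v s) \<bullet> v s = (speed \<sigma> ?I s)\<^sup>2" if "s \<in> ?I" "\<sigma> s \<in> fst c" for s
      using speed_coord[OF c(1) ct that bot[OF that(1)] vw(1)[OF that]] gfield_nonneg[OF c(1)] that by simp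
    have "\<forall>\<^sub>F s in at t within ?I. s \<in> ?I" by (simp add: eventually_at_filter)
    then have "\<forall>\<^sub>F s in at t within ?I. gfield c ((snd c \<circ> \<sigma>) s) (v s) \<bullet> v s = (speed \<sigma> ?I s)\<^sup>2"
      using eventually_in_chart[OF c(1) ct t c(2)] by eventually_elim (rule sp)
    ultimately have "((\<lambda>s. (speed \<sigma> ?I s)\<^sup>2) has_vector_derivative 0) (at t within ?I)"
      by (rule has_vector_derivative_transform_eventually) (use sp[OF t c(2)] t in auto)
    then show ?thesis by (simp add: has_vector_derivative_def)
  qed
  then obtain k where k: "\<And>t. t \<in> ?I \<Longrightarrow> (speed \<sigma> ?I t)\<^sup>2 = k"
    using has_derivative_zero_constant[of ?I "\<lambda>t. (speed \<sigma> ?I t)\<^sup>2"] by auto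
  have sp: "speed \<sigma> ?I t = sqrt k" if t: "t \<in> ?I" for t
    using k[OF t] speed_nonneg[OF C t bot[OF t]] by (metis real_sqrt_unique)
  then have "curve_length \<sigma> 0 1 = integral ?I (\<lambda>_. sqrt k)"
    unfolding curve_length_def by (intro integral_cong) auto
  then have "curve_length \<sigma> 0 1 = sqrt k" by simp
  moreover have "0 \<le> k" using k[of 0] by (metis atLeastAtMost_iff order_refl zero_le_one zero_le_power2)
  ultimately show "0 \<le> curve_length \<sigma> 0 1" "\<And>t. t \<in> {0..1} \<Longrightarrow> speed \<sigma> {0..1} t = curve_length \<sigma> 0 1"
    using sp by auto
qed

text \<open>The constants are uniform over all minimizing geodesics from \<open>x\<close>. The first
  bound concerns the initial velocity alone and so holds for every length. For the second the
  geodesic must stay in a coordinate ball; there the geodesic equation bounds its coordinate second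
  derivative by a multiple of \<open>l^2\<close>, and integrating twice gives the last
  estimate.\<close>

lemma geodesic_chart_estimate:
  assumes c: "c \<in> A" and x: "x \<in> fst c"
  obtains C d where "C > 0" "d > 0"
    "\<And>\<sigma> y l. minimizing_geodesic \<sigma> x y \<Longrightarrow> curve_length \<sigma> 0 1 = l \<Longrightarrow> norm (velocity \<sigma> {0..1} 0 c) \<le> C * l"
    "\<And>\<sigma> y l. minimizing_geodesic \<sigma> x y \<Longrightarrow> curve_length \<sigma> 0 1 = l \<Longrightarrow> 0 < l \<Longrightarrow> l < d \<Longrightarrow>
      y \<in> fst c \<and> norm (snd c y - snd c x) \<le> C * l \<and>
      norm (snd c y - snd c x - velocity \<sigma> {0..1} 0 c) \<le> C * l\<^sup>2"
proof -
  let ?I = "{0..1::real}"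
  have bot: "at t within ?I \<noteq> bot" if "t \<in> ?I" for t using at_within_Icc_neq_bot[OF zero_less_one that] .
  obtain r where r: "r > 0" "cball (snd c x) r \<subseteq> snd c ` fst c"
    using image_open[OF c] x open_contains_cball by blast
  let ?K = "cball (snd c x) r"
  obtain m where m: "m > 0" "\<And>p v. p \<in> ?K \<Longrightarrow> m * norm v \<le> sqrt (gfield c p v \<bullet> v)"
    using gfield_bounds[OF c compact_cball r(2)] by metis
  obtain B where B: "B > 0" "\<And>p z v. p \<in> ?K \<Longrightarrow> norm (dfield (gfield c) p z v) \<le> B * norm z * norm v"
    using dfield_bound[OF C1_field_gfield[OF c] compact_cball r(2)] by metis
  \<comment> \<open>Read off from \<open>m^2 |w| \<le> 2 B |v|^2\<close> and
    \<open>|v| \<le> l / m\<close> below, so that \<open>E * l^2\<close> bounds the second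
    derivative \<open>w\<close>.\<close>
  define E where "E = 2 * B / m\<^sup>2 * (1 / m)\<^sup>2"
  define C where "C = max (1 / m) E"
  have C: "C > 0" "1 / m \<le> C" "E \<le> C" using m(1) by (auto simp: C_def less_max_iff_disj)
  have basic: "norm (v t) \<le> l / m" if geo: "minimizing_geodesic \<sigma> x y" and len: "curve_length \<sigma> 0 1 = l"
    and cd: "chart_derivs c \<sigma> ?I v w"
    and t: "t \<in> ?I" "\<sigma> t \<in> fst c" "snd c (\<sigma> t) \<in> ?K" for \<sigma> y l v w t
  proof -
    have Cv: "C2_curve_on \<sigma> ?I" using geo by (simp add: minimizing_geodesic_def)
    have "l = sqrt (gfield c (snd c (\<sigma> t)) (v t) \<bullet> v t)"
      using speed_coord[OF c C2_curve_on_continuous[OF Cv] t(1,2) bot[OF t(1)] chart_derivsD(1)[OF cd t(1,2)]]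
        geodesic_constant_speed(2)[OF geo t(1)] len by simp
    then show ?thesis using m(2)[OF t(3), of "v t"] m(1) by (simp add: field_simps)
  qed
  have vel0: "velocity \<sigma> ?I t c = v t" if "chart_derivs c \<sigma> ?I v w" "t \<in> ?I" "\<sigma> t \<in> fst c" for \<sigma> v w t
    using vector_derivative_within[OF bot[OF that(2)] chart_derivsD(1)[OF that]] that(3) c by (simp add: velocity_def)
  show ?thesis
  proof (rule that[of C "m * r"])
    show "C > 0" "m * r > 0" using C m r by auto
    fix \<sigma> y l assume geo: "minimizing_geodesic \<sigma> x y" and len: "curve_length \<sigma> 0 1 = l"
    then have Cv: "C2_curve_on \<sigma> ?I" and ends: "\<sigma> 0 = x" "\<sigma> 1 = y"
      and acc: "\<And>t. t \<in> ?I \<Longrightarrow> covariant_derivative \<sigma> ?I (velocity \<sigma> ?I) t = (\<lambda>_. 0)"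
      by (auto simp: minimizing_geodesic_def)
    obtain v w where cd: "chart_derivs c \<sigma> ?I v w" by (rule C2_curve_onE[OF Cv c])
    note vw = chart_derivsD[OF cd]
    have l0: "l \<ge> 0" using geodesic_constant_speed(1)[OF geo] len by simp
    have v0: "velocity \<sigma> ?I 0 c = v 0" using vel0[OF cd, of 0] ends x by simp
    have "norm (v 0) \<le> l / m" using basic[OF geo len cd, of 0] ends x r by simp
    also have "\<dots> \<le> C * l" using C(2) l0 mult_right_mono[of "1 / m" C l] by simp
    finally show "norm (velocity \<sigma> ?I 0 c) \<le> C * l" using v0 by simp
    assume l: "0 < l" "l < m * r"
    have sp: "\<And>t. t \<in> ?I \<Longrightarrow> speed \<sigma> ?I t = l" using geodesic_constant_speed(2)[OF geo] len by simp
    \<comment> \<open>Positive constant speed makes the geodesic a regular curve, as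
      \<open>short_curve_in_chart_ball\<close> requires; constant geodesics are excluded by
      \<open>0 < l\<close>.\<close>
    have "regular_piece \<sigma> 0 1"
      unfolding regular_piece_def
    proof (intro conjI ballI Cv zero_less_one notI)
      fix t assume t: "t \<in> ?I" and z: "velocity \<sigma> ?I t = (\<lambda>_. 0)"
      obtain c' where c': "c' \<in> A" "\<sigma> t \<in> fst c'" using cover by blast
      obtain v' w' where cd': "chart_derivs c' \<sigma> ?I v' w'" by (rule C2_curve_onE[OF Cv c'(1)])
      have "velocity \<sigma> ?I t c' = v' t"
        using vector_derivative_within[OF bot[OF t] chart_derivsD(1)[OF cd' t c'(2)]] c' by (simp add: velocity_def)
      then have "v' t = 0" using z by simp
      then have "speed \<sigma> ?I t = 0"
        using speed_coord[OF c'(1) C2_curve_on_continuous[OF Cv] t c'(2) bot[OF t] chart_derivsD(1)[OF cd' t c'(2)]] by simp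
      then show False using sp[OF t] l by simp
    qed
    then have pr: "piecewise_regular \<sigma> 0 1" by (rule piecewise_regular_piece)
    have inb: "\<sigma> t \<in> fst c \<and> snd c (\<sigma> t) \<in> ball (snd c x) r" if "t \<in> ?I" for t
      using short_curve_in_chart_ball[OF c x r m pr ends(1) _ that] len l by simp
    then have inK: "\<sigma> t \<in> fst c" "snd c (\<sigma> t) \<in> ?K" if "t \<in> ?I" for t using that by (auto simp: less_imp_le)
    have "m * norm (snd c (\<sigma> 1) - snd c (\<sigma> 0)) \<le> curve_length \<sigma> 0 1"
      by (rule chart_displacement_le_length[OF c m(1), of "\<sigma> ` ?I"]) (use m(2) inK pr in auto)
    then have "norm (snd c y - snd c x) \<le> l / m" using m(1) len ends by (simp add: field_simps)
    also have "\<dots> \<le> C * l" using C(2) l0 mult_right_mono[of "1 / m" C l] by simp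
    finally have 1: "norm (snd c y - snd c x) \<le> C * l" .
    have wb: "norm (w t) \<le> E * l\<^sup>2" if t: "t \<in> ?I" for t
    proof (cases "w t = 0")
      case True
      then show ?thesis using B m by (simp add: E_def)
    next
      case False
      let ?p = "snd c (\<sigma> t)"
      have p: "?p \<in> snd c ` fst c" using inK[OF t] by auto
      have "coord_accel c ?p (v t) (w t) = 0"
        using covariant_derivative_coord[OF c C2_curve_on_continuous[OF Cv] t inK(1)[OF t] bot vw(1) vw(2)[OF t inK(1)[OF t]]]
          acc[OF t] by simp
      \<comment> \<open>Pairing the geodesic equation with \<open>w t\<close> itself bounds
        \<open>w t\<close> by first derivatives of the metric, without estimating Christoffel
        symbols.\<close>
      then have "EL (gfield c) ?p (v t) (w t) (w t) = 0"
        using gfield_coord_accel[OF c p, of "v t" "w t" "w t"] by simp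
      then have "gfield c ?p (w t) \<bullet> w t = - (dfield (gfield c) ?p (v t) (v t) \<bullet> w t) + dfield (gfield c) ?p (w t) (v t) \<bullet> v t / 2"
        by (simp add: EL_def)
      also have "\<dots> \<le> norm (dfield (gfield c) ?p (v t) (v t)) * norm (w t) + norm (dfield (gfield c) ?p (w t) (v t)) * norm (v t)"
        using norm_cauchy_schwarz[of "- dfield (gfield c) ?p (v t) (v t)" "w t"]
          norm_cauchy_schwarz[of "dfield (gfield c) ?p (w t) (v t)" "v t"]
          mult_nonneg_nonneg[OF norm_ge_zero norm_ge_zero, of "dfield (gfield c) ?p (w t) (v t)" "v t"]
        by (simp only: inner_minus_left norm_minus_cancel)
      also have "\<dots> \<le> (B * norm (v t) * norm (v t)) * norm (w t) + (B * norm (w t) * norm (v t)) * norm (v t)"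
        using B(2)[OF inK(2)[OF t]] by (intro add_mono mult_right_mono) auto
      also have "\<dots> = 2 * B * (norm (v t))\<^sup>2 * norm (w t)" by (simp add: power2_eq_square)
      finally have "gfield c ?p (w t) \<bullet> w t \<le> 2 * B * (norm (v t))\<^sup>2 * norm (w t)" .
      moreover have "(m * norm (w t))\<^sup>2 \<le> gfield c ?p (w t) \<bullet> w t"
      proof -
        have "(m * norm (w t))\<^sup>2 \<le> (sqrt (gfield c ?p (w t) \<bullet> w t))\<^sup>2"
          using m(1) by (intro power_mono m(2)[OF inK(2)[OF t]]) simp
        then show ?thesis using gfield_nonneg[OF c p] by simp
      qed
      ultimately have "(m\<^sup>2 * norm (w t)) * norm (w t) \<le> (2 * B * (norm (v t))\<^sup>2) * norm (w t)"
        by (simp add: power_mult_distrib power2_eq_square mult_ac)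
      then have "m\<^sup>2 * norm (w t) \<le> 2 * B * (norm (v t))\<^sup>2"
        by (rule mult_right_le_imp_le) (use False in simp)
      also have "\<dots> \<le> 2 * B * (l / m)\<^sup>2"
        using basic[OF geo len cd t inK[OF t]] B(1) by (intro mult_left_mono power_mono) auto
      finally show ?thesis using m(1) by (simp add: E_def field_simps)
    qed
    have vb: "norm (v t - v 0) \<le> E * l\<^sup>2" if t: "t \<in> ?I" for t
    proof -
      have "norm (v t - v 0) \<le> E * l\<^sup>2 * norm (t - 0)"
        using t vw(2) inK(1) wb by (intro vector_differentiable_bound[of ?I v w]) auto
      also have "\<dots> \<le> E * l\<^sup>2 * 1" using t B m by (intro mult_left_mono) (auto simp: E_def)
      finally show ?thesis by simp
    qed
    have "norm (((snd c \<circ> \<sigma>) 1 - 1 *\<^sub>R v 0) - ((snd c \<circ> \<sigma>) 0 - 0 *\<^sub>R v 0)) \<le> E * l\<^sup>2 * norm (1 - 0 :: real)"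
    proof (rule vector_differentiable_bound[of ?I "\<lambda>t. (snd c \<circ> \<sigma>) t - t *\<^sub>R v 0" "\<lambda>t. v t - v 0"])
      fix t assume t: "t \<in> ?I"
      have "((\<lambda>t. t *\<^sub>R v 0) has_vector_derivative v 0) (at t within ?I)"
        by (auto intro!: derivative_eq_intros simp: has_vector_derivative_def)
      with vw(1)[OF t inK(1)[OF t]]
      show "((\<lambda>t. (snd c \<circ> \<sigma>) t - t *\<^sub>R v 0) has_vector_derivative v t - v 0) (at t within ?I)"
        by (rule has_vector_derivative_diff)
    qed (use vb in auto)
    then have "norm (snd c y - snd c x - v 0) \<le> E * l\<^sup>2" using ends by (simp add: algebra_simps)
    also have "\<dots> \<le> C * l\<^sup>2" using C(3) by (intro mult_right_mono) auto
    finally show "y \<in> fst c \<and> norm (snd c y - snd c x) \<le> C * l \<and>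
      norm (snd c y - snd c x - velocity \<sigma> ?I 0 c) \<le> C * l\<^sup>2"
      using 1 v0 inK(1)[of 1] ends by simp
  qed
qed

section \<open>From chart inequalities to proximal normals\<close>

lemma exp_inv_geodesic:
  assumes U: "strongly_convex U" "x \<in> U" "y \<in> U"
  obtains \<sigma> where "minimizing_geodesic \<sigma> x y" "exp_inv x y = velocity \<sigma> {0..1} 0"
proof -
  obtain \<sigma> where \<sigma>: "minimizing_geodesic \<sigma> x y" "\<And>\<sigma>'. minimizing_geodesic \<sigma>' x y \<Longrightarrow> (\<forall>t\<in>{0..1}. \<sigma>' t = \<sigma> t)"
    using U unfolding strongly_convex_def by metis
  \<comment> \<open>Uniqueness of the geodesic on \<open>[0,1]\<close> fixes its velocity at 0
    within \<open>{0..1}\<close>, so the definite description has exactly one candidate.\<close>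
  have "exp_inv x y = velocity \<sigma> {0..1} 0"
    unfolding exp_inv_def
  proof (rule the_equality)
    show "\<exists>\<gamma>. minimizing_geodesic \<gamma> x y \<and> velocity \<sigma> {0..1} 0 = velocity \<gamma> {0..1} 0" using \<sigma>(1) by blast
    fix \<xi> assume "\<exists>\<gamma>. minimizing_geodesic \<gamma> x y \<and> \<xi> = velocity \<gamma> {0..1} 0"
    then obtain \<sigma>' where s': "minimizing_geodesic \<sigma>' x y" "\<xi> = velocity \<sigma>' {0..1} 0" by blast
    then show "\<xi> = velocity \<sigma> {0..1} 0"
      using velocity_cong[of "{0..1}" \<sigma>' \<sigma> 0] \<sigma>(2)[OF s'(1)] by auto
  qed
  then show ?thesis using that \<sigma>(1) by blast
qed

text \<open>In a chart the initial velocity of the geodesic to \<open>y\<close> is the coordinate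
  difference up to an error quadratic in the distance, so near \<open>x\<close> an inequality for
  coordinate differences suffices. At distance at least \<open>d'\<close> the linear bound on the
  velocity becomes a quadratic one after division by \<open>d'\<close>.\<close>

lemma proximal_normalI:
  assumes c: "c \<in> A" "x \<in> fst c" and U: "convex_nhd x U" and \<xi>: "\<xi> \<in> tangent_space x"
    and r: "r > 0" and prox: "\<And>y. y \<in> S \<Longrightarrow> y \<in> fst c \<Longrightarrow> norm (snd c y - snd c x) < r \<Longrightarrow>
      gfield c (snd c x) (\<xi> c) \<bullet> (snd c y - snd c x) \<le> K * (norm (snd c y - snd c x))\<^sup>2"
  shows "\<xi> \<in> proximal_normal_cone S x"
proof -
  obtain C d where C: "C > 0" "d > 0"
    "\<And>\<sigma> y l. minimizing_geodesic \<sigma> x y \<Longrightarrow> curve_length \<sigma> 0 1 = l \<Longrightarrow> norm (velocity \<sigma> {0..1} 0 c) \<le> C * l"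
    "\<And>\<sigma> y l. minimizing_geodesic \<sigma> x y \<Longrightarrow> curve_length \<sigma> 0 1 = l \<Longrightarrow> 0 < l \<Longrightarrow> l < d \<Longrightarrow>
      y \<in> fst c \<and> norm (snd c y - snd c x) \<le> C * l \<and>
      norm (snd c y - snd c x - velocity \<sigma> {0..1} 0 c) \<le> C * l\<^sup>2"
    using geodesic_chart_estimate[OF c] by metis
  define a where "a = gfield c (snd c x) (\<xi> c)"
  \<comment> \<open>For \<open>0 < l < d'\<close> the geodesic estimate applies and places
    \<open>y\<close> within coordinate distance \<open>C * l < r\<close> of
    \<open>x\<close>.\<close>
  define d' where "d' = min d (r / C)"
  have d': "d' > 0" using C r by (simp add: d'_def)
  \<comment> \<open>\<open>K1\<close> serves the far points and \<open>K2\<close> the near ones; the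
    1 added in \<open>s\<close> makes the proximal constant positive.\<close>
  define K1 where "K1 = norm a * C / d'"
  define K2 where "K2 = \<bar>K\<bar> * C\<^sup>2 + norm a * C"
  define s where "s = K1 + K2 + 1"
  have K12: "K1 \<ge> 0" "K2 \<ge> 0" using C d' by (auto simp: K1_def K2_def)
  have "ereal (g x \<xi> (exp_inv x y)) \<le> ereal s * (rdist x y)\<^sup>2" if y: "y \<in> U \<inter> S" for y
  proof -
    have xU: "strongly_convex U" "x \<in> U" using U interior_subset by (auto simp: convex_nhd_def)
    obtain \<sigma> where \<sigma>: "minimizing_geodesic \<sigma> x y" "exp_inv x y = velocity \<sigma> {0..1} 0"
      using exp_inv_geodesic[OF xU] y by blast
    define l where "l = curve_length \<sigma> 0 1"
    have l: "l \<ge> 0" "rdist x y = ereal l" "curve_length \<sigma> 0 1 = l"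
      using geodesic_constant_speed(1)[OF \<sigma>(1)] \<sigma>(1) by (simp_all add: l_def minimizing_geodesic_def)
    have Cv: "C2_curve_on \<sigma> {0..1}" "\<sigma> 0 = x" using \<sigma>(1) by (auto simp: minimizing_geodesic_def)
    obtain v w where "chart_derivs c \<sigma> {0..1} v w" by (rule C2_curve_onE[OF Cv(1) c(1)])
    note vw = chart_derivsD[OF this]
    have "velocity \<sigma> {0..1} 0 = coord_vec c x (v 0)"
      using velocity_eq_coord_vec[OF c(1) C2_curve_on_continuous[OF Cv(1)], of 0 "v 0"] vw(1)[of 0] Cv(2) c(2)
        at_within_Icc_neq_bot[of 0 1 0] by simp
    then have "exp_inv x y = coord_vec c x (exp_inv x y c)"
      using \<sigma>(2) coord_vec_self[OF c] by simp
    then have ge: "g x \<xi> (exp_inv x y) = a \<bullet> exp_inv x y c"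
      using metric_coord[OF c] tangent_space_coord_vec[OF \<xi> c] unfolding a_def by metis
    have ev: "norm (exp_inv x y c) \<le> C * l" using C(3)[OF \<sigma>(1) l(3)] \<sigma>(2) by simp
    have "a \<bullet> exp_inv x y c \<le> s * l\<^sup>2"
    proof (cases "l = 0")
      case True
      then show ?thesis using ev by simp
    next
      case False
      then have lpos: "l > 0" using l(1) by simp
      show ?thesis
      proof (cases "l < d'")
        case True
        let ?z = "snd c y - snd c x"
        have *: "y \<in> fst c" "norm ?z \<le> C * l" "norm (?z - exp_inv x y c) \<le> C * l\<^sup>2"
          using C(4)[OF \<sigma>(1) l(3) lpos] True \<sigma>(2) by (auto simp: d'_def)
        have "C * l < r" using True C(1) by (simp add: d'_def field_simps)
        then have "a \<bullet> ?z \<le> K * (norm ?z)\<^sup>2" using prox[of y] * y unfolding a_def by auto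
        also have "\<dots> \<le> \<bar>K\<bar> * (C * l)\<^sup>2" using *(2) by (intro mult_mono power_mono) auto
        finally have 1: "a \<bullet> ?z \<le> \<bar>K\<bar> * (C * l)\<^sup>2" .
        have "a \<bullet> (exp_inv x y c - ?z) \<le> norm a * norm (exp_inv x y c - ?z)" by (rule norm_cauchy_schwarz)
        also have "\<dots> \<le> norm a * (C * l\<^sup>2)" using *(3) by (intro mult_left_mono) (auto simp: norm_minus_commute)
        finally have "a \<bullet> exp_inv x y c \<le> K2 * l\<^sup>2"
          using 1 by (simp add: K2_def inner_diff_right power_mult_distrib algebra_simps)
        also have "\<dots> \<le> s * l\<^sup>2" using K12 by (intro mult_right_mono) (auto simp: s_def)
        finally show ?thesis .
      next
        case far: False
        have "a \<bullet> exp_inv x y c \<le> norm a * norm (exp_inv x y c)" by (rule norm_cauchy_schwarz)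
        also have "\<dots> \<le> norm a * (C * l)" using ev by (intro mult_left_mono) auto
        also have "\<dots> = K1 * (d' * l)" using d' by (simp add: K1_def)
        also have "\<dots> \<le> K1 * (l * l)" using far lpos K12 by (intro mult_left_mono mult_right_mono) auto
        also have "\<dots> \<le> s * l\<^sup>2" using K12 unfolding power2_eq_square by (intro mult_right_mono) (auto simp: s_def)
        finally show ?thesis .
      qed
    qed
    then show ?thesis using ge l(2) by simp
  qed
  moreover have "s > 0" using K12 by (simp add: s_def)
  ultimately show ?thesis
    unfolding proximal_normal_cone_def using U \<xi> by blast
qed

end

section \<open>The first variation in a set with flattened boundary\<close>

lemma Ck_on_id: "Ck_on 2 (\<lambda>x::'a::euclidean_space. x) U"
  by (simp add: numeral_2_eq_2)

context smooth_manifold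
begin

text \<open>\<open>\<psi>\<close> is a \<open>C\<^sup>2\<close> change of the coordinates \<open>c\<close>, with inverse \<open>q\<close>, that turns \<open>S \<inter> V\<close> into a piece of
  the convex cone \<open>K\<close>; the last clause lets one subtract the image of the base point \<open>x\<close>.\<close>

definition cone_chart ::
    "'m set \<Rightarrow> 'm \<Rightarrow> ('m, 'n) chart \<Rightarrow> 'm set \<Rightarrow> (real^'n \<Rightarrow> real^'n) \<Rightarrow> (real^'n \<Rightarrow> real^'n) \<Rightarrow> (real^'n) set
      \<Rightarrow> (real^'n) set \<Rightarrow> bool" where
  "cone_chart S x c V \<psi> q Q K \<longleftrightarrow> c \<in> A \<and> open V \<and> x \<in> V \<and> V \<subseteq> fst c \<and> open Q \<and>
     (\<forall>y\<in>V. \<psi> (snd c y) \<in> Q \<and> q (\<psi> (snd c y)) = snd c y) \<and>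
     (\<forall>p\<in>Q. q p \<in> snd c ` V \<and> \<psi> (q p) = p) \<and>
     Ck_on 2 \<psi> (snd c ` V) \<and> Ck_on 2 q Q \<and>
     (\<forall>e\<in>K. \<forall>f\<in>K. e + f \<in> K) \<and> (\<forall>e\<in>K. \<forall>s\<ge>0. s *\<^sub>R e \<in> K) \<and>
     (\<forall>y\<in>V. y \<in> S \<longleftrightarrow> \<psi> (snd c y) \<in> K) \<and> - \<psi> (snd c x) \<in> K"

lemma cone_chart_interior:
  assumes "x \<in> interior S"
  shows "\<exists>c V \<psi> q Q K. cone_chart S x c V \<psi> q Q K"
proof -
  obtain c where c: "c \<in> A" "x \<in> fst c" using cover by blast
  let ?V = "fst c \<inter> interior S"
  have V: "open ?V" using dom_open[OF c(1)] by auto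
  have "cone_chart S x c ?V (\<lambda>p. p) (\<lambda>p. p) (snd c ` ?V) UNIV"
    unfolding cone_chart_def
    using c V open_chart_image[OF c(1) V] assms interior_subset[of S] Ck_on_id by auto
  then show ?thesis by blast
qed

text \<open>\<open>flat_boundary_cone\<close> requires that segments avoiding \<open>L\<close> do
  not leave \<open>S\<close>. The image of a segment is connected, and a connected set meeting both
  \<open>S\<close> and its complement meets the frontier, which is \<open>L\<close> in these
  coordinates. Closedness of \<open>S\<close> puts the frontier into \<open>S\<close>.\<close>

lemma cone_chart_frontier:
  assumes S: "closed S" and N: "C2_submanifold k (frontier S)" and x: "x \<in> frontier S"
  shows "\<exists>c V \<psi> q Q K. cone_chart S x c V \<psi> q Q K"
proof -
  obtain c V0 and \<psi> :: "real^'n \<Rightarrow> real^'n" and L where c: "c \<in> A" and V0: "open V0" "x \<in> V0" "V0 \<subseteq> fst c"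
    and inj: "inj_on \<psi> (snd c ` V0)" and opQ0: "open (\<psi> ` snd c ` V0)"
    and C2: "Ck_on 2 \<psi> (snd c ` V0)" "Ck_on 2 (inv_into (snd c ` V0) \<psi>) (\<psi> ` snd c ` V0)"
    and L: "subspace L" "\<psi> ` snd c ` (V0 \<inter> frontier S) = \<psi> ` snd c ` V0 \<inter> L"
    using bspec[OF N[unfolded C2_submanifold_def] x] by (elim bexE exE conjE) (rule that)
  define q where "q = inv_into (snd c ` V0) \<psi>"
  define Q0 where "Q0 = \<psi> ` snd c ` V0"
  define u0 where "u0 = \<psi> (snd c x)"
  have q1: "q (\<psi> (snd c y)) = snd c y" if "y \<in> V0" for y
    unfolding q_def using inv_into_f_f[OF inj] that by blast
  have q2: "q p \<in> snd c ` V0" "\<psi> (q p) = p" if "p \<in> Q0" for p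
    using that unfolding q_def Q0_def by (auto intro: inv_into_into f_inv_into_f)
  have u0: "u0 \<in> Q0" "u0 \<in> L"
    using L(2) x V0(2) unfolding u0_def Q0_def by blast+
  obtain r where r: "r > 0" "ball u0 r \<subseteq> Q0" using opQ0 u0(1) openE unfolding Q0_def by blast
  let ?B = "ball u0 r"
  define f where "f p = chart_inv c (q p)" for p
  have fV: "f p \<in> V0" "\<psi> (snd c (f p)) = p" if p: "p \<in> Q0" for p
  proof -
    obtain y where y: "y \<in> V0" "q p = snd c y" using q2(1)[OF p] by blast
    have "f p = y" using chart_inv_left[OF c] y V0(3) by (auto simp: f_def)
    then show "f p \<in> V0" "\<psi> (snd c (f p)) = p" using y q2(2)[OF p] by auto
  qed
  have f\<psi>: "f (\<psi> (snd c y)) = y" if "y \<in> V0" for y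
    using q1[OF that] chart_inv_left[OF c] that V0(3) by (auto simp: f_def)
  have cf: "continuous_on Q0 f"
    unfolding f_def
  proof (rule continuous_on_compose2[OF continuous_on_chart_inv[OF c]])
    show "continuous_on Q0 q" using C2(2) Ck_on_2_imp_1 Ck_on_1_continuous_on unfolding q_def Q0_def by blast
    show "q ` Q0 \<subseteq> snd c ` fst c" using q2(1) V0(3) by blast
  qed
  define T where "T = {p. f p \<in> S}"
  have frontier_iff: "f p \<in> frontier S \<longleftrightarrow> p \<in> L" if p: "p \<in> Q0" for p
  proof
    assume "f p \<in> frontier S"
    then have "\<psi> (snd c (f p)) \<in> \<psi> ` snd c ` (V0 \<inter> frontier S)" using fV(1)[OF p] by blast
    then show "p \<in> L" using L(2) fV(2)[OF p] by auto
  next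
    assume "p \<in> L"
    then have "p \<in> \<psi> ` snd c ` (V0 \<inter> frontier S)" using L(2) p unfolding Q0_def by blast
    then show "f p \<in> frontier S" using f\<psi> by auto
  qed
  have LT: "?B \<inter> L \<subseteq> T"
    using frontier_iff r(2) frontier_subset_closed[OF S] unfolding T_def by blast
  have seg: "p' \<in> T" if p: "p \<in> ?B" "p' \<in> ?B" "closed_segment p p' \<inter> L = {}" "p \<in> T" for p p'
  proof (rule ccontr)
    assume "p' \<notin> T"
    let ?P = "closed_segment p p'"
    have P: "?P \<subseteq> Q0" using closed_segment_subset[OF p(1,2) convex_ball] r(2) by blast
    have "connected (f ` ?P)"
      by (rule connected_continuous_image[OF continuous_on_subset[OF cf P] connected_segment(1)])
    moreover have "f ` ?P \<inter> S \<noteq> {}" "f ` ?P - S \<noteq> {}"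
      using p(4) \<open>p' \<notin> T\<close> ends_in_segment[of p p'] by (auto simp: T_def)
    ultimately have "f ` ?P \<inter> frontier S \<noteq> {}" by (rule connected_Int_frontier)
    then show False using frontier_iff P p(3) by blast
  qed
  obtain K where K: "\<And>e f. e \<in> K \<Longrightarrow> f \<in> K \<Longrightarrow> e + f \<in> K" "\<And>e s. e \<in> K \<Longrightarrow> s \<ge> 0 \<Longrightarrow> s *\<^sub>R e \<in> K" "L \<subseteq> K"
    "?B \<inter> T = ?B \<inter> K"
    by (rule flat_boundary_cone[OF L(1) u0(2) LT seg]) (assumption+, blast)
  \<comment> \<open>Shrinking to the preimage of the ball makes \<open>S\<close> agree with the cone
    throughout \<open>V\<close>.\<close>
  define V where "V = V0 \<inter> (\<psi> \<circ> snd c) -` ?B"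
  have "continuous_on V0 (\<psi> \<circ> snd c)"
    using continuous_on_subset[OF continuous_on_chart[OF c] V0(3)] Ck_on_1_continuous_on[OF Ck_on_2_imp_1[OF C2(1)]]
    by (intro continuous_on_compose) auto
  then have V: "open V" unfolding V_def using V0(1) by (intro continuous_open_preimage) auto
  have "cone_chart S x c V \<psi> q ?B K"
    unfolding cone_chart_def
  proof (intro conjI ballI allI impI c V)
    show "x \<in> V" using V0 r u0_def by (simp add: V_def)
    show "V \<subseteq> fst c" using V0 by (auto simp: V_def)
    show "Ck_on 2 \<psi> (snd c ` V)" using C2(1) by (rule Ck_on_subset) (auto simp: V_def)
    show "Ck_on 2 q ?B" using C2(2) r(2) Ck_on_subset unfolding q_def Q0_def by blast
    \<comment> \<open>The base point maps into the subspace \<open>L\<close>, which is closed under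
      negation and contained in \<open>K\<close>.\<close>
    show "- \<psi> (snd c x) \<in> K" using subspace_neg[OF L(1) u0(2)] K(3) unfolding u0_def by blast
  next
    fix y assume "y \<in> V"
    then have y: "y \<in> V0" "\<psi> (snd c y) \<in> ?B" by (auto simp: V_def)
    then show "\<psi> (snd c y) \<in> ?B" "q (\<psi> (snd c y)) = snd c y" using q1 by auto
    have "y \<in> S \<longleftrightarrow> \<psi> (snd c y) \<in> T" using f\<psi>[OF y(1)] by (simp add: T_def)
    then show "y \<in> S \<longleftrightarrow> \<psi> (snd c y) \<in> K" using K(4) y(2) by blast
  next
    fix p assume p: "p \<in> ?B"
    then have pQ: "p \<in> Q0" using r by blast
    show "\<psi> (q p) = p" using q2(2)[OF pQ] .
    obtain y where y: "y \<in> V0" "q p = snd c y" using q2(1)[OF pQ] by blast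
    then have "y \<in> V" using q2(2)[OF pQ] p by (simp add: V_def)
    then show "q p \<in> snd c ` V" using y by blast
  next
    fix e f assume "e \<in> K" "f \<in> K"
    then show "e + f \<in> K" by (rule K(1))
  next
    fix e and s :: real assume "e \<in> K" "0 \<le> s"
    then show "s *\<^sub>R e \<in> K" by (rule K(2))
  qed simp
  then show ?thesis by blast
qed

text \<open>Differentiating \<open>\<psi> (q p) = p\<close> exhibits a left inverse of the
  derivative of \<open>q\<close>.\<close>

lemma cone_chart_inverse_frechet_injective:
  assumes "cone_chart S x c V \<psi> q Q K" "p \<in> Q" "v \<noteq> 0"
  shows "frechet_derivative q (at p) v \<noteq> 0"
proof
  assume 0: "frechet_derivative q (at p) v = 0"
  have q: "Ck_on 2 q Q" "open Q" and \<psi>: "Ck_on 2 \<psi> (snd c ` V)" and inv: "\<And>p. p \<in> Q \<Longrightarrow> \<psi> (q p) = p"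
    and qp: "q p \<in> snd c ` V"
    using assms unfolding cone_chart_def by auto
  note D = Ck_on_2_has_derivative[OF \<psi> qp]
  have "((\<lambda>p. \<psi> (q p)) has_derivative
      (\<lambda>v. frechet_derivative \<psi> (at (q p)) (frechet_derivative q (at p) v))) (at p)"
    by (rule has_derivative_compose[OF Ck_on_2_has_derivative[OF q(1) assms(2)] D])
  then have "((\<lambda>p. p) has_derivative
      (\<lambda>v. frechet_derivative \<psi> (at (q p)) (frechet_derivative q (at p) v))) (at p)"
    by (rule has_derivative_transform_within_open[OF _ q(2) assms(2)]) (rule inv)
  from fun_cong[OF has_derivative_unique[OF this has_derivative_ident], of v]
  show False using 0 linear_0[OF has_derivative_linear[OF D]] assms(3) by simp
qed

end

section \<open>Varying the minimizing curve, and the conclusion\<close>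

context riemannian_manifold
begin

lemma covariant_derivative_interior:
  assumes "a \<le> \<alpha>" "\<beta> \<le> b" "\<alpha> < t" "t < \<beta>"
  shows "covariant_derivative \<gamma> {a..b} (velocity \<gamma> {a..b}) t = covariant_derivative \<gamma> {\<alpha>..\<beta>} (velocity \<gamma> {\<alpha>..\<beta>}) t"
proof -
  have at: "at t within {a..b} = at t" "at t within {\<alpha>..\<beta>} = at t"
    using assms by (simp_all add: at_within_Icc_at)
  have "vector_derivative (\<lambda>s. velocity \<gamma> {a..b} s c) (at t) = vector_derivative (\<lambda>s. velocity \<gamma> {\<alpha>..\<beta>} s c) (at t)" for c
  proof (rule vector_derivative_cong_eq)
    have "\<forall>\<^sub>F s in nhds t. s \<in> {\<alpha><..<\<beta>}" using assms by (intro eventually_nhds_in_open) auto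
    then show "\<forall>\<^sub>F s in nhds t. s \<in> UNIV \<longrightarrow> velocity \<gamma> {a..b} s c = velocity \<gamma> {\<alpha>..\<beta>} s c"
      by eventually_elim (use velocity_interior assms in auto)
  qed simp_all
  then show ?thesis
    using velocity_interior[OF assms] unfolding covariant_derivative_def at by (simp cong: if_cong)
qed

text \<open>The pairing is \<open>EL\<close> of the pulled-back metric in direction
  \<open>e\<close>, which is continuous along the piece. A positive value at \<open>t0\<close> would
  persist on a short interval, and the variation supported there would be a shorter admissible
  curve.\<close>

lemma acceleration_nonpos_on_cone:
  assumes min: "minimizing_in S \<gamma> a b" and us: "unit_speed \<gamma> a b"
    and piece: "regular_piece \<gamma> \<alpha> \<beta>" and ab: "a \<le> \<alpha>" "\<alpha> < t0" "t0 < \<beta>" "\<beta> \<le> b"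
    and cc: "cone_chart S (\<gamma> t0) c V \<psi> q Q K" and e: "e \<in> K"
  shows "gfield c (snd c (\<gamma> t0)) (covariant_derivative \<gamma> {a..b} (velocity \<gamma> {a..b}) t0 c)
    \<bullet> frechet_derivative q (at (\<psi> (snd c (\<gamma> t0)))) e \<le> 0"
proof (rule ccontr)
  assume neg: "\<not> ?thesis"
  have c: "c \<in> A" and V: "open V" "\<gamma> t0 \<in> V" "V \<subseteq> fst c" and Q: "open Q"
    and \<psi>1: "\<And>y. y \<in> V \<Longrightarrow> \<psi> (snd c y) \<in> Q" "\<And>y. y \<in> V \<Longrightarrow> q (\<psi> (snd c y)) = snd c y"
    and q1: "\<And>p. p \<in> Q \<Longrightarrow> q p \<in> snd c ` V" "\<And>p. p \<in> Q \<Longrightarrow> \<psi> (q p) = p"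
    and \<psi>: "Ck_on 2 \<psi> (snd c ` V)" and q: "Ck_on 2 q Q"
    and K: "\<And>e f. e \<in> K \<Longrightarrow> f \<in> K \<Longrightarrow> e + f \<in> K" "\<And>e s. e \<in> K \<Longrightarrow> 0 \<le> s \<Longrightarrow> s *\<^sub>R e \<in> K"
    and S: "\<And>y. y \<in> V \<Longrightarrow> y \<in> S \<longleftrightarrow> \<psi> (snd c y) \<in> K"
    using cc unfolding cone_chart_def by auto
  have adm: "piecewise_regular \<gamma> a b" "\<gamma> ` {a..b} \<subseteq> S"
    using min by (auto simp: minimizing_in_def admissible_def)
  have C\<alpha>\<beta>: "C2_curve_on \<gamma> {\<alpha>..\<beta>}" using piece by (simp add: regular_piece_def)
  have "\<exists>\<delta>>0. \<forall>s. \<bar>s - t0\<bar> < \<delta> \<longrightarrow> s \<in> {\<alpha><..<\<beta>} \<and> \<gamma> s \<in> V"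
  proof -
    have "continuous_on {\<alpha><..<\<beta>} \<gamma>"
      by (rule continuous_on_subset[OF C2_curve_on_continuous[OF C\<alpha>\<beta>]]) auto
    then have "open ({\<alpha><..<\<beta>} \<inter> \<gamma> -` V)" using V(1) continuous_open_preimage open_greaterThanLessThan by blast
    moreover have "t0 \<in> {\<alpha><..<\<beta>} \<inter> \<gamma> -` V" using ab V by auto
    ultimately obtain \<delta> where "\<delta> > 0" "ball t0 \<delta> \<subseteq> {\<alpha><..<\<beta>} \<inter> \<gamma> -` V" using openE by blast
    then show ?thesis by (intro exI[of _ \<delta>]) (auto simp: dist_real_def subset_iff abs_minus_commute)
  qed
  then obtain \<delta> where \<delta>: "\<delta> > 0" "\<And>s. \<bar>s - t0\<bar> < \<delta> \<Longrightarrow> s \<in> {\<alpha><..<\<beta>} \<and> \<gamma> s \<in> V" by blast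
  define \<alpha>1 where "\<alpha>1 = t0 - \<delta> / 2"
  define \<beta>1 where "\<beta>1 = t0 + \<delta> / 2"
  let ?I = "{\<alpha>1..\<beta>1}"
  have \<alpha>1: "\<alpha>1 < t0" "t0 < \<beta>1" using \<delta> by (auto simp: \<alpha>1_def \<beta>1_def)
  have in1: "s \<in> {\<alpha><..<\<beta>}" "\<gamma> s \<in> V" if "s \<in> ?I" for s
    using \<delta>(2)[of s] \<delta>(1) that by (auto simp: \<alpha>1_def \<beta>1_def)
  have in1': "\<gamma> s \<in> fst c" if "s \<in> ?I" for s using in1(2)[OF that] V(3) by blast
  have sub1: "?I \<subseteq> {\<alpha>..\<beta>}" using in1(1) by force
  have C1: "C2_curve_on \<gamma> ?I" using C2_curve_on_subset[OF C\<alpha>\<beta> sub1] .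
  obtain v w where "chart_derivs c \<gamma> ?I v w" by (rule C2_curve_onE[OF C1 c])
  note vw = chart_derivsD[OF this]
  have x': "((snd c \<circ> \<gamma>) has_vector_derivative v t) (at t within ?I)" if "t \<in> ?I" for t using vw(1)[OF that in1'[OF that]] .
  have v': "(v has_vector_derivative w t) (at t within ?I)" if "t \<in> ?I" for t using vw(2)[OF that in1'[OF that]] .
  have cw: "continuous_on ?I w" using vw(3) in1' by (auto intro: continuous_on_subset)
  have cv: "continuous_on ?I v" using continuous_on_vector_derivative[OF v'] .
  have cx: "continuous_on ?I (snd c \<circ> \<gamma>)" using continuous_on_vector_derivative[OF x'] .
  let ?D\<psi> = "\<lambda>y. frechet_derivative \<psi> (at y)" and ?Dq = "\<lambda>y. frechet_derivative q (at y)"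
  have opV: "open (snd c ` V)" using open_chart_image[OF c V(1,3)] .
  note F\<psi> = C1_field_frechet[OF opV \<psi>] and Fq = C1_field_frechet[OF Q q]
  define u where "u t = \<psi> ((snd c \<circ> \<gamma>) t)" for t
  define u1 where "u1 t = ?D\<psi> ((snd c \<circ> \<gamma>) t) (v t)" for t
  define u2 where "u2 t = dfield ?D\<psi> ((snd c \<circ> \<gamma>) t) (v t) (v t) + ?D\<psi> ((snd c \<circ> \<gamma>) t) (w t)" for t
  have xV: "(snd c \<circ> \<gamma>) t \<in> snd c ` V" if "t \<in> ?I" for t using in1[OF that] by auto
  have du: "(u has_vector_derivative u1 t) (at t within ?I)" if "t \<in> ?I" for t
    unfolding u_def u1_def
    by (rule frechet_derivative_has_vector_derivative[OF Ck_on_2_imp_1[OF \<psi>] x'[OF that] xV[OF that]])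
  have du1: "(u1 has_vector_derivative u2 t) (at t within ?I)" if "t \<in> ?I" for t
    unfolding u1_def u2_def by (rule C1_field_chain_vector[OF F\<psi> x'[OF that] xV[OF that] that v'[OF that]])
  have cu2: "continuous_on ?I u2"
    unfolding u2_def
    by (intro continuous_on_add C1_field_continuous_on[OF F\<psi> cx xV] dfield_continuous_on[OF F\<psi> cx xV] cv cw)
  have cu: "continuous_on ?I u" using continuous_on_vector_derivative[OF du] .
  have cu1: "continuous_on ?I u1" using continuous_on_vector_derivative[OF du1] .
  have uQ: "u t \<in> Q" if "t \<in> ?I" for t using \<psi>1(1)[OF in1(2)[OF that]] by (simp add: u_def)
  have qu: "q (u t) = (snd c \<circ> \<gamma>) t" if "t \<in> ?I" for t using \<psi>1(2)[OF in1(2)[OF that]] by (simp add: u_def)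
  have bot: "at t within ?I \<noteq> bot" if "t \<in> ?I" for t using at_within_Icc_neq_bot[OF _ that] \<alpha>1 by simp
  \<comment> \<open>Since \<open>q\<close> undoes \<open>\<psi>\<close> along the curve,
    differentiating \<open>q (u t)\<close> once and twice returns \<open>v\<close> and
    \<open>w\<close>; these are the arguments that \<open>EL_pullback\<close> produces.\<close>
  have v_eq: "?Dq (u t) (u1 t) = v t" if t: "t \<in> ?I" for t
  proof -
    have "((\<lambda>t. q (u t)) has_vector_derivative ?Dq (u t) (u1 t)) (at t within ?I)"
      by (rule frechet_derivative_has_vector_derivative[OF Ck_on_2_imp_1[OF q] du[OF t] uQ[OF t]])
    then have "((snd c \<circ> \<gamma>) has_vector_derivative ?Dq (u t) (u1 t)) (at t within ?I)"
      by (rule has_vector_derivative_transform[OF t, rotated]) (simp add: qu)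
    then show ?thesis using vector_derivative_unique_within[OF bot[OF t] _ x'[OF t]] by blast
  qed
  have w_eq: "dfield ?Dq (u t) (u1 t) (u1 t) + ?Dq (u t) (u2 t) = w t" if t: "t \<in> ?I" for t
  proof -
    have "((\<lambda>t. ?Dq (u t) (u1 t)) has_vector_derivative dfield ?Dq (u t) (u1 t) (u1 t) + ?Dq (u t) (u2 t)) (at t within ?I)"
      by (rule C1_field_chain_vector[OF Fq du[OF t] uQ[OF t] t du1[OF t]])
    then have "(v has_vector_derivative dfield ?Dq (u t) (u1 t) (u1 t) + ?Dq (u t) (u2 t)) (at t within ?I)"
      by (rule has_vector_derivative_transform[OF t, rotated]) (simp add: v_eq)
    then show ?thesis using vector_derivative_unique_within[OF bot[OF t] _ v'[OF t]] by blast
  qed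
  define F where "F = pullback q (gfield c)"
  have qsub: "q ` Q \<subseteq> snd c ` fst c" using q1(1) V(3) by blast
  have F: "metric_field Q F"
    unfolding F_def
    by (rule metric_field_pullback[OF Q q qsub metric_field_gfield[OF c]])
      (rule cone_chart_inverse_frechet_injective[OF cc])
  then have CF: "C1_field Q F" by (simp add: metric_field_def)
  have F_inner: "F p z \<bullet> z' = gfield c (q p) (?Dq p z) \<bullet> ?Dq p z'" if "p \<in> Q" for p z z'
    unfolding F_def by (rule pullback_inner[OF Q q qsub C1_field_gfield[OF c] that])
  define h where "h t = EL F (u t) (u1 t) (u2 t) e" for t
  have "h t0 > 0"
  proof -
    have t0: "t0 \<in> ?I" using \<alpha>1 by auto
    have p0: "snd c (\<gamma> t0) \<in> snd c ` fst c" using V by auto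
    have "covariant_derivative \<gamma> {a..b} (velocity \<gamma> {a..b}) t0 c = coord_accel c (snd c (\<gamma> t0)) (v t0) (w t0)"
      using covariant_derivative_interior[of a \<alpha>1 \<beta>1 b t0 \<gamma>] ab \<alpha>1 in1(1)[of \<alpha>1] in1(1)[of \<beta>1]
        covariant_derivative_coord[OF c C2_curve_on_continuous[OF C1] t0 in1'[OF t0] bot vw(1) v'[OF t0]]
      by (auto simp: less_imp_le)
    moreover have "h t0 = EL (gfield c) (q (u t0)) (?Dq (u t0) (u1 t0))
        (dfield ?Dq (u t0) (u1 t0) (u1 t0) + ?Dq (u t0) (u2 t0)) (?Dq (u t0) e)"
      unfolding h_def F_def
    proof (rule EL_pullback[OF Q q qsub C1_field_gfield[OF c] uQ[OF t0]])
      show "gfield c (q (u t0)) z \<bullet> z' = gfield c (q (u t0)) z' \<bullet> z" for z z'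
        using metric_field_gfield[OF c] qsub uQ[OF t0] unfolding metric_field_def by blast
    qed
    ultimately show ?thesis
      using neg gfield_coord_accel[OF c p0, of "v t0" "w t0" "?Dq (u t0) e"] qu[OF t0] v_eq[OF t0] w_eq[OF t0]
      by (simp add: u_def)
  qed
  moreover have "continuous_on ?I h"
    unfolding h_def EL_def
    by (intro continuous_intros C1_field_continuous_on[OF CF cu uQ] dfield_continuous_on[OF CF cu uQ] cu1 cu2) auto
  \<comment> \<open>By continuity \<open>h\<close> stays positive on a smaller interval around
    \<open>t0\<close>, to which the variation is confined.\<close>
  ultimately obtain \<eta> where \<eta>: "\<eta> > 0" "\<And>t. t \<in> ?I \<Longrightarrow> dist t t0 < \<eta> \<Longrightarrow> dist (h t) (h t0) < h t0"
    using \<alpha>1 unfolding continuous_on_iff by (metis atLeastAtMost_iff less_imp_le)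
  define \<alpha>2 where "\<alpha>2 = max \<alpha>1 (t0 - \<eta> / 2)"
  define \<beta>2 where "\<beta>2 = min \<beta>1 (t0 + \<eta> / 2)"
  let ?J = "{\<alpha>2..\<beta>2}"
  have \<alpha>2: "\<alpha>2 < \<beta>2" using \<alpha>1 \<eta> by (auto simp: \<alpha>2_def \<beta>2_def)
  have J: "?J \<subseteq> ?I" by (auto simp: \<alpha>2_def \<beta>2_def)
  have hpos: "h t > 0" if "t \<in> ?J" for t
  proof -
    have "dist t t0 < \<eta>" using that \<eta>(1) by (auto simp: \<alpha>2_def \<beta>2_def dist_real_def)
    then show ?thesis using \<eta>(2)[of t] that J by (auto simp: dist_real_def)
  qed
  have duJ: "(u has_vector_derivative u1 t) (at t within ?J)" if "t \<in> ?J" for t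
    using has_vector_derivative_within_subset[OF du J] that J by blast
  have du1J: "(u1 has_vector_derivative u2 t) (at t within ?J)" if "t \<in> ?J" for t
    using has_vector_derivative_within_subset[OF du1 J] that J by blast
  have uQJ: "u t \<in> Q" if "t \<in> ?J" for t using uQ J that by blast
  have cuJ: "continuous_on ?J u" "continuous_on ?J u1" "continuous_on ?J u2"
    using continuous_on_subset[OF _ J] cu cu1 cu2 by blast+
  define k where "k t = (t - \<alpha>2) * (\<beta>2 - t)" for t
  define l where "l t = \<alpha>2 + \<beta>2 - 2 * t" for t
  have ck: "continuous_on ?J k" and cl: "continuous_on ?J l"
    unfolding k_def l_def by (intro continuous_intros)+
  obtain d1 where d1: "d1 > 0" "\<And>s. 0 < s \<Longrightarrow> s < d1 \<Longrightarrow>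
      integral ?J (\<lambda>t. F (u t + (s * k t) *\<^sub>R e) (u1 t + (s * l t) *\<^sub>R e) \<bullet> (u1 t + (s * l t) *\<^sub>R e))
      < integral ?J (\<lambda>t. F (u t) (u1 t) \<bullet> u1 t)"
    using energy_decreases[OF F \<alpha>2 duJ du1J cuJ(3) uQJ hpos[unfolded h_def]] unfolding k_def l_def by blast
  obtain d2 where d2: "d2 > 0" "\<And>s t. \<bar>s\<bar> \<le> d2 \<Longrightarrow> t \<in> ?J \<Longrightarrow> u t + (s * k t) *\<^sub>R e \<in> Q"
    using small_perturbation_in_open[OF cuJ(1) uQJ Q ck, of e] by metis
  have u1nz: "u1 t \<in> - {0}" if t: "t \<in> ?J" for t
  proof -
    have tI: "t \<in> ?I" using t J by blast
    have "velocity \<gamma> {\<alpha>..\<beta>} t \<noteq> (\<lambda>_. 0)" using piece tI sub1 by (auto simp: regular_piece_def)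
    then have "velocity \<gamma> ?I t \<noteq> (\<lambda>_. 0)" using velocity_subset[OF C\<alpha>\<beta> sub1 tI bot[OF tI]] by simp
    then have nz: "coord_vec c (\<gamma> t) (v t) \<noteq> (\<lambda>_. 0)"
      using velocity_eq_coord_vec[OF c C2_curve_on_continuous[OF C1] tI in1'[OF tI] bot[OF tI] x'[OF tI]] by simp
    have "v t \<noteq> 0"
    proof
      assume "v t = 0"
      then have "tnorm (\<gamma> t) (coord_vec c (\<gamma> t) (v t)) = 0" using tnorm_coord[OF c in1'[OF tI]] by simp
      then show False
        using metric_pos[OF coord_vec_tangent[OF c in1'[OF tI]] nz] by (simp add: tnorm_def)
    qed
    then show ?thesis using v_eq[OF tI] linear_0[OF linear_pullback_map[OF Q q qsub C1_field_gfield[OF c] uQ[OF tI]]] by auto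
  qed
  obtain d3 where d3: "d3 > 0" "\<And>s t. \<bar>s\<bar> \<le> d3 \<Longrightarrow> t \<in> ?J \<Longrightarrow> u1 t + (s * l t) *\<^sub>R e \<in> - {0}"
    using small_perturbation_in_open[OF cuJ(2) u1nz _ cl, of e] by (metis open_Compl closed_singleton)
  \<comment> \<open>Three demands: the energy drops, the varied curve stays in \<open>Q\<close>, and
    its velocity does not vanish, so that it is again regular.\<close>
  define s where "s = min d1 (min d2 d3) / 2"
  have s: "0 < s" "s < d1" "\<bar>s\<bar> \<le> d2" "\<bar>s\<bar> \<le> d3" using d1(1) d2(1) d3(1) by (auto simp: s_def)
  define us where "us t = u t + (s * k t) *\<^sub>R e" for t
  define us1 where "us1 t = u1 t + (s * l t) *\<^sub>R e" for t
  define us2 where "us2 t = u2 t - (2 * s) *\<^sub>R e" for t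
  have usQ: "us t \<in> Q" "us1 t \<noteq> 0" if "t \<in> ?J" for t
    using d2(2)[OF s(3) that] d3(2)[OF s(4) that] by (auto simp: us_def us1_def)
  have dus: "(us has_vector_derivative us1 t) (at t within ?J)" if "t \<in> ?J" for t
  proof -
    have "((\<lambda>t. s * k t) has_real_derivative s * l t) (at t within ?J)"
      unfolding k_def l_def by (auto intro!: derivative_eq_intros simp: algebra_simps)
    then have "((\<lambda>t. (s * k t) *\<^sub>R e) has_vector_derivative (s * l t) *\<^sub>R e) (at t within ?J)"
      using has_vector_derivative_scaleR[OF _ has_vector_derivative_const[of e]] by fastforce
    then show ?thesis unfolding us_def us1_def using duJ[OF that] has_vector_derivative_add by blast
  qed
  have dus1: "(us1 has_vector_derivative us2 t) (at t within ?J)" if "t \<in> ?J" for t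
  proof -
    have "((\<lambda>t. s * l t) has_real_derivative - (2 * s)) (at t within ?J)"
      unfolding l_def by (auto intro!: derivative_eq_intros simp: algebra_simps)
    then have "((\<lambda>t. (s * l t) *\<^sub>R e) has_vector_derivative (- (2 * s)) *\<^sub>R e) (at t within ?J)"
      using has_vector_derivative_scaleR[OF _ has_vector_derivative_const[of e]] by fastforce
    from has_vector_derivative_add[OF du1J[OF that] this]
    show ?thesis unfolding us1_def us2_def by simp
  qed
  have cus: "continuous_on ?J us" using continuous_on_vector_derivative[OF dus] .
  have cus1: "continuous_on ?J us1" using continuous_on_vector_derivative[OF dus1] .
  have cus2: "continuous_on ?J us2" unfolding us2_def by (intro continuous_intros cuJ)
  define \<gamma>s where "\<gamma>s t = chart_inv c (q (us t))" for t
  define vs where "vs t = ?Dq (us t) (us1 t)" for t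
  define ws where "ws t = dfield ?Dq (us t) (us1 t) (us1 t) + ?Dq (us t) (us2 t)" for t
  have qV: "\<gamma>s t \<in> V" "snd c (\<gamma>s t) = q (us t)" if t: "t \<in> ?J" for t
  proof -
    obtain y where y: "y \<in> V" "q (us t) = snd c y" using q1(1)[OF usQ(1)[OF t]] by blast
    then have "\<gamma>s t = y" using chart_inv_left[OF c] V(3) by (auto simp: \<gamma>s_def)
    then show "\<gamma>s t \<in> V" "snd c (\<gamma>s t) = q (us t)" using y by auto
  qed
  have q_us: "q (us t) \<in> snd c ` fst c" if "t \<in> ?J" for t using qsub usQ(1)[OF that] by blast
  have c\<gamma>s: "continuous_on ?J \<gamma>s"
    unfolding \<gamma>s_def
  proof (rule continuous_on_compose2[OF continuous_on_chart_inv[OF c]])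
    show "continuous_on ?J (\<lambda>t. q (us t))"
      using continuous_on_compose2[OF Ck_on_1_continuous_on[OF Ck_on_2_imp_1[OF q]] cus] usQ(1) by blast
  qed (use q_us in blast)
  have dxs: "((snd c \<circ> \<gamma>s) has_vector_derivative vs t) (at t within ?J)" if t: "t \<in> ?J" for t
  proof (rule has_vector_derivative_transform[OF t])
    show "((\<lambda>t. q (us t)) has_vector_derivative vs t) (at t within ?J)"
      unfolding vs_def by (rule frechet_derivative_has_vector_derivative[OF Ck_on_2_imp_1[OF q] dus[OF t] usQ(1)[OF t]])
  qed (simp add: qV)
  have dvs: "(vs has_vector_derivative ws t) (at t within ?J)" if t: "t \<in> ?J" for t
    unfolding vs_def ws_def by (rule C1_field_chain_vector[OF Fq dus[OF t] usQ(1)[OF t] t dus1[OF t]])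
  have cws: "continuous_on ?J ws"
    unfolding ws_def
    by (intro continuous_on_add C1_field_continuous_on[OF Fq cus usQ(1)] dfield_continuous_on[OF Fq cus usQ(1)] cus1 cus2)
  have imgs: "\<gamma>s ` ?J \<subseteq> fst c" using qV(1) V(3) by blast
  have vs_nz: "vs t \<noteq> 0" if t: "t \<in> ?J" for t
    unfolding vs_def by (rule cone_chart_inverse_frechet_injective[OF cc usQ[OF t]])
  have piece_s: "regular_piece \<gamma>s \<alpha>2 \<beta>2"
    by (rule regular_piece_chartI[OF c \<alpha>2 c\<gamma>s imgs dxs dvs cws vs_nz])
  have in_S: "\<gamma>s t \<in> S" if t: "t \<in> ?J" for t
  proof -
    have tI: "t \<in> ?I" using t J by blast
    have "t \<in> {a..b}" using in1(1)[OF tI] ab by auto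
    then have "\<gamma> t \<in> S" using adm(2) by blast
    then have "u t \<in> K" using S[OF in1(2)[OF tI]] by (simp add: u_def)
    \<comment> \<open>Here the signs matter: \<open>s\<close> and the bump \<open>k\<close> are
      nonnegative, and \<open>K\<close> is closed only under nonnegative scaling and
      addition.\<close>
    moreover have "(s * k t) *\<^sub>R e \<in> K" using s(1) t by (intro K(2) e) (auto simp: k_def)
    ultimately have "us t \<in> K" unfolding us_def by (rule K(1))
    moreover have "\<psi> (snd c (\<gamma>s t)) = us t" using qV(2)[OF t] q1(2)[OF usQ(1)[OF t]] by simp
    ultimately show ?thesis using S[OF qV(1)[OF t]] by simp
  qed
  have ends: "\<gamma>s t = \<gamma> t" if t: "t \<in> {\<alpha>2, \<beta>2}" for t
  proof -
    have tI: "t \<in> ?I" using t J \<alpha>2 by auto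
    have "us t = u t" using t by (auto simp: us_def k_def)
    then show ?thesis using qu[OF tI] chart_inv_left[OF c in1'[OF tI]] by (simp add: \<gamma>s_def)
  qed
  define \<gamma>' where "\<gamma>' t = (if t \<in> ?J then \<gamma>s t else \<gamma> t)" for t
  have \<gamma>': "\<And>t. t \<in> {a..\<alpha>2} \<Longrightarrow> \<gamma> t = \<gamma>' t" "\<And>t. t \<in> ?J \<Longrightarrow> \<gamma>s t = \<gamma>' t" "\<And>t. t \<in> {\<beta>2..b} \<Longrightarrow> \<gamma> t = \<gamma>' t"
    using ends by (auto simp: \<gamma>'_def)
  have a\<alpha>2: "a < \<alpha>2" "\<beta>2 < b"
    using in1(1)[of \<alpha>2] in1(1)[of \<beta>2] J \<alpha>2 ab by auto
  have split: "piecewise_regular \<gamma> a \<alpha>2" "piecewise_regular \<gamma> \<alpha>2 b" "piecewise_regular \<gamma> \<alpha>2 \<beta>2" "piecewise_regular \<gamma> \<beta>2 b"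
    using piecewise_regular_split[OF adm(1), of \<alpha>2] piecewise_regular_split[of \<gamma> \<alpha>2 b \<beta>2] a\<alpha>2 \<alpha>2 by auto
  have split': "piecewise_regular \<gamma>' a \<alpha>2" "piecewise_regular \<gamma>' \<alpha>2 \<beta>2" "piecewise_regular \<gamma>' \<beta>2 b"
    using piecewise_regular_cong[OF split(1) \<gamma>'(1)] piecewise_regular_cong[OF piecewise_regular_piece[OF piece_s] \<gamma>'(2)]
      piecewise_regular_cong[OF split(4) \<gamma>'(3)] by blast+
  have split'': "piecewise_regular \<gamma>' \<alpha>2 b" using piecewise_regular_join[OF split'(2,3)] .
  have "admissible S \<gamma>' a b"
    unfolding admissible_def
    using piecewise_regular_join[OF split'(1) split''] adm(2) in_S by (auto simp: \<gamma>'_def)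
  moreover have "\<gamma>' a = \<gamma> a" "\<gamma>' b = \<gamma> b" using \<gamma>'(1)[of a] \<gamma>'(3)[of b] a\<alpha>2 by auto
  ultimately have "curve_length \<gamma> a b \<le> curve_length \<gamma>' a b" using min unfolding minimizing_in_def by blast
  moreover have "curve_length \<gamma> a b = curve_length \<gamma> a \<alpha>2 + (curve_length \<gamma> \<alpha>2 \<beta>2 + curve_length \<gamma> \<beta>2 b)"
    using curve_length_join[OF split(1,2)] curve_length_join[OF split(3,4)] by simp
  moreover have "curve_length \<gamma>' a b = curve_length \<gamma> a \<alpha>2 + (curve_length \<gamma>s \<alpha>2 \<beta>2 + curve_length \<gamma> \<beta>2 b)"
    using curve_length_join[OF split'(1) split''] curve_length_join[OF split'(2,3)]
      curve_length_cong[OF \<gamma>'(1)] curve_length_cong[OF \<gamma>'(2)] curve_length_cong[OF \<gamma>'(3)] by simp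
  ultimately have le: "curve_length \<gamma> \<alpha>2 \<beta>2 \<le> curve_length \<gamma>s \<alpha>2 \<beta>2" by simp
  have botJ: "at t within ?J \<noteq> bot" if "t \<in> ?J" for t using at_within_Icc_neq_bot[OF \<alpha>2 that] .
  have speed1: "F (u t) (u1 t) \<bullet> u1 t = (speed \<gamma> ?J t)\<^sup>2" if t: "t \<in> ?J" for t
  proof -
    have tI: "t \<in> ?I" using t J by blast
    have "speed \<gamma> ?J t = sqrt (gfield c (snd c (\<gamma> t)) (v t) \<bullet> v t)"
      using speed_coord[OF c continuous_on_subset[OF C2_curve_on_continuous[OF C1] J] t in1'[OF tI] botJ[OF t]
          has_vector_derivative_within_subset[OF x'[OF tI] J]] .
    then show ?thesis
      using F_inner[OF uQ[OF tI], of "u1 t" "u1 t"] v_eq[OF tI] qu[OF tI] gfield_nonneg[OF c] in1'[OF tI] by simp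
  qed
  have speed2: "F (us t) (us1 t) \<bullet> us1 t = (speed \<gamma>s ?J t)\<^sup>2" if t: "t \<in> ?J" for t
  proof -
    have "speed \<gamma>s ?J t = sqrt (gfield c (snd c (\<gamma>s t)) (vs t) \<bullet> vs t)"
      using speed_coord[OF c c\<gamma>s t _ botJ[OF t] dxs[OF t]] imgs t by blast
    then show ?thesis
      using F_inner[OF usQ(1)[OF t], of "us1 t" "us1 t"] qV(2)[OF t] gfield_nonneg[OF c q_us[OF t]]
      by (simp add: vs_def)
  qed
  obtain N where N: "finite N" "\<And>t. t \<in> {a..b} - N \<Longrightarrow> speed \<gamma> {a..b} t = 1"
    using us unfolding unit_speed_def by blast
  \<comment> \<open>Unit speed is given off a finite set for the velocity within
    \<open>{a..b}\<close>, which agrees with that within \<open>?J\<close> at interior points of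
    \<open>?J\<close>.\<close>
  have one: "speed \<gamma> ?J t = 1" if t: "t \<in> ?J - (N \<union> {\<alpha>2, \<beta>2})" for t
  proof -
    have "velocity \<gamma> {a..b} t = velocity \<gamma> ?J t" using t a\<alpha>2 by (intro velocity_interior) auto
    moreover have "t \<in> {a..b} - N" using t a\<alpha>2 by auto
    ultimately show ?thesis using N(2)[of t] by simp
  qed
  have const: "((\<lambda>_. 1::real) has_integral (\<beta>2 - \<alpha>2)) ?J"
    using has_integral_const_real[of "1::real" \<alpha>2 \<beta>2] \<alpha>2 by simp
  have fin: "finite (N \<union> {\<alpha>2, \<beta>2})" using N(1) by simp
  have "(speed \<gamma> ?J has_integral (\<beta>2 - \<alpha>2)) ?J"
    by (rule has_integral_spike_finite[OF fin _ const]) (use one in auto)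
  then have len: "curve_length \<gamma> \<alpha>2 \<beta>2 = \<beta>2 - \<alpha>2" unfolding curve_length_def by (rule integral_unique)
  have "((\<lambda>t. F (u t) (u1 t) \<bullet> u1 t) has_integral (\<beta>2 - \<alpha>2)) ?J"
    by (rule has_integral_spike_finite[OF fin _ const]) (use one speed1 in auto)
  then have en: "integral ?J (\<lambda>t. F (u t) (u1 t) \<bullet> u1 t) = \<beta>2 - \<alpha>2" by (rule integral_unique)
  have ien: "(\<lambda>t. F (us t) (us1 t) \<bullet> us1 t) integrable_on ?J"
    by (intro integrable_continuous_interval continuous_on_inner C1_field_continuous_on[OF CF cus usQ(1)] cus1)
  have lt: "integral ?J (\<lambda>t. F (us t) (us1 t) \<bullet> us1 t) < \<beta>2 - \<alpha>2"
    using d1(2)[OF s(1,2)] en unfolding us_def us1_def by simp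
  have "curve_length \<gamma>s \<alpha>2 \<beta>2 \<le> (integral ?J (\<lambda>t. F (us t) (us1 t) \<bullet> us1 t) + (\<beta>2 - \<alpha>2)) / 2"
  proof (rule has_integral_le[OF piece_has_length[OF piece_s]
        has_integral_divide[OF has_integral_add[OF integrable_integral[OF ien] const]]])
    fix t assume t: "t \<in> ?J"
    \<comment> \<open>Expanding the square gives \<open>speed \<le> (speed^2 + 1) / 2\<close>, which
      bounds length by energy without differentiating a square root.\<close>
    have "0 \<le> (speed \<gamma>s ?J t - 1)\<^sup>2" by simp
    then show "speed \<gamma>s ?J t \<le> (F (us t) (us1 t) \<bullet> us1 t + 1) / 2"
      unfolding speed2[OF t] by (simp add: power2_eq_square algebra_simps)
  qed
  then show False using le len lt by simp
qed

text \<open>For \<open>y\<close> in \<open>S\<close> near \<open>x\<close> the difference of the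
  flattened coordinates of \<open>y\<close> and \<open>x\<close> is a sum of two elements of
  \<open>K\<close>, so the polar condition applies to it. Taylor expansion of \<open>q\<close>
  compares its image with the coordinate difference in \<open>c\<close>, and the Lipschitz bound for
  \<open>\<psi>\<close> makes the error quadratic in that difference.\<close>

lemma proximal_normal_cone_chartI:
  assumes cc: "cone_chart S x c V \<psi> q Q K" and xS: "x \<in> S" and U: "convex_nhd x U" and \<xi>: "\<xi> \<in> tangent_space x"
    and polar: "\<And>e. e \<in> K \<Longrightarrow>
      gfield c (snd c x) (\<xi> c) \<bullet> frechet_derivative q (at (\<psi> (snd c x))) e \<le> 0"
  shows "\<xi> \<in> proximal_normal_cone S x"
proof -
  have c: "c \<in> A" and V: "open V" "x \<in> V" "V \<subseteq> fst c" and Q: "open Q"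
    and \<psi>1: "\<And>y. y \<in> V \<Longrightarrow> \<psi> (snd c y) \<in> Q" "\<And>y. y \<in> V \<Longrightarrow> q (\<psi> (snd c y)) = snd c y"
    and \<psi>: "Ck_on 2 \<psi> (snd c ` V)" and q: "Ck_on 2 q Q"
    and K: "\<And>e f. e \<in> K \<Longrightarrow> f \<in> K \<Longrightarrow> e + f \<in> K" "- \<psi> (snd c x) \<in> K"
    and S: "\<And>y. y \<in> V \<Longrightarrow> y \<in> S \<longleftrightarrow> \<psi> (snd c y) \<in> K"
    using cc unfolding cone_chart_def by auto
  define p where "p = snd c x"
  define u where "u = \<psi> p"
  define a where "a = gfield c p (\<xi> c)"
  have opV: "open (snd c ` V)" using open_chart_image[OF c V(1,3)] .
  have pV: "p \<in> snd c ` V" and uQ: "u \<in> Q" using V \<psi>1 by (auto simp: p_def u_def)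
  obtain C1 d1 where 1: "C1 > 0" "d1 > 0" "\<And>h. norm h < d1 \<Longrightarrow> u + h \<in> Q \<and>
      norm (q (u + h) - q u - frechet_derivative q (at u) h) \<le> C1 * (norm h)\<^sup>2"
    by (rule Ck_on_2_Taylor[OF Q q uQ]) blast
  obtain C2 d2 where 2: "C2 > 0" "d2 > 0" "\<And>y. norm (y - p) < d2 \<Longrightarrow> norm (\<psi> y - \<psi> p) \<le> C2 * norm (y - p)"
    by (rule Ck_on_2_locally_lipschitz[OF opV \<psi> pV]) blast
  obtain d3 where 3: "d3 > 0" "ball p d3 \<subseteq> snd c ` V" using opV pV openE by blast
  \<comment> \<open>Within \<open>r\<close> the coordinates of \<open>y\<close> belong to the image
    of \<open>V\<close>, the Lipschitz bound for \<open>\<psi>\<close> holds, and it keeps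
    \<open>h\<close> in the range of the Taylor estimate.\<close>
  define r where "r = min d3 (min d2 (d1 / C2))"
  show ?thesis
  proof (rule proximal_normalI[OF c _ U \<xi>, of r S "norm a * C1 * C2\<^sup>2"])
    show "x \<in> fst c" using V by blast
    show "r > 0" using 1 2 3 by (simp add: r_def)
    fix y assume y: "y \<in> S" "y \<in> fst c" and "norm (snd c y - snd c x) < r"
    then have z: "norm (snd c y - p) < d3" "norm (snd c y - p) < d2" "norm (snd c y - p) < d1 / C2"
      by (auto simp: r_def p_def)
    let ?z = "snd c y - p"
    have "snd c y \<in> ball p d3" using z(1) by (simp add: dist_norm norm_minus_commute)
    then obtain y' where y': "y' \<in> V" "snd c y = snd c y'" using 3(2) by blast
    then have "y = y'" using chart_inv_left[OF c] V(3) y(2) by (metis subsetD)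
    then have yV: "y \<in> V" using y' by simp
    define h where "h = \<psi> (snd c y) - u"
    have hK: "h \<in> K"
    proof -
      have "\<psi> (snd c y) \<in> K" using S[OF yV] y(1) by simp
      from K(1)[OF this K(2)] show ?thesis by (simp add: h_def u_def p_def)
    qed
    have hn: "norm h \<le> C2 * norm ?z" using 2(3)[OF z(2)] by (simp add: h_def u_def)
    also have "\<dots> < d1" using z(3) 2(1) by (simp add: field_simps)
    finally have "norm (q (u + h) - q u - frechet_derivative q (at u) h) \<le> C1 * (norm h)\<^sup>2" using 1(3) by blast
    moreover have "q (u + h) = snd c y" "q u = p" using \<psi>1(2)[OF yV] \<psi>1(2)[OF V(2)] by (auto simp: h_def u_def p_def)
    ultimately have R: "norm (?z - frechet_derivative q (at u) h) \<le> C1 * (norm h)\<^sup>2" by simp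
    have "a \<bullet> ?z = a \<bullet> frechet_derivative q (at u) h + a \<bullet> (?z - frechet_derivative q (at u) h)"
      by (simp add: inner_diff_right)
    also have "\<dots> \<le> 0 + norm a * norm (?z - frechet_derivative q (at u) h)"
      using polar[OF hK] by (intro add_mono norm_cauchy_schwarz) (simp add: a_def p_def u_def)
    also have "\<dots> \<le> norm a * (C1 * (C2 * norm ?z)\<^sup>2)"
      using R hn 1(1) power_mono[OF hn, of 2]
      by (auto intro!: mult_left_mono intro: order_trans)
    finally show "gfield c (snd c x) (\<xi> c) \<bullet> (snd c y - snd c x) \<le> norm a * C1 * C2\<^sup>2 * (norm (snd c y - snd c x))\<^sup>2"
      by (simp add: a_def p_def power_mult_distrib mult_ac)
  qed
qed

lemma minimizing_acceleration_proximal: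
  assumes S: "closed S" and pr: "prox_regular S" and N: "C2_submanifold k (frontier S)"
    and us: "unit_speed \<gamma> a b" and min: "minimizing_in S \<gamma> a b"
  shows "\<exists>F. finite F \<and> (\<forall>t\<in>{a..b} - F.
    covariant_derivative \<gamma> {a..b} (velocity \<gamma> {a..b}) t \<in> proximal_normal_cone S (\<gamma> t))"
proof -
  have adm: "piecewise_regular \<gamma> a b" "\<gamma> ` {a..b} \<subseteq> S"
    using min by (auto simp: minimizing_in_def admissible_def)
  obtain F where F: "finite F" "\<And>t. t \<in> {a..b} - F \<Longrightarrow>
      \<exists>\<alpha> \<beta>. \<alpha> < t \<and> t < \<beta> \<and> a \<le> \<alpha> \<and> \<beta> \<le> b \<and> regular_piece \<gamma> \<alpha> \<beta>"
    by (rule piecewise_regular_regular_points[OF adm(1)]) blast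
  have "covariant_derivative \<gamma> {a..b} (velocity \<gamma> {a..b}) t \<in> proximal_normal_cone S (\<gamma> t)" if t: "t \<in> {a..b} - F" for t
  proof -
    obtain \<alpha> \<beta> where ab: "\<alpha> < t" "t < \<beta>" "a \<le> \<alpha>" "\<beta> \<le> b" "regular_piece \<gamma> \<alpha> \<beta>" using F(2)[OF t] by blast
    have xS: "\<gamma> t \<in> S" using adm(2) t by blast
    obtain \<epsilon> where \<epsilon>: "\<epsilon> > 0" "strongly_convex (rball (\<gamma> t) \<epsilon>)"
      using pr xS unfolding prox_regular_def prox_regular_at_def by blast
    have U: "convex_nhd (\<gamma> t) (rball (\<gamma> t) \<epsilon>)"
      using \<epsilon> rball_neighbourhood by (simp add: convex_nhd_def)
    obtain c V \<psi> q Q K where cc: "cone_chart S (\<gamma> t) c V \<psi> q Q K"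
    proof (cases "\<gamma> t \<in> interior S")
      case True
      then show ?thesis using cone_chart_interior that by blast
    next
      case False
      then have "\<gamma> t \<in> frontier S" using xS closure_subset by (auto simp: frontier_def)
      then show ?thesis using cone_chart_frontier[OF S N] that by blast
    qed
    have C: "C2_curve_on \<gamma> {\<alpha>..\<beta>}" using ab(5) by (simp add: regular_piece_def)
    have "covariant_derivative \<gamma> {\<alpha>..\<beta>} (velocity \<gamma> {\<alpha>..\<beta>}) t \<in> tangent_space (\<gamma> t)"
      using covariant_derivative_tangent[OF C] at_within_Icc_neq_bot ab(1,2) by auto
    \<comment> \<open>The conclusion differentiates within \<open>{a..b}\<close>; at a point
      interior to a piece this agrees with the derivative taken on that piece.\<close>
    then have tan: "covariant_derivative \<gamma> {a..b} (velocity \<gamma> {a..b}) t \<in> tangent_space (\<gamma> t)"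
      using covariant_derivative_interior[OF ab(3,4,1,2)] by simp
    show ?thesis
      by (rule proximal_normal_cone_chartI[OF cc xS U tan])
        (rule acceleration_nonpos_on_cone[OF min us ab(5,3,1,2,4) cc])
  qed
  then show ?thesis using F(1) by blast
qed

end

theorem theorem5p3:
  fixes A :: "('m::{t2_space,second_countable_topology}, 'n::finite) chart set"
    and g :: "'m \<Rightarrow> ('m, 'n) tvec \<Rightarrow> ('m, 'n) tvec \<Rightarrow> real"
    and S :: "'m set" and k :: nat
    and \<gamma> :: "real \<Rightarrow> 'm" and a b :: real
  assumes "riemannian_manifold A g"
    and "closed S"
    and "riemannian_manifold.prox_regular A g S"
    and "smooth_manifold.C2_submanifold A k (frontier S)"
    and "smooth_manifold.admissible A S \<gamma> a b"
    and "riemannian_manifold.unit_speed A g \<gamma> a b"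
    and "riemannian_manifold.minimizing_in A g S \<gamma> a b"
  shows "\<exists>F. finite F \<and> (\<forall>t\<in>{a..b} - F.
    riemannian_manifold.covariant_derivative A g \<gamma> {a..b} (smooth_manifold.velocity A \<gamma> {a..b}) t
      \<in> riemannian_manifold.proximal_normal_cone A g S (\<gamma> t))"
  using riemannian_manifold.minimizing_acceleration_proximal[OF assms(1-4,6,7)] .

end
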